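(* Let $\mathcal{G}=\mathrm{Diff}(S^2,dV)$ be the group of area-preserving diffeomorphisms of the two-sphere and $\widetilde{\mathcal{G}}$ its universal cover. For every real $p>2$ the $L^p$-metrics $d_p$ on $\widetilde{\mathcal{G}}$ and on $\mathcal{G}$ are unbounded, i.e. have infinite diameter.
   Context: $S^2=\mathbb{C}P^1$ carries the standard Fubini-Study Riemannian metric and the Fubini-Study area form $dV$ scaled to have total area $2\pi$. For a (smooth) path $\{\phi_t\}_{t\in[0,1]}$ in $\mathcal{G}$ generated by the time-dependent vector field $X_t=\frac{d}{dt'}\big|_{t'=t}\phi_{t'}\circ\phi_t^{-1}$, put $l_p(\{\phi_t\})=\int_0^1\bigl(\int_{S^2}|X_t|^p\,dV\bigr)^{1/p}dt$. On $\mathcal{G}$, $d_p(\phi_0,\phi_1)=\inf l_p(\{\phi_t\})$, the infimum running over all paths in $\mathcal{G}$ from $\phi_0$ to $\phi_1$; this metric is right-invariant. Elements of $\widetilde{\mathcal{G}}$ are homotopy classes rel endpoints of paths in $\mathcal{G}$ starting at $\mathrm{Id}$; for $\widetilde\phi\in\widetilde{\mathcal{G}}$, $\|\widetilde\phi\|_p$ is the infimum of $l_p$ over all paths in the class $\widetilde\phi$, and on $\widetilde{\mathcal{G}}$ one sets $d_p(\widetilde\phi_0,\widetilde\phi_1)=\|\widetilde\phi_1\widetilde\phi_0^{-1}\|_p$. *)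

theory Defs
  imports "HOL-Analysis.Analysis"
begin

fun Ck_on :: "nat \<Rightarrow> 'a::real_normed_vector set \<Rightarrow> ('a \<Rightarrow> 'b::real_normed_vector) \<Rightarrow> bool" where
  "Ck_on 0 U f \<longleftrightarrow> continuous_on U f"
| "Ck_on (Suc k) U f \<longleftrightarrow>
     (\<forall>x\<in>U. f differentiable (at x)) \<and>
     (\<forall>v. Ck_on k U (\<lambda>x. frechet_derivative f (at x) v))"

text \<open>A map on an arbitrary subset is smooth if near each point it extends to a
  \<open>C\<^sup>\<infinity>\<close> map on an open subset of the ambient space.  For a closed submanifold, or its
  product with an interval or a square, this is the usual intrinsic smoothness.\<close>

definition smooth_on :: "'a::real_normed_vector set \<Rightarrow> ('a \<Rightarrow> 'b::real_normed_vector) \<Rightarrow> bool" where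
  "smooth_on M f \<longleftrightarrow>
     (\<forall>x\<in>M. \<exists>U g. open U \<and> x \<in> U \<and> (\<forall>k. Ck_on k U g) \<and> (\<forall>y\<in>U \<inter> M. g y = f y))"

abbreviation S2 :: "(real^3) set" where
  "S2 \<equiv> sphere 0 1"

text \<open>The point \<open>[1 : z]\<close> of \<open>\<complex>P\<^sup>1\<close> is identified with \<open>affine_chart z\<close>; the image omits only
  the point at infinity \<open>(0, 0, -1)\<close>.  Under this identification the Fubini-Study metric
  \<open>|dz|\<^sup>2 / (1 + |z|\<^sup>2)\<^sup>2\<close> is one quarter of the metric induced from \<open>\<real>\<^sup>3\<close>, and the
  Fubini-Study area form scaled to total area \<open>2\<pi>\<close>, namely \<open>2 dx \<and> dy / (1 + |z|\<^sup>2)\<^sup>2\<close>, is one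
  half of the area form induced from \<open>\<real>\<^sup>3\<close>, whose total area is \<open>4\<pi>\<close>; see the lemmas
  \<open>fs_norm_chart\<close> and \<open>fs_form_chart\<close>.\<close>

definition affine_chart :: "complex \<Rightarrow> real^3" where
  "affine_chart z =
     vector [2 * Re z / (1 + (cmod z)\<^sup>2), 2 * Im z / (1 + (cmod z)\<^sup>2),
             (1 - (cmod z)\<^sup>2) / (1 + (cmod z)\<^sup>2)]"

definition fs_norm :: "real^3 \<Rightarrow> real" where
  "fs_norm u = norm u / 2"

definition fs_form :: "real^3 \<Rightarrow> real^3 \<Rightarrow> real^3 \<Rightarrow> real" where
  "fs_form x u v = (x \<bullet> cross3 u v) / 2"

definition fs_measure :: "(real^3) measure" where
  "fs_measure =
     distr (density lborel (\<lambda>z. ennreal (2 / (1 + (cmod z)\<^sup>2)\<^sup>2))) borel affine_chart"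

lemma affine_chart_in_S2: "affine_chart z \<in> S2"
proof -
  have p: "1 + ((Re z)\<^sup>2 + (Im z)\<^sup>2) > 0"
    by (smt (verit) zero_le_power2)
  have "(norm (affine_chart z))\<^sup>2 = 1"
    using p unfolding power2_norm_eq_inner
    by (simp add: affine_chart_def inner_vec_def sum_3 cmod_power2 divide_simps)
       (simp add: algebra_simps power2_eq_square)
  then show ?thesis
    by (simp add: power2_eq_1_iff) (smt (verit) norm_ge_zero)
qed

lemma affine_chart_derivative:
  fixes z :: complex
  defines "r \<equiv> 1 + (cmod z)\<^sup>2"
  shows "(affine_chart has_derivative
     (\<lambda>h. vector [2 * Re h / r - 4 * Re z * (Re z * Re h + Im z * Im h) / r\<^sup>2,
                  2 * Im h / r - 4 * Im z * (Re z * Re h + Im z * Im h) / r\<^sup>2,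
                  - 4 * (Re z * Re h + Im z * Im h) / r\<^sup>2])) (at z)"
proof -
  have p: "1 + ((Re z)\<^sup>2 + (Im z)\<^sup>2) > 0"
    by (smt (verit) zero_le_power2)
  have vec: "(f has_derivative D) (at z)"
    if f: "((\<lambda>w. f w $ 1) has_derivative (\<lambda>h. D h $ 1)) (at z)"
       "((\<lambda>w. f w $ 2) has_derivative (\<lambda>h. D h $ 2)) (at z)"
       "((\<lambda>w. f w $ 3) has_derivative (\<lambda>h. D h $ 3)) (at z)" for f D :: "complex \<Rightarrow> real^3"
  proof (subst has_derivative_componentwise_within, intro ballI)
    fix b :: "real^3" assume "b \<in> Basis"
    then obtain i where b: "b = axis i 1" by (auto simp: Basis_vec_def)
    have "i = 1 \<or> i = 2 \<or> i = 3" by (rule exhaust_3)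
    with f show "((\<lambda>w. f w \<bullet> b) has_derivative (\<lambda>h. D h \<bullet> b)) (at z)"
      unfolding b inner_axis by auto
  qed
  let ?q = "\<lambda>w. 1 + ((Re w)\<^sup>2 + (Im w)\<^sup>2)"
  have q: "(?q has_derivative (\<lambda>h. 2 * (Re z * Re h + Im z * Im h))) (at z)"
    by (rule has_derivative_eq_rhs, (rule derivative_intros)+) (simp add: fun_eq_iff)
  have quot: "((\<lambda>w. g w / ?q w) has_derivative
      (\<lambda>h. D h / ?q z - g z * (2 * (Re z * Re h + Im z * Im h)) / (?q z)\<^sup>2)) (at z)"
    if "(g has_derivative D) (at z)" for g D
    by (rule has_derivative_eq_rhs, rule has_derivative_divide[OF that q])
       (use p in \<open>simp_all add: fun_eq_iff divide_simps power2_eq_square\<close>)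
  show ?thesis
    unfolding affine_chart_def r_def cmod_power2
  proof (rule vec; simp only: vector_3)
    show "((\<lambda>w. 2 * Re w / ?q w) has_derivative
        (\<lambda>h. 2 * Re h / ?q z - 4 * Re z * (Re z * Re h + Im z * Im h) / (?q z)\<^sup>2)) (at z)"
      by (rule has_derivative_eq_rhs, rule quot, (rule derivative_intros)+)
         (simp add: fun_eq_iff)
    show "((\<lambda>w. 2 * Im w / ?q w) has_derivative
        (\<lambda>h. 2 * Im h / ?q z - 4 * Im z * (Re z * Re h + Im z * Im h) / (?q z)\<^sup>2)) (at z)"
      by (rule has_derivative_eq_rhs, rule quot, (rule derivative_intros)+)
         (simp add: fun_eq_iff)
    have d: "((\<lambda>w. 1 - ((Re w)\<^sup>2 + (Im w)\<^sup>2)) has_derivative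
        (\<lambda>h. - 2 * (Re z * Re h + Im z * Im h))) (at z)"
      by (rule has_derivative_eq_rhs, (rule derivative_intros)+) (simp add: fun_eq_iff)
    show "((\<lambda>w. (1 - ((Re w)\<^sup>2 + (Im w)\<^sup>2)) / ?q w) has_derivative
        (\<lambda>h. - 4 * (Re z * Re h + Im z * Im h) / (?q z)\<^sup>2)) (at z)"
      by (rule has_derivative_eq_rhs, rule quot, rule d)
         (use p in \<open>simp add: fun_eq_iff divide_simps\<close>, simp add: algebra_simps power2_eq_square)
  qed
qed

lemma affine_chart_measurable: "affine_chart \<in> borel_measurable borel"
  by (intro borel_measurable_continuous_onI continuous_at_imp_continuous_on ballI
      has_derivative_continuous[OF affine_chart_derivative])

lemma fs_norm_chart:
  assumes "(affine_chart has_derivative D) (at z)"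
  shows "fs_norm (D h) = cmod h / (1 + (cmod z)\<^sup>2)"
proof -
  let ?r = "1 + (cmod z)\<^sup>2"
  have p: "?r > 0" by (smt (verit) zero_le_power2)
  have r: "(Re z)\<^sup>2 + (Im z)\<^sup>2 = ?r - 1" by (simp add: cmod_power2)
  define s where "s = Re z * Re h + Im z * Im h"
  have D: "D h = (1 / ?r\<^sup>2) *\<^sub>R vector [2 * ?r * Re h - 4 * Re z * s, 2 * ?r * Im h - 4 * Im z * s, - 4 * s]"
    using p has_derivative_unique[OF assms affine_chart_derivative]
    by (simp add: s_def vec_eq_iff forall_3 divide_simps power2_eq_square[of ?r])
  have ring: "(2*r*c - 4*a*(a*c + b*d))\<^sup>2 + (2*r*d - 4*b*(a*c + b*d))\<^sup>2 + (- 4*(a*c + b*d))\<^sup>2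
      = 4 * r\<^sup>2 * (c\<^sup>2 + d\<^sup>2)"
    if "a\<^sup>2 + b\<^sup>2 = r - 1" for a b c d r :: real
    using that by algebra
  have vec: "(norm (vector [a, b, c] :: real^3))\<^sup>2 = a\<^sup>2 + b\<^sup>2 + c\<^sup>2" for a b c :: real
    unfolding power2_norm_eq_inner inner_vec_def sum_3 by (simp add: power2_eq_square)
  have "(norm (D h))\<^sup>2 = (1 / ?r\<^sup>2)\<^sup>2 * (4 * ?r\<^sup>2 * (cmod h)\<^sup>2)"
    unfolding D norm_scaleR power_mult_distrib[of "\<bar>_\<bar>"] vec s_def power2_abs
      ring[OF r] cmod_power2[of h] ..
  also have "\<dots> = (2 * cmod h / ?r)\<^sup>2"
    using p by (simp add: power2_eq_square)
  finally have "norm (D h) = 2 * cmod h / ?r"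
    using p by (simp add: power2_eq_iff_nonneg)
  then show ?thesis using p by (simp add: fs_norm_def divide_simps)
qed

lemma fs_form_chart:
  assumes "(affine_chart has_derivative D) (at z)"
  shows "fs_form (affine_chart z) (D 1) (D \<i>) = 2 / (1 + (cmod z)\<^sup>2)\<^sup>2"
proof -
  let ?r = "1 + (cmod z)\<^sup>2"
  have p: "?r > 0" by (smt (verit) zero_le_power2)
  have r: "?r = 1 + (Re z)\<^sup>2 + (Im z)\<^sup>2" by (simp add: cmod_power2)
  have D: "D 1 = vector [2 / ?r - 4 * Re z * Re z / ?r\<^sup>2, - 4 * Im z * Re z / ?r\<^sup>2, - 4 * Re z / ?r\<^sup>2]"
          "D \<i> = vector [- 4 * Re z * Im z / ?r\<^sup>2, 2 / ?r - 4 * Im z * Im z / ?r\<^sup>2, - 4 * Im z / ?r\<^sup>2]"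
    using has_derivative_unique[OF assms affine_chart_derivative] by simp_all
  have ring: "((2*a) * ((-4*b*a) * (-4*b) - (-4*a) * (2*r-4*b*b))
      + (2*b) * ((-4*a) * (-4*a*b) - (2*r-4*a*a) * (-4*b))
      + (2 - r) * ((2*r-4*a*a) * (2*r-4*b*b) - (-4*b*a) * (-4*a*b))) = 4 * r^3"
    if "r = 1 + a\<^sup>2 + b\<^sup>2" for a b r :: real
    using that by algebra
  have scale: "(1 / r) * (1 / r\<^sup>2) * (1 / r\<^sup>2) * (4 * r^3) / 2 = 2 / r\<^sup>2" if "r > 0" for r :: real
    using that by (simp add: power2_eq_square power3_eq_cube)
  have chart: "affine_chart z = (1 / ?r) *\<^sub>R vector [2 * Re z, 2 * Im z, 2 - ?r]"
    by (simp add: affine_chart_def vec_eq_iff forall_3)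
  have D': "D 1 = (1 / ?r\<^sup>2) *\<^sub>R vector [2 * ?r - 4 * Re z * Re z, - 4 * Im z * Re z, - 4 * Re z]"
       "D \<i> = (1 / ?r\<^sup>2) *\<^sub>R vector [- 4 * Re z * Im z, 2 * ?r - 4 * Im z * Im z, - 4 * Im z]"
    using p unfolding D by (simp_all add: vec_eq_iff forall_3 divide_simps power2_eq_square[of ?r])
  have "fs_form (affine_chart z) (D 1) (D \<i>) = (1 / ?r) * (1 / ?r\<^sup>2) * (1 / ?r\<^sup>2) * (4 * ?r^3) / 2"
    unfolding fs_form_def chart D' cross_mult_left cross_mult_right inner_scaleR_left
      inner_scaleR_right ring[OF r, symmetric]
    by (simp add: cross3_def inner_vec_def sum_3)
  also have "\<dots> = 2 / ?r\<^sup>2"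
    using scale[OF p] .
  finally show ?thesis .
qed

definition area_diffeos :: "(real^3 \<Rightarrow> real^3) set" where
  "area_diffeos =
     {\<phi> \<in> extensional S2. bij_betw \<phi> S2 S2 \<and> smooth_on S2 \<phi> \<and> smooth_on S2 (inv_into S2 \<phi>) \<and>
        (\<forall>x\<in>S2. \<forall>D. (\<phi> has_derivative D) (at x within S2) \<longrightarrow>
           (\<forall>u v. x \<bullet> u = 0 \<and> x \<bullet> v = 0 \<longrightarrow> fs_form (\<phi> x) (D u) (D v) = fs_form x u v))}"

text \<open>The derivative of \<open>\<phi>\<close> within the sphere is unique only on tangent vectors, that is
  on vectors orthogonal to \<open>x\<close>.  Preserving the form, and not just the measure, makes
  \<open>\<phi>\<close> orientation preserving.\<close>

definition is_path :: "(real \<Rightarrow> real^3 \<Rightarrow> real^3) \<Rightarrow> bool" where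
  "is_path \<gamma> \<longleftrightarrow> (\<forall>t\<in>{0..1}. \<gamma> t \<in> area_diffeos) \<and>
                smooth_on ({0..1} \<times> S2) (\<lambda>(t, x). \<gamma> t x)"

definition generator :: "(real \<Rightarrow> real^3 \<Rightarrow> real^3) \<Rightarrow> real \<Rightarrow> real^3 \<Rightarrow> real^3" where
  "generator \<gamma> t x =
     vector_derivative (\<lambda>s. \<gamma> s (inv_into S2 (\<gamma> t) x)) (at t within {0..1})"

definition lp_length :: "real \<Rightarrow> (real \<Rightarrow> real^3 \<Rightarrow> real^3) \<Rightarrow> real" where
  "lp_length p \<gamma> =
     integral {0..1} (\<lambda>t. (LINT x|fs_measure. fs_norm (generator \<gamma> t x) powr p) powr (1 / p))"

text \<open>The infimum below is over a nonempty set, since the group is path connected.\<close>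

definition dist_G :: "real \<Rightarrow> (real^3 \<Rightarrow> real^3) \<Rightarrow> (real^3 \<Rightarrow> real^3) \<Rightarrow> real" where
  "dist_G p \<phi>\<^sub>0 \<phi>\<^sub>1 = Inf {lp_length p \<gamma> | \<gamma>. is_path \<gamma> \<and> \<gamma> 0 = \<phi>\<^sub>0 \<and> \<gamma> 1 = \<phi>\<^sub>1}"

definition based_paths :: "(real \<Rightarrow> real^3 \<Rightarrow> real^3) set" where
  "based_paths = {\<gamma>. is_path \<gamma> \<and> \<gamma> 0 = restrict id S2}"

definition homotopy_rel :: "((real \<Rightarrow> real^3 \<Rightarrow> real^3) \<times> (real \<Rightarrow> real^3 \<Rightarrow> real^3)) set" where
  "homotopy_rel =
     {(\<alpha>, \<beta>). \<alpha> \<in> based_paths \<and> \<beta> \<in> based_paths \<and>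
        (\<exists>H :: real \<Rightarrow> real \<Rightarrow> real^3 \<Rightarrow> real^3.
             (\<forall>s\<in>{0..1}. \<forall>t\<in>{0..1}. H s t \<in> area_diffeos) \<and>
             smooth_on ({0..1} \<times> {0..1} \<times> S2) (\<lambda>(s, t, x). H s t x) \<and>
             (\<forall>t\<in>{0..1}. H 0 t = \<alpha> t \<and> H 1 t = \<beta> t) \<and>
             (\<forall>s\<in>{0..1}. H s 0 = \<alpha> 0 \<and> H s 1 = \<alpha> 1))}"

text \<open>Smooth homotopies with fixed endpoints between smooth paths: by smoothing, these give the
  same classes as continuous paths and homotopies for the \<open>C\<^sup>\<infinity>\<close> topology.  Values of a path
  outside \<open>[0, 1]\<close> play no role, and paths agreeing on \<open>[0, 1]\<close> are homotopic.\<close>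

definition universal_cover :: "(real \<Rightarrow> real^3 \<Rightarrow> real^3) set set" where
  "universal_cover = based_paths // homotopy_rel"

definition cover_mult ::
  "(real \<Rightarrow> real^3 \<Rightarrow> real^3) set \<Rightarrow> (real \<Rightarrow> real^3 \<Rightarrow> real^3) set \<Rightarrow> (real \<Rightarrow> real^3 \<Rightarrow> real^3) set"
  where "cover_mult A B =
     (\<Union>\<alpha>\<in>A. \<Union>\<beta>\<in>B. homotopy_rel `` {\<lambda>t. compose S2 (\<alpha> t) (\<beta> t)})"

definition cover_inv :: "(real \<Rightarrow> real^3 \<Rightarrow> real^3) set \<Rightarrow> (real \<Rightarrow> real^3 \<Rightarrow> real^3) set" where
  "cover_inv A = (\<Union>\<alpha>\<in>A. homotopy_rel `` {\<lambda>t. restrict (inv_into S2 (\<alpha> t)) S2})"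

definition cover_norm :: "real \<Rightarrow> (real \<Rightarrow> real^3 \<Rightarrow> real^3) set \<Rightarrow> real" where
  "cover_norm p A = Inf (lp_length p ` A)"

definition dist_cover ::
  "real \<Rightarrow> (real \<Rightarrow> real^3 \<Rightarrow> real^3) set \<Rightarrow> (real \<Rightarrow> real^3 \<Rightarrow> real^3) set \<Rightarrow> real" where
  "dist_cover p A B = cover_norm p (cover_mult B (cover_inv A))"

end

theory Submission
  imports Defs
begin

text \<open>The cross-ratio \<open>\<lambda>\<close> of four points of the sphere has argument zero when its first two entries
  agree.  Moving the second entry to the first therefore shows that the total variation of
  \<open>arg \<lambda>(\<gamma>\<^sub>t x\<^sub>1, \<dots>, \<gamma>\<^sub>t x\<^sub>4)\<close> along a path \<open>\<gamma>\<close> from the identity to \<open>\<phi>\<close> depends on \<open>\<phi>\<close> only; no knowledge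
  of the homotopy type of the group is needed.  If \<open>\<phi>\<close> rotates each circle of latitude by \<open>k\<close> times its
  height, this variation grows linearly in \<open>k\<close> for all configurations with suitably separated latitudes.
  On the other hand the logarithmic derivative of \<open>\<lambda>\<close> is at most a constant times a sum of terms
  \<open>|X(x\<^sub>i)| / (|x\<^sub>i - x\<^sub>j| |x\<^sub>i - x\<^sub>k|)\<close>.  The inverse distance is integrable over the sphere uniformly in
  the base point and the flow preserves area, so averaging over the configurations bounds the
  variation by the \<open>L\<^sup>1\<close>-length, and hence by the \<open>L\<^sup>p\<close>-length, of \<open>\<gamma>\<close>.\<close>

section \<open>The cross-ratio as a polynomial on the sphere\<close>

text \<open>Moebius maps carry any three points of the sphere to any other three, so a cross-ratio,
  with four points, is the first invariant to look at. Its argument is lost only when one of the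
  first two points meets one of the last two. The pairs \<open>a\<close>, \<open>b\<close> and
  \<open>c\<close>, \<open>d\<close> may collide. This permits the contraction of the second point
  onto the first, and it keeps the distances inside the pairs out of the denominators. In each term
  of the estimate the two inverse distances share the moving point but have different partners, so
  they are integrated one after the other, and each needs only that 1/r is integrable on a surface.
  A polynomial in the points of R^3 replaces the quotient of coordinates because trajectories of
  \<gamma> may run through the point at infinity. The bound concerns every path that ends at the
  given twist, hence every representative of a class in the universal cover, so one estimate serves
  both diameters.\<close>

text \<open>Up to a positive factor, \<open>cr a b c d\<close> is the conjugate of the cross-ratio
  \<open>(a - c) (b - d) / ((b - c) (a - d))\<close> of the stereographic coordinates (see \<open>cr_chart\<close>): its real part comes from
  \<open>2 Re \<lambda> = 1 + |\<lambda>|\<^sup>2 - |1 - \<lambda>|\<^sup>2\<close> written in chordal distances, its imaginary part is the volume of the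
  tetrahedron \<open>a b c d\<close>.\<close>

definition cr :: "real^3 \<Rightarrow> real^3 \<Rightarrow> real^3 \<Rightarrow> real^3 \<Rightarrow> complex" where
  "cr a b c d = Complex ((1 - b \<bullet> c) * (1 - a \<bullet> d) + (1 - a \<bullet> c) * (1 - b \<bullet> d) - (1 - a \<bullet> b) * (1 - c \<bullet> d))
     ((a - d) \<bullet> cross3 (b - d) (c - d))"

text \<open>The derivative of \<open>cr\<close> in its first argument in direction \<open>v\<close>; the other three partial derivatives
  follow from \<open>cr b a c d = cnj (cr a b c d)\<close> and \<open>cr c d a b = cr a b c d\<close>.\<close>

definition cr1 :: "real^3 \<Rightarrow> real^3 \<Rightarrow> real^3 \<Rightarrow> real^3 \<Rightarrow> complex" where
  "cr1 v b c d = Complex (- (1 - b \<bullet> c) * (v \<bullet> d) - (v \<bullet> c) * (1 - b \<bullet> d) + (v \<bullet> b) * (1 - c \<bullet> d))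
     (v \<bullet> cross3 (b - d) (c - d))"

definition crd :: "real^3 \<Rightarrow> real^3 \<Rightarrow> real^3 \<Rightarrow> real^3 \<Rightarrow> real^3 \<Rightarrow> real^3 \<Rightarrow> real^3 \<Rightarrow> real^3 \<Rightarrow> complex" where
  "crd a b c d a' b' c' d' = cr1 a' b c d + cnj (cr1 b' a c d) + cr1 c' d a b + cnj (cr1 d' c a b)"

lemma unit_diff: "norm x = 1 \<Longrightarrow> norm y = 1 \<Longrightarrow> (norm (x - y))\<^sup>2 = 2 * (1 - x \<bullet> y)" for x y :: "'a::real_inner"
  by (simp add: power2_norm_eq_inner inner_diff_left inner_diff_right inner_commute norm_eq_1)

lemma triple_gram:
  fixes u v w :: "real^3"
  shows "(u \<bullet> cross3 v w)\<^sup>2 = (u\<bullet>u)*(v\<bullet>v)*(w\<bullet>w) + 2*(u\<bullet>v)*(v\<bullet>w)*(u\<bullet>w) - (u\<bullet>u)*(v\<bullet>w)\<^sup>2 - (v\<bullet>v)*(u\<bullet>w)\<^sup>2 - (w\<bullet>w)*(u\<bullet>v)\<^sup>2"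
  by (simp add: inner_vec_def sum_3 cross3_def power2_eq_square algebra_simps)

text \<open>The Gram determinant of four vectors in three-space vanishes.\<close>

lemma gram4:
  fixes a b c d :: "real^3"
  assumes n: "a\<bullet>a = 1" "b\<bullet>b = 1" "c\<bullet>c = 1" "d\<bullet>d = 1"
  shows "1 + 2*(a\<bullet>b)*(b\<bullet>c)*(a\<bullet>c) - (b\<bullet>c)\<^sup>2 - (a\<bullet>c)\<^sup>2 - (a\<bullet>b)\<^sup>2 =
    (a\<bullet>d)\<^sup>2 * (1 - (b\<bullet>c)\<^sup>2) + (b\<bullet>d)\<^sup>2 * (1 - (a\<bullet>c)\<^sup>2) + (c\<bullet>d)\<^sup>2 * (1 - (a\<bullet>b)\<^sup>2)
    + 2*(a\<bullet>d)*(b\<bullet>d)*((b\<bullet>c)*(a\<bullet>c) - a\<bullet>b) + 2*(a\<bullet>d)*(c\<bullet>d)*((a\<bullet>b)*(b\<bullet>c) - a\<bullet>c)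
    + 2*(b\<bullet>d)*(c\<bullet>d)*((a\<bullet>c)*(a\<bullet>b) - b\<bullet>c)"
proof -
  note s = inner_commute[of d a] inner_commute[of d b] inner_commute[of d c] inner_commute[of c a] inner_commute[of c b] inner_commute[of b a]
  let ?t = "a \<bullet> cross3 b c"
  \<comment> \<open>Expansion of \<open>d\<close> in the basis dual to \<open>a\<close>,
    \<open>b\<close>, \<open>c\<close>, with the denominator cleared so that it also holds for
    dependent vectors. Comparing squared lengths and inserting \<open>triple_gram\<close> for the
    square of \<open>?t\<close> gives the relation.\<close>
  have "?t *\<^sub>R d = (a\<bullet>d) *\<^sub>R cross3 b c + (b\<bullet>d) *\<^sub>R cross3 c a + (c\<bullet>d) *\<^sub>R cross3 a b" (is "_ = ?r")
    by (simp add: vec_eq_iff forall_3 inner_vec_def sum_3 cross3_def algebra_simps)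
  then have "(?t *\<^sub>R d) \<bullet> (?t *\<^sub>R d) = ?r \<bullet> ?r" by simp
  then have "?t\<^sup>2 = ?r \<bullet> ?r" using n by (simp add: power2_eq_square)
  then show ?thesis
    unfolding triple_gram inner_add_left inner_add_right inner_scaleR_left inner_scaleR_right dot_cross
    by (simp add: n s power2_eq_square algebra_simps)
qed

text \<open>The squared modulus factors into the four terms \<open>1 - x \<bullet> y\<close> only
  modulo the relation \<open>gram4\<close>. The formula locates the zeros of \<open>cr\<close>, so
  an injective motion of four distinct points keeps the argument defined.\<close>

lemma cr_norm:
  assumes "norm a = 1" "norm b = 1" "norm c = 1" "norm d = 1"
  shows "cmod (cr a b c d) = norm (a - c) * norm (b - d) * norm (b - c) * norm (a - d) / 2"
proof -
  have n: "a\<bullet>a = 1" "b\<bullet>b = 1" "c\<bullet>c = 1" "d\<bullet>d = 1" using assms by (simp_all add: norm_eq_1)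
  note s = inner_commute[of d a] inner_commute[of d b] inner_commute[of d c] inner_commute[of c a] inner_commute[of c b] inner_commute[of b a]
  have "(cmod (cr a b c d))\<^sup>2 = 4 * (1 - a\<bullet>c) * (1 - b\<bullet>d) * (1 - b\<bullet>c) * (1 - a\<bullet>d)"
    using gram4[OF n]
    unfolding cmod_power2 cr_def complex.sel triple_gram
    by (simp add: inner_diff_left inner_diff_right n s power2_eq_square algebra_simps)
  also have "\<dots> = (norm (a - c) * norm (b - d) * norm (b - c) * norm (a - d) / 2)\<^sup>2"
    by (simp add: power_mult_distrib power_divide unit_diff assms algebra_simps)
  finally show ?thesis by (simp add: power2_eq_iff_nonneg)
qed

text \<open>The volume degenerates and the remaining product is a square. If \<open>a\<close>
  differs from \<open>c\<close> and \<open>d\<close> the value is positive, which fixes the argument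
  as zero where the first two points coincide.\<close>

lemma cr_same:
  assumes "norm a = 1" "norm c = 1" "norm d = 1"
  shows "cr a a c d = of_real ((norm (a - c) * norm (a - d))\<^sup>2 / 2)"
proof -
  have "a \<bullet> a = 1" using assms by (simp add: norm_eq_1)
  moreover have "(a - d) \<bullet> cross3 (a - d) (c - d) = 0" by (simp add: dot_cross_self)
  ultimately show ?thesis
    by (simp add: complex_eq_iff cr_def power_mult_distrib unit_diff assms algebra_simps)
qed

text \<open>With p = c - b and q = d - b, the real part pairs \<open>v\<close> with a combination of
  |p|^2 q, |q|^2 p and (p . q) b, and the imaginary part pairs \<open>v\<close> with the cross
  product of p and q. Chords have length at most 2, so each of these is at most |p| |q|; three terms
  and one term make the constant 4.\<close>

lemma cr1_bound:
  assumes "norm b = 1" "norm c = 1" "norm d = 1"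
  shows "cmod (cr1 v b c d) \<le> 4 * norm v * norm (b - c) * norm (b - d)"
proof -
  let ?p = "c - b" let ?q = "d - b"
  have n: "b\<bullet>b = 1" "c\<bullet>c = 1" "d\<bullet>d = 1" using assms by (simp_all add: norm_eq_1)
  have re: "Re (cr1 v b c d) = v \<bullet> (- ((norm ?p)\<^sup>2 / 2) *\<^sub>R ?q - ((norm ?q)\<^sup>2 / 2) *\<^sub>R ?p - (?p \<bullet> ?q) *\<^sub>R b)"
    unfolding cr1_def power2_norm_eq_inner
    by (simp add: inner_diff_left inner_diff_right n inner_commute[of d v] inner_commute[of d b] inner_commute[of d c] inner_commute[of c v] inner_commute[of c b] inner_commute[of b v])
       (simp add: field_simps)
  have np: "norm ?p \<le> 2" "norm ?q \<le> 2" using assms norm_triangle_ineq4[of c b] norm_triangle_ineq4[of d b] by auto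
  have "norm (- ((norm ?p)\<^sup>2 / 2) *\<^sub>R ?q - ((norm ?q)\<^sup>2 / 2) *\<^sub>R ?p - (?p \<bullet> ?q) *\<^sub>R b) 
     \<le> (norm ?p)\<^sup>2 / 2 * norm ?q + (norm ?q)\<^sup>2 / 2 * norm ?p + \<bar>?p \<bullet> ?q\<bar> * norm b"
    by (rule order_trans[OF norm_triangle_ineq4 add_mono[OF order_trans[OF norm_triangle_ineq4]]]) simp_all
  also have "\<dots> \<le> norm ?p * norm ?q + norm ?q * norm ?p + norm ?p * norm ?q"
    using Cauchy_Schwarz_ineq2[of ?p ?q] mult_right_mono[OF np(1), of "norm ?p * norm ?q"] mult_right_mono[OF np(2), of "norm ?p * norm ?q"] assms
    by (intro add_mono) (simp_all add: power2_eq_square algebra_simps)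
  finally have B: "\<bar>Re (cr1 v b c d)\<bar> \<le> norm v * (3 * norm ?p * norm ?q)"
    unfolding re by (intro order_trans[OF Cauchy_Schwarz_ineq2] mult_left_mono) auto
  have "cross3 (b - d) (c - d) = cross3 ?p ?q"
    by (simp add: cross3_def vec_eq_iff forall_3 algebra_simps)
  then have "\<bar>Im (cr1 v b c d)\<bar> \<le> norm v * norm (cross3 ?p ?q)"
    by (simp add: cr1_def Cauchy_Schwarz_ineq2)
  also have "norm (cross3 ?p ?q) \<le> norm ?p * norm ?q"
    by (rule power2_le_imp_le) (use norm_cross[of ?p ?q] zero_le_power2[of "?p\<bullet>?q"] in \<open>auto simp: power_mult_distrib\<close>)
  finally have C: "\<bar>Im (cr1 v b c d)\<bar> \<le> norm v * (norm ?p * norm ?q)" by (simp add: mult_left_mono)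
  show ?thesis using cmod_le[of "cr1 v b c d"] B C by (simp add: norm_minus_commute algebra_simps)
qed

text \<open>The two distances in the bound for a partial derivative also occur in
  \<open>cr_norm\<close> and cancel. What is left are the inverse distances from the moving point to
  the opposite pair. The 8 is the 4 of \<open>cr1_bound\<close> divided by the 1/2 of
  \<open>cr_norm\<close>.\<close>

lemma crd_bound:
  assumes n: "norm a = 1" "norm b = 1" "norm c = 1" "norm d = 1"
    and ne: "a \<noteq> c" "a \<noteq> d" "b \<noteq> c" "b \<noteq> d"
  shows "cmod (crd a b c d a' b' c' d') / cmod (cr a b c d) \<le>
    8 * (norm a' * (1 / norm (a - c) * (1 / norm (a - d))) + norm b' * (1 / norm (b - c) * (1 / norm (b - d)))
     + norm c' * (1 / norm (c - a) * (1 / norm (c - b))) + norm d' * (1 / norm (d - a) * (1 / norm (d - b))))"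
proof -
  have p: "norm (a - c) > 0" "norm (a - d) > 0" "norm (b - c) > 0" "norm (b - d) > 0" using ne by auto
  have c: "norm (c - a) = norm (a - c)" "norm (c - b) = norm (b - c)" "norm (d - a) = norm (a - d)" "norm (d - b) = norm (b - d)"
    by (simp_all add: norm_minus_commute)
  have "cmod (crd a b c d a' b' c' d') \<le> cmod (cr1 a' b c d) + cmod (cr1 b' a c d) + cmod (cr1 c' d a b) + cmod (cr1 d' c a b)"
    unfolding crd_def by (intro order_trans[OF norm_triangle_ineq] add_mono) auto
  also have "\<dots> \<le> 4 * norm a' * norm (b - c) * norm (b - d) + 4 * norm b' * norm (a - c) * norm (a - d)
     + 4 * norm c' * norm (a - d) * norm (b - d) + 4 * norm d' * norm (a - c) * norm (b - c)"
    using cr1_bound[OF n(2,3,4), of a'] cr1_bound[OF n(1,3,4), of b'] cr1_bound[OF n(4,1,2), of c'] cr1_bound[OF n(3,1,2), of d']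
    unfolding c by linarith
  finally have "cmod (crd a b c d a' b' c' d') / cmod (cr a b c d) \<le> (4 * norm a' * norm (b - c) * norm (b - d) + 4 * norm b' * norm (a - c) * norm (a - d)
     + 4 * norm c' * norm (a - d) * norm (b - d) + 4 * norm d' * norm (a - c) * norm (b - c)) / cmod (cr a b c d)"
    by (rule divide_right_mono) simp
  also have "\<dots> = 8 * (norm a' * (1 / norm (a - c) * (1 / norm (a - d))) + norm b' * (1 / norm (b - c) * (1 / norm (b - d)))
     + norm c' * (1 / norm (c - a) * (1 / norm (c - b))) + norm d' * (1 / norm (d - a) * (1 / norm (d - b))))"
    unfolding cr_norm[OF n] c using p by (simp add: divide_simps)
  finally show ?thesis .
qed

section \<open>Differentiation of the cross-ratio along moving points\<close>

lemma DERIV_inner: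
  fixes f g :: "real \<Rightarrow> 'a::real_inner"
  assumes "(f has_vector_derivative f') (at t within T)" "(g has_vector_derivative g') (at t within T)"
  shows "((\<lambda>s. f s \<bullet> g s) has_real_derivative f' \<bullet> g t + f t \<bullet> g') (at t within T)"
  using has_derivative_inner[OF assms[unfolded has_vector_derivative_def]]
  by (rule has_derivative_imp_has_field_derivative) (simp add: algebra_simps)

lemma cross3_vector_derivative:
  assumes "(f has_vector_derivative f') (at t within T)" "(g has_vector_derivative g') (at t within T)"
  shows "((\<lambda>s. cross3 (f s) (g s)) has_vector_derivative cross3 (f t) g' + cross3 f' (g t)) (at t within T)"
  using bounded_bilinear.has_vector_derivative[OF _ assms, of cross3]
  by (simp add: bilinear_conv_bounded_bilinear[symmetric] bilinear_cross)

lemma has_vector_derivative_Complex: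
  assumes "(f has_real_derivative f') (at t within T)" "(g has_real_derivative g') (at t within T)"
  shows "((\<lambda>s. Complex (f s) (g s)) has_vector_derivative Complex f' g') (at t within T)"
  using has_vector_derivative_add[OF has_vector_derivative_of_real[OF assms(1), where 'a=complex] has_vector_derivative_mult_right[OF has_vector_derivative_of_real[OF assms(2), where 'a=complex], of \<i>]]
  by (simp add: Complex_eq)

lemma cr_derivative:
  assumes D: "(a has_vector_derivative a') (at t within T)" "(b has_vector_derivative b') (at t within T)"
    "(c has_vector_derivative c') (at t within T)" "(d has_vector_derivative d') (at t within T)"
  shows "((\<lambda>s. cr (a s) (b s) (c s) (d s)) has_vector_derivative crd (a t) (b t) (c t) (d t) a' b' c' d') (at t within T)"
proof -
  define R where "R = Re (crd (a t) (b t) (c t) (d t) a' b' c' d')"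
  define I where "I = Im (crd (a t) (b t) (c t) (d t) a' b' c' d')"
  have R: "((\<lambda>s. (1 - b s \<bullet> c s) * (1 - a s \<bullet> d s) + (1 - a s \<bullet> c s) * (1 - b s \<bullet> d s) - (1 - a s \<bullet> b s) * (1 - c s \<bullet> d s)) has_real_derivative R) (at t within T)"
    by (rule derivative_eq_intros DERIV_inner D refl)+
       (simp add: R_def crd_def cr1_def inner_commute algebra_simps)
  have "a' \<bullet> cross3 (b t - d t) (c t - d t) - b' \<bullet> cross3 (a t - d t) (c t - d t) + 
    c' \<bullet> cross3 (d t - b t) (a t - b t) - d' \<bullet> cross3 (c t - b t) (a t - b t) =
    (a t - d t) \<bullet> (cross3 (b t - d t) (c' - d') + cross3 (b' - d') (c t - d t)) + (a' - d') \<bullet> cross3 (b t - d t) (c t - d t)"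
    by (simp add: inner_vec_def sum_3 cross3_def power2_eq_square algebra_simps)
  then have I: "((\<lambda>s. (a s - d s) \<bullet> cross3 (b s - d s) (c s - d s)) has_real_derivative I) (at t within T)"
    by (intro DERIV_cong[OF DERIV_inner[OF has_vector_derivative_diff[OF D(1,4)] cross3_vector_derivative[OF has_vector_derivative_diff[OF D(2,4)] has_vector_derivative_diff[OF D(3,4)]]]])
       (simp add: I_def crd_def cr1_def)
  show ?thesis
    using has_vector_derivative_Complex[OF R I]
    by (simp add: cr_def R_def I_def)
qed

section \<open>Continuous arguments of complex paths\<close>

lemma cis_eq_1_iff: "cis x = 1 \<longleftrightarrow> (\<exists>n::int. x = of_int n * 2 * pi)"
  unfolding complex_eq_iff cis.simps one_complex.simps
  using cos_one_2pi_int[of x] sin_zero_iff_int2[of x] by auto (metis cos_one_sin_zero)+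

text \<open>The values lie in 2 pi Z, whose points are at least 2 pi apart, so a continuous function
  on a connected set cannot pass from one to another.\<close>

lemma cis_1_constant:
  fixes g :: "'a::topological_space \<Rightarrow> real"
  assumes "connected S" "continuous_on S g" "\<And>x. x \<in> S \<Longrightarrow> cis (g x) = 1" "x \<in> S" "y \<in> S"
  shows "g x = g y"
proof -
  have "\<exists>e>0. \<forall>y. y \<in> S \<and> g y \<noteq> g x \<longrightarrow> e \<le> norm (g y - g x)" if x: "x \<in> S" for x
  proof (intro exI[of _ "2 * pi"] conjI allI impI)
    fix y assume y: "y \<in> S \<and> g y \<noteq> g x"
    obtain m n :: int where m: "g x = of_int m * 2 * pi" "g y = of_int n * 2 * pi"
      using assms(3)[OF x] assms(3)[of y] y by (auto simp: cis_eq_1_iff)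
    have "1 \<le> \<bar>real_of_int n - of_int m\<bar>" using m y by (cases "n = m") auto
    then have "2 * pi * 1 \<le> 2 * pi * \<bar>real_of_int n - of_int m\<bar>" by (intro mult_left_mono) auto
    also have "\<dots> = \<bar>2 * pi * (real_of_int n - of_int m)\<bar>" by (simp only: abs_mult) simp
    also have "2 * pi * (real_of_int n - of_int m) = g y - g x" by (simp add: m algebra_simps)
    finally show "2 * pi \<le> norm (g y - g x)" by simp
  qed auto
  then have "g constant_on S"
    by (intro continuous_discrete_range_constant assms)
  then show ?thesis using assms(4,5) by (auto simp: constant_on_def)
qed

lemma sgn_exp_complex: "sgn (exp z) = cis (Im z)"
  by (simp add: exp_eq_polar sgn_mult sgn_of_real)

lemma exp_pos_cis: "exp g = of_real r \<Longrightarrow> r > 0 \<Longrightarrow> cis (Im g) = 1"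
  by (metis sgn_exp_complex sgn_of_real sgn_pos of_real_1)

text \<open>Since \<open>sgn 0 = 0\<close> is no value of \<open>cis\<close>, a phase exists only
  where \<open>f\<close> has no zero. Using \<open>sgn\<close> makes positive factors such as the
  conformal weights of the chart invisible.\<close>

definition phase :: "(real \<Rightarrow> complex) \<Rightarrow> (real \<Rightarrow> real) \<Rightarrow> bool" where
  "phase f \<psi> \<longleftrightarrow> continuous_on {0..1} \<psi> \<and> (\<forall>t\<in>{0..1}. sgn (f t) = cis (\<psi> t))"

lemma phase_mult: "phase f a \<Longrightarrow> phase g b \<Longrightarrow> phase (\<lambda>t. f t * g t) (\<lambda>t. a t + b t)"
  unfolding phase_def by (auto intro!: continuous_intros simp: sgn_mult cis_mult)

lemma phase_cnj: "phase f a \<Longrightarrow> phase (\<lambda>t. cnj (f t)) (\<lambda>t. - a t)"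
  unfolding phase_def
  by (auto intro!: continuous_intros simp: cis_cnj[symmetric])
     (metis atLeastAtMost_iff complex_cnj_divide complex_cnj_complex_of_real complex_mod_cnj sgn_eq)

lemma phase_scale: "phase f a \<Longrightarrow> (\<And>t. t \<in> {0..1} \<Longrightarrow> k t > 0) \<Longrightarrow> phase (\<lambda>t. of_real (k t) * f t) a"
  unfolding phase_def by (auto simp: sgn_mult sgn_of_real)

lemma phase_rotate: "z \<noteq> 0 \<Longrightarrow> phase (\<lambda>t. z * cis (c * t)) (\<lambda>t. Arg z + c * t)"
  unfolding phase_def by (auto intro!: continuous_intros simp: sgn_mult cis_mult[symmetric] cis_Arg)

text \<open>The integral \<open>I\<close> of f'/f is a logarithm of \<open>f t / f 0\<close>,
  because f exp(-I) has derivative zero. Any phase then has the same increment as Im I, which is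
  bounded by the integral of |f'/f|.\<close>

lemma phase_lower_bound:
  fixes f f' :: "real \<Rightarrow> complex"
  assumes D: "\<And>t. t \<in> {0..1} \<Longrightarrow> (f has_vector_derivative f' t) (at t within {0..1})"
    and c': "continuous_on {0..1} f'" and nz: "\<And>t. t \<in> {0..1} \<Longrightarrow> f t \<noteq> 0"
    and ph: "phase f \<psi>"
  shows "\<bar>\<psi> 1 - \<psi> 0\<bar> \<le> integral {0..1} (\<lambda>t. cmod (f' t) / cmod (f t))"
proof -
  have cp: "continuous_on {0..1} \<psi>" using ph by (simp add: phase_def)
  have cf: "continuous_on {0..1} f" 
    using D has_vector_derivative_continuous continuous_on_eq_continuous_within by blast
  have cq: "continuous_on {0..1} (\<lambda>t. f' t / f t)" by (intro continuous_intros c' cf) (use nz in auto)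
  define I where "I = (\<lambda>t. integral {0..t} (\<lambda>t. f' t / f t))"
  have DI: "(I has_vector_derivative f' t / f t) (at t within {0..1})" if "t \<in> {0..1}" for t
    unfolding I_def using integral_has_vector_derivative[OF cq that] .
  have cI: "continuous_on {0..1} I"
    using DI has_vector_derivative_continuous continuous_on_eq_continuous_within by blast
  have "((\<lambda>t. f t * exp (- I t)) has_derivative (\<lambda>h. 0)) (at t within {0..1})" if t: "t \<in> {0..1}" for t
  proof -
    have "((exp \<circ> (\<lambda>t. - I t)) has_vector_derivative (- (f' t / f t)) * exp (- I t)) (at t within {0..1})"
      by (rule field_vector_diff_chain_within[OF has_vector_derivative_minus[OF DI[OF t]] has_field_derivative_at_within[OF DERIV_exp]])
    from has_vector_derivative_mult[OF D[OF t] this]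
    show ?thesis using nz[OF t] by (simp add: o_def has_vector_derivative_def)
  qed
  then have "\<exists>C. \<forall>t\<in>{0..1}. f t * exp (- I t) = C"
    by (intro has_derivative_zero_constant) auto
  then obtain C where C: "\<And>t. t \<in> {0..1} \<Longrightarrow> f t * exp (- I t) = C" by blast
  have I0: "I 0 = 0" by (simp add: I_def)
  have e: "f t = f 0 * exp (I t)" if "t \<in> {0..1}" for t
    using C[OF that] C[of 0] I0 by (simp add: exp_minus field_simps)
  have one: "cis (\<psi> t - \<psi> 0 - Im (I t)) = 1" if t: "t \<in> {0..1}" for t
  proof -
    have "sgn (f t) = sgn (f 0) * sgn (exp (I t))" using e[OF t] by (simp add: sgn_mult)
    then have "cis (\<psi> t) = cis (\<psi> 0) * cis (Im (I t))" using ph t by (simp add: sgn_exp_complex phase_def)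
    then show ?thesis by (simp add: cis_divide[symmetric])
  qed
  have "\<psi> 1 - \<psi> 0 - Im (I 1) = \<psi> 0 - \<psi> 0 - Im (I 0)"
    by (rule cis_1_constant[of "{0..1::real}" "\<lambda>t. \<psi> t - \<psi> 0 - Im (I t)"]) (auto intro!: continuous_intros cp cI one)
  then have "\<bar>\<psi> 1 - \<psi> 0\<bar> \<le> norm (I 1)" using abs_Im_le_cmod[of "I 1"] I0 by simp
  also have "\<dots> \<le> integral {0..1} (\<lambda>t. cmod (f' t) / cmod (f t))"
    unfolding I_def
    by (intro integral_norm_bound_integral integrable_continuous_real cq continuous_intros c' cf)
       (use nz in \<open>auto simp: norm_divide\<close>)
  finally show ?thesis .
qed

text \<open>A logarithm of \<open>M / N\<close> on the square has constant imaginary part on three of the sides.\<close>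

lemma phase_transfer:
  fixes M N :: "real \<Rightarrow> real \<Rightarrow> complex"
  assumes cM: "continuous_on ({0..1} \<times> {0..1}) (\<lambda>(s,t). M s t)"
    and cN: "continuous_on ({0..1} \<times> {0..1}) (\<lambda>(s,t). N s t)"
    and M: "\<And>s t. s \<in> {0..1} \<Longrightarrow> t \<in> {0..1} \<Longrightarrow> M s t \<noteq> 0"
    and N: "\<And>s t. s \<in> {0..1} \<Longrightarrow> t \<in> {0..1} \<Longrightarrow> N s t \<noteq> 0"
    and e0: "\<And>s. s \<in> {0..1} \<Longrightarrow> M s 0 = N s 0" and e1: "\<And>s. s \<in> {0..1} \<Longrightarrow> M s 1 = N s 1"
    and M0: "\<And>t. t \<in> {0..1} \<Longrightarrow> \<exists>r>0. M 0 t = of_real r" and N0: "\<And>t. t \<in> {0..1} \<Longrightarrow> \<exists>r>0. N 0 t = of_real r"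
    and ph: "phase (N 1) \<psi>"
  shows "\<exists>\<psi>'. phase (M 1) \<psi>' \<and> \<psi>' 1 - \<psi>' 0 = \<psi> 1 - \<psi> 0"
proof -
  let ?S = "{0..1::real} \<times> {0..1::real}"
  have "continuous_on ?S (\<lambda>x. (case x of (s,t) \<Rightarrow> M s t) / (case x of (s,t) \<Rightarrow> N s t))"
    by (intro continuous_intros cM cN) (use N in auto)
  moreover have "contractible ?S" by (intro convex_imp_contractible convex_Times) auto
  ultimately obtain g where g: "continuous_on ?S g" "\<And>x. x \<in> ?S \<Longrightarrow> (case x of (s,t) \<Rightarrow> M s t) / (case x of (s,t) \<Rightarrow> N s t) = exp (g x)"
    by (rule continuous_logarithm_on_contractible) (use M N in auto)
  have ge: "exp (g (s, t)) = M s t / N s t" if "s \<in> {0..1}" "t \<in> {0..1}" for s t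
    using g(2)[of "(s,t)"] that by auto
  have cg: "continuous_on {0..1} (\<lambda>s. g (s, t))" "continuous_on {0..1} (\<lambda>s. g (t, s))" if "t \<in> {0..1}" for t
    by (rule continuous_on_compose2[OF g(1)]; use that in \<open>auto intro!: continuous_intros\<close>)+
  have a: "Im (g (1, t)) = Im (g (0, t))" if "t = 0 \<or> t = 1" for t
  proof (rule cis_1_constant[of "{0..1::real}" "\<lambda>s. Im (g (s, t))"])
    show "cis (Im (g (s, t))) = 1" if "s \<in> {0..1}" for s
      by (rule exp_pos_cis[of _ 1]) (use that \<open>t = 0 \<or> t = 1\<close> e0 e1 N ge[of s t] in auto)
  qed (use that cg in \<open>auto intro!: continuous_intros\<close>)
  have "Im (g (0, 1)) = Im (g (0, 0))"
  proof (rule cis_1_constant[of "{0..1::real}" "\<lambda>t. Im (g (0, t))"])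
    show "cis (Im (g (0, t))) = 1" if t: "t \<in> {0..1}" for t
    proof -
      obtain r r' where "r > 0" "r' > 0" "M 0 t = of_real r" "N 0 t = of_real r'" using M0[OF t] N0[OF t] by blast
      then show ?thesis by (intro exp_pos_cis[of _ "r / r'"]) (use ge[of 0 t] t in auto)
    qed
  qed (use cg in \<open>auto intro!: continuous_intros\<close>)
  \<comment> \<open>The two ends of the side s = 1 are linked through the other three sides, on
    which Im g does not change. Hence adding Im g to \<psi> leaves the increment alone.\<close>
  then have "Im (g (1, 1)) = Im (g (1, 0))" using a by simp
  moreover have "phase (M 1) (\<lambda>t. \<psi> t + Im (g (1, t)))"
    unfolding phase_def
  proof (intro conjI ballI)
    show "continuous_on {0..1} (\<lambda>t. \<psi> t + Im (g (1, t)))"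
      using ph by (auto simp: phase_def intro!: continuous_intros cg(2))
    fix t :: real assume t: "t \<in> {0..1}"
    have "M 1 t = N 1 t * exp (g (1, t))" using ge[of 1 t] N[of 1 t] t by simp
    then show "sgn (M 1 t) = cis (\<psi> t + Im (g (1, t)))"
      using ph t by (simp add: phase_def sgn_mult sgn_exp_complex cis_mult)
  qed
  ultimately show ?thesis by (intro exI[of _ "\<lambda>t. \<psi> t + Im (g (1, t))"]) auto
qed

text \<open>The curve stays within distance less than 1 of the point 1, hence in the right half
  plane, where the principal argument lies between -pi/2 and pi/2.\<close>

lemma phase_one_minus:
  assumes "cmod w < 1"
  shows "\<exists>\<psi>. phase (\<lambda>t. 1 - w * cis (c * t)) \<psi> \<and> \<bar>\<psi> 1 - \<psi> 0\<bar> \<le> pi"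
proof (intro exI conjI)
  let ?f = "\<lambda>t. 1 - w * cis (c * t)"
  have pos: "Re (?f t) > 0" for t
    using abs_Re_le_cmod[of "w * cis (c * t)"] assms by (simp add: norm_mult)
  then have nz: "?f t \<noteq> 0" for t by (metis less_irrefl zero_complex.sel(1))
  have "continuous_on {0..1} (\<lambda>t. Im (Ln (?f t)))"
    using pos by (intro continuous_intros) (auto simp: complex_nonpos_Reals_iff not_le)
  moreover have "sgn (?f t) = cis (Im (Ln (?f t)))" for t
    using sgn_exp_complex[of "Ln (?f t)"] nz[of t] by simp
  ultimately show "phase ?f (\<lambda>t. Im (Ln (?f t)))" unfolding phase_def by blast
  show "\<bar>Im (Ln (?f 1)) - Im (Ln (?f 0))\<bar> \<le> pi"
    using Re_Ln_pos_lt_imp[OF pos[of 1]] Re_Ln_pos_lt_imp[OF pos[of 0]] by linarith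
qed

text \<open>In each difference the entry of larger modulus dominates, so the difference turns like
  that entry up to an error of pi. The four rates combine to a3 + a2 - (a3 + a1) = a2 - a1, with
  four errors.\<close>

lemma twist_phase:
  assumes l: "cmod z4 < cmod z1" "cmod z4 < cmod z2" "cmod z1 < cmod z3" "cmod z2 < cmod z3"
  shows "\<exists>\<psi>. phase (\<lambda>t. (z1 * cis (a1 * t) - z3 * cis (a3 * t)) * (z2 * cis (a2 * t) - z4 * cis (a4 * t))
     * cnj ((z2 * cis (a2 * t) - z3 * cis (a3 * t)) * (z1 * cis (a1 * t) - z4 * cis (a4 * t)))) \<psi>
    \<and> \<bar>\<psi> 1 - \<psi> 0 - (a2 - a1)\<bar> \<le> 4 * pi"
proof -
  have nz: "z1 \<noteq> 0" "z2 \<noteq> 0" "z3 \<noteq> 0" using l norm_ge_zero[of z4] norm_ge_zero[of z1] by auto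
  have F: "\<exists>\<psi>. phase (\<lambda>t. z * cis (a * t) - w * cis (b * t)) \<psi> \<and> \<bar>\<psi> 1 - \<psi> 0 - a\<bar> \<le> pi" 
    if lt: "cmod w < cmod z" and nz: "z \<noteq> 0" for z w a b
  proof -
    obtain \<psi> where p: "phase (\<lambda>t. 1 - w / z * cis ((b - a) * t)) \<psi>" "\<bar>\<psi> 1 - \<psi> 0\<bar> \<le> pi"
      using phase_one_minus[of "w / z" "b - a"] lt nz by (auto simp: norm_divide)
    have eq: "z * cis (a * t) - w * cis (b * t) = z * cis (a * t) * (1 - w / z * cis ((b - a) * t))" for t
      using nz by (simp add: field_simps cis_mult)
    show ?thesis
      unfolding eq using phase_mult[OF phase_rotate[OF nz, of a] p(1)] p(2)
      by (intro exI[of _ "\<lambda>t. Arg z + a * t + \<psi> t"]) auto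
  qed
  have G: "\<exists>\<psi>. phase (\<lambda>t. z * cis (a * t) - w * cis (b * t)) \<psi> \<and> \<bar>\<psi> 1 - \<psi> 0 - b\<bar> \<le> pi" 
    if lt: "cmod z < cmod w" and nz: "w \<noteq> 0" for z w a b
  proof -
    obtain \<psi> where p: "phase (\<lambda>t. w * cis (b * t) - z * cis (a * t)) \<psi>" "\<bar>\<psi> 1 - \<psi> 0 - b\<bar> \<le> pi"
      using F[OF lt nz] by metis
    have eq: "z * cis (a * t) - w * cis (b * t) = - (w * cis (b * t) - z * cis (a * t))" for t by simp
    have m: "phase (\<lambda>t. -1) (\<lambda>t. pi)" by (simp add: phase_def)
    show ?thesis
      unfolding eq using phase_mult[OF m p(1)] p(2)
      by (intro exI[of _ "\<lambda>t. pi + \<psi> t"]) auto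
  qed
  obtain p where p: "phase (\<lambda>t. z1 * cis (a1 * t) - z3 * cis (a3 * t)) p" "\<bar>p 1 - p 0 - a3\<bar> \<le> pi"
    using G[OF l(3) nz(3)] by blast
  obtain q where q: "phase (\<lambda>t. z2 * cis (a2 * t) - z4 * cis (a4 * t)) q" "\<bar>q 1 - q 0 - a2\<bar> \<le> pi"
    using F[OF l(2) nz(2)] by blast
  obtain r where r: "phase (\<lambda>t. z2 * cis (a2 * t) - z3 * cis (a3 * t)) r" "\<bar>r 1 - r 0 - a3\<bar> \<le> pi"
    using G[OF l(4) nz(3)] by blast
  obtain s where s: "phase (\<lambda>t. z1 * cis (a1 * t) - z4 * cis (a4 * t)) s" "\<bar>s 1 - s 0 - a1\<bar> \<le> pi"
    using F[OF l(1) nz(1)] by blast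
  show ?thesis
    using phase_mult[OF phase_mult[OF p(1) q(1)] phase_cnj[OF phase_mult[OF r(1) s(1)]]] p(2) q(2) r(2) s(2)
    by (intro exI[of _ "\<lambda>t. p t + q t + - (r t + s t)"] conjI) (assumption, linarith)
qed

section \<open>Twists about the vertical axis\<close>

text \<open>A class of functions closed under differentiation, which makes \<open>C\<^sup>k\<close> smoothness for all \<open>k\<close> immediate.\<close>

inductive trig_poly :: "('a::real_normed_vector \<Rightarrow> real) \<Rightarrow> bool" where
  trig_const: "trig_poly (\<lambda>x. c)"
| trig_linear: "bounded_linear f \<Longrightarrow> trig_poly f"
| trig_add: "trig_poly f \<Longrightarrow> trig_poly g \<Longrightarrow> trig_poly (\<lambda>x. f x + g x)"
| trig_mult: "trig_poly f \<Longrightarrow> trig_poly g \<Longrightarrow> trig_poly (\<lambda>x. f x * g x)"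
| trig_sin: "trig_poly f \<Longrightarrow> trig_poly (\<lambda>x. sin (f x))"
| trig_cos: "trig_poly f \<Longrightarrow> trig_poly (\<lambda>x. cos (f x))"

lemma trig_diff: "trig_poly f \<Longrightarrow> trig_poly g \<Longrightarrow> trig_poly (\<lambda>x. f x - g x)"
  using trig_add[OF _ trig_mult[OF trig_const[of "-1"]], of f g] by simp

lemma trig_poly_has_derivative:
  "trig_poly f \<Longrightarrow> \<exists>f'. (\<forall>x. (f has_derivative f' x) (at x)) \<and> (\<forall>v. trig_poly (\<lambda>x. f' x v))"
proof (induction rule: trig_poly.induct)
  case (trig_const c)
  show ?case by (intro exI[of _ "\<lambda>x v. 0"]) (auto intro: trig_poly.intros)
next
  case (trig_linear f)
  then show ?case by (intro exI[of _ "\<lambda>x. f"]) (auto intro: trig_poly.intros bounded_linear_imp_has_derivative)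
next
  case (trig_add f g)
  then obtain f' g' where "\<And>x. (f has_derivative f' x) (at x)" "\<And>v. trig_poly (\<lambda>x. f' x v)"
    "\<And>x. (g has_derivative g' x) (at x)" "\<And>v. trig_poly (\<lambda>x. g' x v)" by blast
  then show ?case
    by (intro exI[of _ "\<lambda>x v. f' x v + g' x v"]) (auto intro!: trig_poly.trig_add has_derivative_add)
next
  case (trig_mult f g)
  then obtain f' g' where "\<And>x. (f has_derivative f' x) (at x)" "\<And>v. trig_poly (\<lambda>x. f' x v)"
    "\<And>x. (g has_derivative g' x) (at x)" "\<And>v. trig_poly (\<lambda>x. g' x v)" by blast
  then show ?case using trig_mult.hyps
    by (intro exI[of _ "\<lambda>x v. f x * g' x v + f' x v * g x"]) (auto intro!: trig_poly.trig_add trig_poly.trig_mult has_derivative_mult)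
next
  case (trig_sin f)
  then obtain f' where "\<And>x. (f has_derivative f' x) (at x)" "\<And>v. trig_poly (\<lambda>x. f' x v)" by blast
  then show ?case using trig_sin.hyps
    by (intro exI[of _ "\<lambda>x v. f' x v * cos (f x)"]) (auto intro!: trig_poly.trig_mult trig_poly.trig_cos has_derivative_sin)
next
  case (trig_cos f)
  then obtain f' where f': "\<And>x. (f has_derivative f' x) (at x)" "\<And>v. trig_poly (\<lambda>x. f' x v)" by blast
  have "trig_poly (\<lambda>x. f' x v * (- 1 * sin (f x)))" for v
    using f' trig_cos.hyps by (intro trig_poly.trig_mult trig_poly.trig_const trig_poly.trig_sin) auto
  moreover have "((\<lambda>x. cos (f x)) has_derivative (\<lambda>v. f' x v * (- 1 * sin (f x)))) (at x)" for x
    by (rule has_derivative_eq_rhs[OF has_derivative_cos[OF f'(1)]]) (simp add: fun_eq_iff)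
  ultimately show ?case by (intro exI[of _ "\<lambda>x v. f' x v * (- 1 * sin (f x))"] conjI allI)
qed

text \<open>The induction runs over all \<open>f\<close> at once, since directional derivatives,
  read componentwise, stay in the class.\<close>

lemma trig_poly_Ck:
  fixes f :: "'a::real_normed_vector \<Rightarrow> 'b::euclidean_space"
  assumes "\<And>b. b \<in> Basis \<Longrightarrow> trig_poly (\<lambda>x. f x \<bullet> b)"
  shows "Ck_on k UNIV f"
  using assms
proof (induction k arbitrary: f)
  case (0 f)
  have "isCont (\<lambda>x. f x \<bullet> b) x" if "b \<in> Basis" for b x
    using trig_poly_has_derivative[OF 0[OF that]] has_derivative_continuous by blast
  then show ?case
    by (simp add: continuous_on_componentwise[of UNIV f] continuous_at_imp_continuous_on)
next
  case (Suc k f)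
  have "\<forall>b\<in>Basis. \<exists>f'. (\<forall>x. ((\<lambda>x. f x \<bullet> b) has_derivative f' x) (at x)) \<and> (\<forall>v. trig_poly (\<lambda>x. f' x v))"
    using trig_poly_has_derivative[OF Suc.prems] by blast
  then obtain F where F: "\<And>b x. b \<in> Basis \<Longrightarrow> ((\<lambda>x. f x \<bullet> b) has_derivative F b x) (at x)"
      "\<And>b v. b \<in> Basis \<Longrightarrow> trig_poly (\<lambda>x. F b x v)" by metis
  have D: "(f has_derivative (\<lambda>v. \<Sum>b\<in>Basis. F b x v *\<^sub>R b)) (at x)" for x
    by (subst has_derivative_componentwise_within) (auto simp: F inner_sum_left inner_Basis if_distrib sum.If_cases cong: if_cong)
  have E: "frechet_derivative f (at x) v = (\<Sum>b\<in>Basis. F b x v *\<^sub>R b)" for x v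
    using frechet_derivative_at[OF D[of x]] by metis
  have "Ck_on k UNIV (\<lambda>x. frechet_derivative f (at x) v)" for v
    unfolding E by (rule Suc.IH) (auto simp: F inner_sum_left inner_Basis if_distrib sum.If_cases cong: if_cong)
  then show ?case using differentiableI[OF D] by simp
qed

lemma trig_poly_smooth_on:
  fixes f g :: "'a::real_normed_vector \<Rightarrow> 'b::euclidean_space"
  assumes "\<And>b. b \<in> Basis \<Longrightarrow> trig_poly (\<lambda>x. g x \<bullet> b)" "\<And>x. x \<in> S \<Longrightarrow> f x = g x"
  shows "smooth_on S f"
  unfolding smooth_on_def
  using trig_poly_Ck[OF assms(1)] assms(2) by (intro ballI exI[of _ UNIV] exI[of _ g]) auto

section \<open>Derivatives within the sphere\<close>

lemma has_derivative_vec3: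
  fixes f :: "'a::real_normed_vector \<Rightarrow> real^3"
  assumes "((\<lambda>w. f w $ 1) has_derivative (\<lambda>h. D h $ 1)) F"
    "((\<lambda>w. f w $ 2) has_derivative (\<lambda>h. D h $ 2)) F"
    "((\<lambda>w. f w $ 3) has_derivative (\<lambda>h. D h $ 3)) F" "F = at z within S"
  shows "(f has_derivative D) F"
  unfolding assms(4)
proof (subst has_derivative_componentwise_within, intro ballI)
  fix b :: "real^3" assume "b \<in> Basis"
  then obtain i where b: "b = axis i 1" by (auto simp: Basis_vec_def)
  have "i = 1 \<or> i = 2 \<or> i = 3" by (rule exhaust_3)
  with assms show "((\<lambda>w. f w \<bullet> b) has_derivative (\<lambda>h. D h \<bullet> b)) (at z within S)"
    unfolding b inner_axis by auto
qed

text \<open>The great circle through \<open>x\<close> with direction \<open>u\<close> stays on the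
  sphere, and both derivatives compute the velocity of \<open>f\<close> along it.\<close>

lemma sphere_derivative_unique:
  fixes f :: "real^3 \<Rightarrow> 'b::real_normed_vector"
  assumes D: "(f has_derivative D) (at x within S2)" "(f has_derivative D') (at x within S2)"
    and x: "x \<in> S2" and u: "x \<bullet> u = 0"
  shows "D u = D' u"
proof (cases "u = 0")
  case True
  have "linear D" "linear D'" using D has_derivative_linear by blast+
  with True show ?thesis by (simp add: linear_0)
next
  case False
  define w where "w = u /\<^sub>R norm u"
  define c where "c = (\<lambda>s::real. cos s *\<^sub>R x + sin s *\<^sub>R w)"
  have xw: "x \<bullet> x = 1" "x \<bullet> w = 0" "w \<bullet> w = 1" "w \<bullet> x = 0"
    using x u False by (simp_all add: w_def norm_eq_1 inner_commute dot_square_norm power2_eq_square)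
  have cS: "c s \<in> S2" for s
    by (simp add: c_def norm_eq_1 inner_add_left inner_add_right xw flip: power2_eq_square)
  have c0: "c 0 = x" by (simp add: c_def)
  have cd: "(c has_derivative (\<lambda>h. h *\<^sub>R w)) (at 0)"
    unfolding c_def by (rule derivative_eq_intros refl)+ simp
  have ch: "((\<lambda>s. f (c s)) has_derivative (\<lambda>h. E (h *\<^sub>R w))) (at 0)" if "(f has_derivative E) (at x within S2)" for E
    by (rule has_derivative_in_compose[OF cd, of f E, unfolded c0, OF has_derivative_subset[OF that]]) (use cS in auto)
  have "(\<lambda>h. D (h *\<^sub>R w)) = (\<lambda>h. D' (h *\<^sub>R w))"
    using has_derivative_unique[OF ch[OF D(1)] ch[OF D(2)]] .
  then have "D (norm u *\<^sub>R w) = D' (norm u *\<^sub>R w)" by metis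
  then show ?thesis using False by (simp add: w_def)
qed

section \<open>Rotations and height-dependent twists\<close>

definition rot :: "real \<Rightarrow> real^3 \<Rightarrow> real^3" where
  "rot a x = vector [x $ 1 * cos a - x $ 2 * sin a, x $ 1 * sin a + x $ 2 * cos a, x $ 3]"

definition twist :: "real \<Rightarrow> real^3 \<Rightarrow> real^3" where
  "twist k x = rot (k * x $ 3) x"

lemma rot_add: "rot a (rot b x) = rot (a + b) x"
  by (simp add: rot_def vec_eq_iff forall_3 cos_add sin_add algebra_simps)

lemma rot_0 [simp]: "rot 0 x = x"
  by (simp add: rot_def vec_eq_iff forall_3)

lemma rot_norm [simp]: "norm (rot a x) = norm x"
proof -
  have "rot a x \<bullet> rot a x = ((cos a)\<^sup>2 + (sin a)\<^sup>2) * ((x$1)\<^sup>2 + (x$2)\<^sup>2) + (x$3)\<^sup>2"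
    by (simp add: rot_def inner_vec_def sum_3 power2_eq_square algebra_simps del: sin_cos_squared_add sin_cos_squared_add2 sin_cos_squared_add3)
  then have "rot a x \<bullet> rot a x = x \<bullet> x"
    by (simp add: inner_vec_def sum_3 power2_eq_square)
  then show ?thesis by (simp add: norm_eq)
qed

lemma rot_triple: "rot a x \<bullet> cross3 (rot a y) (rot a z) = x \<bullet> cross3 y z"
proof -
  have "rot a x \<bullet> cross3 (rot a y) (rot a z) = ((cos a)\<^sup>2 + (sin a)\<^sup>2) * (x \<bullet> cross3 y z)"
    by (simp add: rot_def cross3_def inner_vec_def sum_3 power2_eq_square algebra_simps del: sin_cos_squared_add sin_cos_squared_add2 sin_cos_squared_add3)
  then show ?thesis by simp
qed

lemma twist_twist: "twist j (twist k x) = twist (j + k) x"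
  unfolding twist_def by (simp add: rot_add) (simp add: rot_def algebra_simps)

lemma twist_0 [simp]: "twist 0 x = x"
  by (simp add: twist_def)

lemma twist_norm [simp]: "norm (twist k x) = norm x"
  by (simp add: twist_def)

lemma twist_bij: "bij_betw (restrict (twist k) S2) S2 S2"
  by (rule bij_betw_byWitness[where f' = "twist (- k)"]) (auto simp: twist_twist)

lemma twist_inv: "x \<in> S2 \<Longrightarrow> inv_into S2 (restrict (twist k) S2) x = twist (- k) x"
  by (rule inv_into_f_eq) (use twist_bij[of k] in \<open>auto simp: bij_betw_def twist_twist\<close>)

text \<open>The vector \<open>[- x $ 2, x $ 1, 0]\<close> is the generator of the rotation, the
  cross product of the vertical axis with \<open>x\<close>. Its coefficient \<open>k * u $ 3\<close>
  is the change of the rotation angle.\<close>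

lemma twist_derivative:
  "(twist k has_derivative (\<lambda>u. rot (k * x $ 3) (u + (k * u $ 3) *\<^sub>R vector [- x $ 2, x $ 1, 0]))) (at x within S)"
proof (rule has_derivative_vec3[OF _ _ _ refl])
  have n: "((\<lambda>w::real^3. w $ i) has_derivative (\<lambda>h. h $ i)) (at x within S)" for i
    by (rule bounded_linear_imp_has_derivative) (rule bounded_linear_vec_nth)
  show "((\<lambda>w. twist k w $ 1) has_derivative
     (\<lambda>u. rot (k * x $ 3) (u + (k * u $ 3) *\<^sub>R vector [- x $ 2, x $ 1, 0]) $ 1)) (at x within S)"
    unfolding twist_def rot_def vector_3
    by (rule has_derivative_eq_rhs, (rule derivative_intros n)+) (simp add: fun_eq_iff algebra_simps)
  show "((\<lambda>w. twist k w $ 2) has_derivative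
     (\<lambda>u. rot (k * x $ 3) (u + (k * u $ 3) *\<^sub>R vector [- x $ 2, x $ 1, 0]) $ 2)) (at x within S)"
    unfolding twist_def rot_def vector_3
    by (rule has_derivative_eq_rhs, (rule derivative_intros n)+) (simp add: fun_eq_iff algebra_simps)
  show "((\<lambda>w. twist k w $ 3) has_derivative
     (\<lambda>u. rot (k * x $ 3) (u + (k * u $ 3) *\<^sub>R vector [- x $ 2, x $ 1, 0]) $ 3)) (at x within S)"
    unfolding twist_def rot_def vector_3
    by (rule has_derivative_eq_rhs, rule n) (simp add: fun_eq_iff)
qed

text \<open>The twist acts on tangent vectors as a shear along \<open>j\<close>, followed by a
  rotation. As the area spanned by a tangent vector \<open>w\<close> and \<open>j\<close> is
  \<open>- w $ 3\<close>, the two correction terms are equal and cancel.\<close>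

lemma twist_triple:
  assumes "norm x = 1" "x \<bullet> u = 0" "x \<bullet> v = 0"
  defines "j \<equiv> vector [- x $ 2, x $ 1, 0] :: real^3"
  shows "x \<bullet> cross3 (u + (k * u $ 3) *\<^sub>R j) (v + (k * v $ 3) *\<^sub>R j) = x \<bullet> cross3 u v"
proof -
  have x: "(x$1)*(x$1) + (x$2)*(x$2) = 1 - (x$3)*(x$3)" using assms(1) by (simp add: norm_eq_1 inner_vec_def sum_3)
  have t: "x \<bullet> cross3 w j = - w $ 3" if "x \<bullet> w = 0" for w
  proof -
    have w: "x$1 * w$1 + x$2 * w$2 = - (x$3 * w$3)" using that by (simp add: inner_vec_def sum_3)
    have "x \<bullet> cross3 w j = - w$3 * ((x$1)*(x$1) + (x$2)*(x$2)) + x$3 * (x$1 * w$1 + x$2 * w$2)"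
      by (simp add: j_def cross3_def inner_vec_def sum_3 algebra_simps)
    then show ?thesis unfolding x w by (simp add: algebra_simps)
  qed
  have "x \<bullet> cross3 (u + (k * u $ 3) *\<^sub>R j) (v + (k * v $ 3) *\<^sub>R j) =
     x \<bullet> cross3 u v + k * v $ 3 * (x \<bullet> cross3 u j) - k * u $ 3 * (x \<bullet> cross3 v j)"
    by (simp add: cross3_def inner_vec_def sum_3 algebra_simps)
  then show ?thesis using t[OF assms(2)] t[OF assms(3)] by simp
qed

lemma trig_poly_vec3:
  fixes f :: "'a::real_normed_vector \<Rightarrow> real^3"
  assumes "trig_poly (\<lambda>w. f w $ 1)" "trig_poly (\<lambda>w. f w $ 2)" "trig_poly (\<lambda>w. f w $ 3)" "b \<in> Basis"
  shows "trig_poly (\<lambda>w. f w \<bullet> b)"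
proof -
  obtain i where b: "b = axis i 1" using assms(4) by (auto simp: Basis_vec_def)
  have "i = 1 \<or> i = 2 \<or> i = 3" by (rule exhaust_3)
  with assms show ?thesis unfolding b inner_axis by auto
qed

text \<open>The twist parameter may itself vary with \<open>w\<close>; this covers smoothness in
  time and in a homotopy variable as well as in space.\<close>

lemma trig_poly_twist:
  assumes "trig_poly f" "bounded_linear L" "b \<in> Basis"
  shows "trig_poly (\<lambda>w. twist (f w) (L w) \<bullet> b)"
proof (rule trig_poly_vec3[OF _ _ _ assms(3)])
  have L: "trig_poly (\<lambda>w. L w $ i)" for i
    by (rule trig_linear) (rule bounded_linear_compose[OF bounded_linear_vec_nth assms(2)])
  show "trig_poly (\<lambda>w. twist (f w) (L w) $ 1)" "trig_poly (\<lambda>w. twist (f w) (L w) $ 2)" "trig_poly (\<lambda>w. twist (f w) (L w) $ 3)"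
    unfolding twist_def rot_def vector_3 
    by (intro trig_add trig_diff trig_mult trig_sin trig_cos L assms(1))+
qed

lemma twist_area_diffeo: "restrict (twist k) S2 \<in> area_diffeos"
  unfolding area_diffeos_def
proof (intro CollectI conjI ballI allI impI)
  show "smooth_on S2 (restrict (twist k) S2)" 
    by (rule trig_poly_smooth_on[where g = "twist k"]) (auto intro!: trig_poly_twist trig_const bounded_linear_ident)
  show "smooth_on S2 (inv_into S2 (restrict (twist k) S2))"
    by (rule trig_poly_smooth_on[where g = "twist (- k)"]) (auto intro!: trig_poly_twist trig_const bounded_linear_ident simp: twist_inv[unfolded mem_sphere_0])
  fix x D u v assume x: "x \<in> S2" and D: "(restrict (twist k) S2 has_derivative D) (at x within S2)"
    and uv: "x \<bullet> u = 0 \<and> x \<bullet> v = 0"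
  let ?E = "\<lambda>u. rot (k * x $ 3) (u + (k * u $ 3) *\<^sub>R vector [- x $ 2, x $ 1, 0])"
  have "(restrict (twist k) S2 has_derivative ?E) (at x within S2)"
    by (rule has_derivative_transform[OF x _ twist_derivative]) simp
  from sphere_derivative_unique[OF D this x] uv have "D u = ?E u" "D v = ?E v" by auto
  then show "fs_form (restrict (twist k) S2 x) (D u) (D v) = fs_form x u v"
    using x uv by (simp add: fs_form_def twist_def rot_triple twist_triple)
qed (simp_all only: twist_bij restrict_extensional)

definition twist_path :: "real \<Rightarrow> real \<Rightarrow> real^3 \<Rightarrow> real^3" where
  "twist_path k t = restrict (twist (k * t)) S2"

lemma twist_path_smooth2: "smooth_on ({0..1::real} \<times> {0..1} \<times> S2) (\<lambda>(s, t, x). twist_path k t x)"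
proof (rule trig_poly_smooth_on[where g = "\<lambda>w. twist (k * fst (snd w)) (snd (snd w))"])
  show "trig_poly (\<lambda>w :: real \<times> real \<times> (real^3). twist (k * fst (snd w)) (snd (snd w)) \<bullet> b)" if "b \<in> Basis" for b
    by (rule trig_poly_twist[OF trig_mult[OF trig_const trig_linear]])
       (auto intro: bounded_linear_compose[OF bounded_linear_fst] bounded_linear_compose[OF bounded_linear_snd] bounded_linear_snd that)
qed (auto simp: twist_path_def)

lemma twist_path_is_path: "is_path (twist_path k)"
  unfolding is_path_def
proof (intro conjI ballI)
  show "smooth_on ({0..1} \<times> S2) (\<lambda>(t, x). twist_path k t x)"
  proof (rule trig_poly_smooth_on[where g = "\<lambda>w. twist (k * fst w) (snd w)"])
    show "trig_poly (\<lambda>w :: real \<times> (real^3). twist (k * fst w) (snd w) \<bullet> b)" if "b \<in> Basis" for b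
      by (rule trig_poly_twist[OF trig_mult[OF trig_const trig_linear]]) (auto intro: bounded_linear_snd bounded_linear_fst that)
  qed (auto simp: twist_path_def)
qed (simp add: twist_path_def twist_area_diffeo)

lemma twist_path_0: "twist_path k 0 = restrict id S2"
  by (auto simp: twist_path_def)

lemma twist_path_based: "twist_path k \<in> based_paths"
  by (simp add: based_paths_def twist_path_is_path twist_path_0)

text \<open>The homotopy is constant. It puts \<open>twist_path k\<close> into its own class, which
  supplies an element for the infima over classes.\<close>

lemma twist_path_homotopic: "(twist_path k, twist_path k) \<in> homotopy_rel"
  unfolding homotopy_rel_def
  using twist_path_smooth2[of k]
  by (auto intro!: exI[of _ "\<lambda>s. twist_path k"] simp: twist_path_based) (simp add: twist_path_def twist_area_diffeo)

section \<open>Stereographic coordinates\<close>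

lemma chart_r: "0 < 1 + (cmod z)\<^sup>2"
  by (smt (verit) zero_le_power2)

lemma chart_nth:
  "affine_chart z $ 1 = 2 * Re z / (1 + (cmod z)\<^sup>2)" "affine_chart z $ 2 = 2 * Im z / (1 + (cmod z)\<^sup>2)"
  "affine_chart z $ 3 = (1 - (cmod z)\<^sup>2) / (1 + (cmod z)\<^sup>2)"
  by (simp_all add: affine_chart_def)

lemma chart_norm [simp]: "norm (affine_chart z) = 1"
  using affine_chart_in_S2[of z] by simp

lemma chart_continuous: "continuous_on S affine_chart"
  by (intro continuous_at_imp_continuous_on ballI has_derivative_continuous[OF affine_chart_derivative])

lemma chart_3_less: "affine_chart z $ 3 > -1" 
  using chart_r[of z] by (simp add: chart_nth field_simps)

lemma chart_inner: "1 - affine_chart z \<bullet> affine_chart w = 2 * (cmod (z - w))\<^sup>2 / ((1 + (cmod z)\<^sup>2) * (1 + (cmod w)\<^sup>2))"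
proof -
  have "affine_chart z \<bullet> affine_chart w =
    (4 * Re z * Re w + 4 * Im z * Im w + (1 - (cmod z)\<^sup>2) * (1 - (cmod w)\<^sup>2)) / ((1 + (cmod z)\<^sup>2) * (1 + (cmod w)\<^sup>2))"
    by (simp add: inner_vec_def sum_3 chart_nth add_divide_distrib)
  moreover have "(1 + (cmod z)\<^sup>2) * (1 + (cmod w)\<^sup>2) - (4 * Re z * Re w + 4 * Im z * Im w + (1 - (cmod z)\<^sup>2) * (1 - (cmod w)\<^sup>2)) = 2 * (cmod (z - w))\<^sup>2"
    unfolding cmod_power2 by (simp add: power2_eq_square algebra_simps)
  moreover have "1 - N / R = (R - N) / R" if "R > 0" for N R :: real using that by (simp add: diff_divide_distrib)
  ultimately show ?thesis using chart_r[of z] chart_r[of w] by simp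
qed

lemma chart_dist: "norm (affine_chart z - affine_chart w) = 2 * cmod (z - w) / (sqrt (1 + (cmod z)\<^sup>2) * sqrt (1 + (cmod w)\<^sup>2))"
proof -
  have "(norm (affine_chart z - affine_chart w))\<^sup>2 = 2 * (1 - affine_chart z \<bullet> affine_chart w)"
    using chart_norm[of z] chart_norm[of w] unfolding norm_eq_1
    by (simp add: power2_norm_eq_inner inner_diff_left inner_diff_right inner_commute)
  also have "\<dots> = (2 * cmod (z - w) / (sqrt (1 + (cmod z)\<^sup>2) * sqrt (1 + (cmod w)\<^sup>2)))\<^sup>2"
    using chart_r[of z] chart_r[of w] by (simp add: chart_inner power_divide power_mult_distrib)
  finally show ?thesis by (simp add: power2_eq_iff_nonneg)
qed

lemma chart_inj: "affine_chart z = affine_chart w \<longleftrightarrow> z = w"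
proof
  assume "affine_chart z = affine_chart w"
  then have "2 * cmod (z - w) / (sqrt (1 + (cmod z)\<^sup>2) * sqrt (1 + (cmod w)\<^sup>2)) = 0"
    using chart_dist[of z w] by simp
  then show "z = w" using chart_r[of z] chart_r[of w] by simp
qed simp

text \<open>At the pole (0, 0, -1) the division by zero yields the default 0, which is why later
  conditions exclude \<open>x $ 3 = -1\<close> explicitly.\<close>

definition stereo :: "real^3 \<Rightarrow> complex" where
  "stereo x = Complex (x $ 1) (x $ 2) / of_real (1 + x $ 3)"

lemma chart_stereo:
  assumes "norm x = 1" "x $ 3 \<noteq> -1"
  shows "affine_chart (stereo x) = x"
proof -
  let ?c = "1 + x $ 3"
  have c: "?c \<noteq> 0" using assms(2) by linarith
  have n: "(x$1)\<^sup>2 + (x$2)\<^sup>2 = ?c * (1 - x$3)"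
    using assms(1) by (simp add: norm_eq_1 inner_vec_def sum_3 power2_eq_square algebra_simps)
  have "(cmod (stereo x))\<^sup>2 = ((x$1)\<^sup>2 + (x$2)\<^sup>2) / ?c\<^sup>2"
    by (simp add: stereo_def norm_divide power_divide cmod_power2 del: of_real_add)
  also have "\<dots> = (1 - x$3) / ?c" using c unfolding n by (simp add: power2_eq_square)
  finally have s: "(cmod (stereo x))\<^sup>2 = (1 - x$3) / ?c" .
  then have r: "1 + (cmod (stereo x))\<^sup>2 = 2 / ?c" using c by (simp add: field_simps)
  have ri: "Re (stereo x) = x$1 / ?c" "Im (stereo x) = x$2 / ?c"
    by (simp_all add: stereo_def Re_divide_of_real Im_divide_of_real del: of_real_add)
  show ?thesis
    using c unfolding vec_eq_iff forall_3 chart_nth r ri by (simp add: s field_simps)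
qed

lemma stereo_chart [simp]: "stereo (affine_chart z) = z"
proof -
  have "affine_chart (stereo (affine_chart z)) = affine_chart z"
    using chart_3_less[of z] by (intro chart_stereo) auto
  then show ?thesis by (simp add: chart_inj)
qed

lemma S2_cases:
  assumes "norm x = 1"
  obtains z where "x = affine_chart z" | "x = - axis 3 1"
proof (cases "x $ 3 = -1")
  case True
  then have "(x$1)*(x$1) + (x$2)*(x$2) = 0"
    using assms by (simp add: norm_eq_1 inner_vec_def sum_3)
  then have "x$1 = 0" "x$2 = 0" using sum_squares_eq_zero_iff by blast+
  then show ?thesis using True by (intro that(2)) (simp add: vec_eq_iff forall_3 axis_def)
next
  case False
  then show ?thesis using that(1)[of "stereo x"] chart_stereo[OF assms] by simp
qed

lemma twist_chart: "twist k (affine_chart z) = affine_chart (z * cis (k * affine_chart z $ 3))"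
proof -
  have "cmod (z * cis a) = cmod z" for a by (simp add: norm_mult)
  then show ?thesis
    unfolding twist_def rot_def by (simp add: vec_eq_iff forall_3 chart_nth algebra_simps diff_divide_distrib add_divide_distrib)
qed

lemma cr_chart:
  "cr (affine_chart z1) (affine_chart z2) (affine_chart z3) (affine_chart z4) =
    of_real (8 / ((1 + (cmod z1)\<^sup>2) * (1 + (cmod z2)\<^sup>2) * (1 + (cmod z3)\<^sup>2) * (1 + (cmod z4)\<^sup>2))) *
    cnj ((z1 - z3) * (z2 - z4) * cnj ((z2 - z3) * (z1 - z4)))" (is "?L = of_real (8 / ?R) * cnj ?P")
proof -
  define r where "r = (\<lambda>z. 1 + (cmod z)\<^sup>2)"
  define y where "y = (\<lambda>z. vector [2 * Re z, 2 * Im z, 1 - (cmod z)\<^sup>2] :: real^3)"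
  have rp: "r z > 0" for z by (simp add: r_def chart_r)
  have ch: "affine_chart z = (1 / r z) *\<^sub>R y z" for z
    by (simp add: vec_eq_iff forall_3 chart_nth r_def y_def)
  have rr: "1 + (cmod z)\<^sup>2 = r z" for z by (simp add: r_def)
  have R: "?R = r z1 * r z2 * r z3 * r z4" by (simp add: r_def)
  have n: "(cmod (z2 - z3))\<^sup>2 * (cmod (z1 - z4))\<^sup>2 + (cmod (z1 - z3))\<^sup>2 * (cmod (z2 - z4))\<^sup>2 - (cmod (z1 - z2))\<^sup>2 * (cmod (z3 - z4))\<^sup>2 = 2 * Re ?P"
  proof -
    define a b where "a = (z1 - z3) * (z2 - z4)" and "b = (z2 - z3) * (z1 - z4)"
    \<comment> \<open>With the two products of differences as \<open>a\<close> and \<open>b\<close>,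
      this identity turns the three products of chord lengths into the polarisation |a|^2 + |b|^2 -
      |a - b|^2 = 2 Re (a cnj b).\<close>
    have ab: "a - b = (z1 - z2) * (z3 - z4)" by (simp add: a_def b_def algebra_simps)
    have "(cmod b)\<^sup>2 + (cmod a)\<^sup>2 - (cmod (a - b))\<^sup>2 = 2 * Re (a * cnj b)"
      unfolding cmod_power2 by (simp add: power2_eq_square algebra_simps)
    then show ?thesis unfolding ab by (simp only: a_def b_def norm_mult power_mult_distrib)
  qed
  have Re: "Re ?L = 8 / ?R * Re ?P"
  proof -
    have "Re ?L = 4 / ?R * ((cmod (z2 - z3))\<^sup>2 * (cmod (z1 - z4))\<^sup>2 + (cmod (z1 - z3))\<^sup>2 * (cmod (z2 - z4))\<^sup>2 - (cmod (z1 - z2))\<^sup>2 * (cmod (z3 - z4))\<^sup>2)"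
      unfolding cr_def complex.sel chart_inner rr
      using rp[of z1] rp[of z2] rp[of z3] rp[of z4] by (simp add: field_simps)
    then show ?thesis unfolding n by simp
  qed
  \<comment> \<open>The volume becomes an alternating sum of four triple products. Clearing the
    weights \<open>r\<close> multiplies each by the weight of the point missing from it, which
    leaves a polynomial identity.\<close>
  have tri: "(a - d) \<bullet> cross3 (b - d) (c - d) = a \<bullet> cross3 b c - d \<bullet> cross3 b c - a \<bullet> cross3 d c - a \<bullet> cross3 b d" for a b c d :: "real^3"
    by (simp add: cross3_def inner_vec_def sum_3 algebra_simps)
  have "Im ?L = (1 / ?R) * (r z4 * (y z1 \<bullet> cross3 (y z2) (y z3)) - r z1 * (y z4 \<bullet> cross3 (y z2) (y z3))
      - r z2 * (y z1 \<bullet> cross3 (y z4) (y z3)) - r z3 * (y z1 \<bullet> cross3 (y z2) (y z4)))"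
    unfolding cr_def complex.sel tri ch cross_mult_left cross_mult_right inner_scaleR_left inner_scaleR_right rr
    using rp[of z1] rp[of z2] rp[of z3] rp[of z4] by (simp add: field_simps)
  also have "r z4 * (y z1 \<bullet> cross3 (y z2) (y z3)) - r z1 * (y z4 \<bullet> cross3 (y z2) (y z3))
      - r z2 * (y z1 \<bullet> cross3 (y z4) (y z3)) - r z3 * (y z1 \<bullet> cross3 (y z2) (y z4)) = - 8 * Im ?P"
    unfolding r_def y_def cross3_def inner_vec_def sum_3 vector_3 cmod_power2
    by (simp add: power2_eq_square algebra_simps)
  finally have "Im ?L = (1 / ?R) * (- 8 * Im ?P)" .
  moreover have "(1 / r) * (- 8 * i) = - (8 / r * i)" for r i :: real by simp
  ultimately have "Im ?L = - (8 / ?R * Im ?P)" by metis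
  moreover have "Re (of_real c * cnj w) = c * Re w" "Im (of_real c * cnj w) = - (c * Im w)" for c w by simp_all
  ultimately show ?thesis using Re by (intro complex_eqI) metis+
qed

section \<open>Integrability of the inverse distance\<close>

text \<open>An integrable majorant on the plane for both the area density and, after a translation, the
  density divided by the chordal distance to a fixed point.\<close>

definition sing :: "complex \<Rightarrow> real" where
  "sing u = (if cmod u < 1 then 1 + 1 / cmod u else 1 / cmod u ^ 3)"

lemma sing_measurable [measurable]: "sing \<in> borel_measurable borel"
  unfolding sing_def by measurable

lemma emeasure_ball_complex: "r \<ge> 0 \<Longrightarrow> emeasure lborel (ball (c::complex) r) \<le> ennreal (4 * r\<^sup>2)"
proof -
  assume r: "r \<ge> 0"
  have "ball c r \<subseteq> cbox (c - Complex r r) (c + Complex r r)"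
  proof
    fix z assume "z \<in> ball c r"
    then have "\<bar>Re (z - c)\<bar> < r" "\<bar>Im (z - c)\<bar> < r"
      using abs_Re_le_cmod[of "z - c"] abs_Im_le_cmod[of "z - c"] by (auto simp: dist_norm norm_minus_commute)
    then show "z \<in> cbox (c - Complex r r) (c + Complex r r)" by (auto simp: in_cbox_complex_iff)
  qed
  then have "emeasure lborel (ball c r) \<le> emeasure lborel (cbox (c - Complex r r) (c + Complex r r))"
    by (intro emeasure_mono) auto
  also have "\<dots> = ennreal (4 * r\<^sup>2)"
    using r by (subst emeasure_lborel_cbox) (auto simp: Basis_complex_def power2_eq_square)
  finally show ?thesis .
qed

lemma dyadic_below:
  fixes x :: real assumes "0 < x" "x < 1"
  shows "\<exists>n. (1/2) ^ Suc n \<le> x \<and> x < (1/2) ^ n"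
proof -
  define n where "n = (LEAST n. (1/2) ^ Suc n \<le> x)"
  obtain m where "(1/2) ^ m < x" using real_arch_pow_inv[of x "1/2"] assms by auto
  then have "(1/2) ^ Suc m \<le> x" by (simp add: field_simps)
  then have 1: "(1/2) ^ Suc n \<le> x" unfolding n_def by (rule LeastI)
  have "x < (1/2) ^ n"
  proof (cases n)
    case (Suc k)
    then show ?thesis using not_less_Least[of k "\<lambda>n. (1/2) ^ Suc n \<le> x"] unfolding n_def by auto
  qed (use assms in auto)
  with 1 show ?thesis by blast
qed

lemma dyadic_above:
  fixes x :: real assumes "1 \<le> x"
  shows "\<exists>n. 2 ^ n \<le> x \<and> x < 2 ^ Suc n"
proof -
  define n where "n = (LEAST n. x < 2 ^ Suc n)"
  obtain m where "x < 2 ^ m" using real_arch_pow[of 2 x] by auto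
  then have "x < 2 ^ Suc m" by (rule order_less_le_trans) simp
  then have 1: "x < 2 ^ Suc n" unfolding n_def by (rule LeastI)
  have "2 ^ n \<le> x"
  proof (cases n)
    case (Suc k)
    then show ?thesis using not_less_Least[of k "\<lambda>n. x < 2 ^ Suc n"] unfolding n_def by auto
  qed (use assms in auto)
  with 1 show ?thesis by blast
qed

text \<open>On the shell where |u| is about (1/2)^n the summand 1/|u| contributes at most 2^(n+1) *
  4 * (1/4)^n, and on the shell |u| about 2^n the cube contributes at most (1/8)^n * 4 * 4^(n+1).
  Both are geometric, 8 and 16 times (1/2)^n, whence the 24.\<close>

lemma sing_finite: "(\<integral>\<^sup>+u. ennreal (sing u) \<partial>lborel) < \<infinity>"
proof -
  let ?B = "\<lambda>r. ball (0::complex) r"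
  define F where "F = (\<lambda>n u. ennreal (2 ^ Suc n) * indicator (?B ((1/2)^n)) u + ennreal ((1/8)^n) * indicator (?B (2 ^ Suc n)) u)"
  have [measurable]: "?B r \<in> sets borel" for r by simp
  have Fm [measurable]: "F n \<in> borel_measurable borel" for n unfolding F_def by measurable
  have "ennreal (sing u) \<le> indicator (?B 1) u + (\<Sum>n. F n u)" for u
  proof -
    have le: "F n u \<le> (\<Sum>n. F n u)" for n by (rule sum_le_suminf[of _ "{n}", simplified]) auto
    consider "u = 0" | "0 < cmod u" "cmod u < 1" | "1 \<le> cmod u" by fastforce
    then show ?thesis
    proof cases
      case 1
      then show ?thesis by (simp add: sing_def)
    next
      case 2
      then obtain n where n: "(1/2) ^ Suc n \<le> cmod u" "cmod u < (1/2) ^ n" using dyadic_below by blast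
      have "1 / cmod u \<le> 1 / (1/2) ^ Suc n" using n 2 by (intro divide_left_mono mult_pos_pos) auto
      also have "1 / (1/2::real) ^ Suc n = 2 ^ Suc n" by (simp add: power_divide)
      finally have "ennreal (1 / cmod u) \<le> F n u" using n(2) unfolding F_def
        by (intro order_trans[OF ennreal_leI add_increasing2]) auto
      then have "ennreal (1 / cmod u) \<le> (\<Sum>n. F n u)" using le order_trans by blast
      then have "1 + ennreal (1 / cmod u) \<le> 1 + (\<Sum>n. F n u)" by (rule add_left_mono)
      moreover have "ennreal (sing u) = 1 + ennreal (1 / cmod u)" using 2 by (simp add: sing_def ennreal_plus del: divide_ennreal)
      ultimately show ?thesis using 2 by simp
    next
      case 3
      then obtain n where n: "2 ^ n \<le> cmod u" "cmod u < 2 ^ Suc n" using dyadic_above by blast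
      have "1 / cmod u ^ 3 \<le> 1 / (2 ^ n) ^ 3" using n 3 by (intro divide_left_mono power_mono mult_pos_pos) auto
      also have "1 / (2 ^ n) ^ 3 = (1/8::real) ^ n" by (simp add: power_divide power_mult[symmetric] mult.commute[of n] power_mult)
      finally have "ennreal (1 / cmod u ^ 3) \<le> F n u" using n(2) unfolding F_def
        by (intro order_trans[OF ennreal_leI add_increasing]) auto
      then have "ennreal (1 / cmod u ^ 3) \<le> (\<Sum>n. F n u)" using le order_trans by blast
      then show ?thesis using 3 by (simp add: sing_def add_increasing)
    qed
  qed
  then have "(\<integral>\<^sup>+u. ennreal (sing u) \<partial>lborel) \<le> (\<integral>\<^sup>+u. indicator (?B 1) u + (\<Sum>n. F n u) \<partial>lborel)"
    by (rule nn_integral_mono)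
  also have "\<dots> = emeasure lborel (?B 1) + (\<Sum>n. \<integral>\<^sup>+u. F n u \<partial>lborel)"
    by (subst nn_integral_add) (auto simp: nn_integral_suminf)
  also have "\<dots> \<le> ennreal 4 + (\<Sum>n. ennreal (24 * (1/2)^n))"
  proof (intro add_mono suminf_le)
    show "emeasure lborel (?B 1) \<le> ennreal 4" using emeasure_ball_complex[of 1 0] by simp
    fix n
    have "(\<integral>\<^sup>+u. F n u \<partial>lborel) = ennreal (2 ^ Suc n) * emeasure lborel (?B ((1/2)^n)) + ennreal ((1/8)^n) * emeasure lborel (?B (2 ^ Suc n))"
      unfolding F_def by (subst nn_integral_add) (auto simp: nn_integral_cmult_indicator)
    also have "\<dots> \<le> ennreal (2 ^ Suc n) * ennreal (4 * ((1/2)^n)\<^sup>2) + ennreal ((1/8)^n) * ennreal (4 * (2 ^ Suc n)\<^sup>2)"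
      by (intro add_mono mult_left_mono emeasure_ball_complex) auto
    also have "\<dots> = ennreal (2 ^ Suc n * (4 * ((1/2)^n)\<^sup>2) + (1/8)^n * (4 * (2 ^ Suc n)\<^sup>2))"
      by (simp add: ennreal_mult[symmetric] ennreal_plus[symmetric] del: ennreal_plus power_Suc)
    also have "2 ^ Suc n * (4 * ((1/2)^n)\<^sup>2) + (1/8)^n * (4 * (2 ^ Suc n)\<^sup>2) = 24 * (1/2::real)^n"
    proof -
      have a: "(8::real)^n = 2^n * 2^n * 2^n" by (simp add: power_mult_distrib[symmetric])
      show ?thesis by (simp add: power_divide a power2_eq_square field_simps)
    qed
    finally show "(\<integral>\<^sup>+u. F n u \<partial>lborel) \<le> ennreal (24 * (1/2)^n)" .
  qed auto
  also have "(\<Sum>n. ennreal (24 * (1/2)^n)) = ennreal (\<Sum>n. 24 * (1/2)^n)"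
    by (intro suminf_ennreal2) (auto intro!: summable_mult summable_geometric)
  also have "ennreal 4 + \<dots> < \<infinity>" by simp
  finally show ?thesis .
qed

definition sing_int :: ennreal where "sing_int = (\<integral>\<^sup>+u. ennreal (sing u) \<partial>lborel)"

text \<open>Translation invariance makes the later bound on inverse distances independent of the
  base point.\<close>

lemma sing_shift: "(\<integral>\<^sup>+z. ennreal (sing (z - w)) \<partial>lborel) = sing_int"
proof -
  have "sing_int = (\<integral>\<^sup>+z. ennreal (sing z) \<partial>distr lborel borel ((+) (- w)))"
    by (simp add: sing_int_def lborel_distr_plus)
  also have "\<dots> = (\<integral>\<^sup>+z. ennreal (sing (z - w)) \<partial>lborel)"
    by (subst nn_integral_distr) (auto simp: algebra_simps)
  finally show ?thesis ..
qed

lemma sing_nonneg: "sing u \<ge> 0"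
  by (simp add: sing_def)

lemma chart_le_sing:
  fixes z :: complex
  defines "a \<equiv> sqrt (1 + (cmod z)\<^sup>2)"
  shows "1 / a ^ 3 \<le> sing z"
proof -
  have a: "a \<ge> 1" "a \<ge> cmod z" unfolding a_def by (auto intro!: real_le_rsqrt)
  show ?thesis
  proof (cases "cmod z < 1")
    case True
    have "1 / a ^ 3 \<le> 1" using a by (simp add: one_le_power)
    then show ?thesis using True by (simp add: sing_def add_increasing2)
  next
    case False
    then have "1 / a ^ 3 \<le> 1 / cmod z ^ 3" using a by (intro divide_left_mono power_mono mult_pos_pos) auto
    then show ?thesis using False by (simp add: sing_def)
  qed
qed

lemma fs_nn_integral:
  assumes [measurable]: "f \<in> borel_measurable borel"
  shows "(\<integral>\<^sup>+x. f x \<partial>fs_measure) = (\<integral>\<^sup>+z. ennreal (2 / (1 + (cmod z)\<^sup>2)\<^sup>2) * f (affine_chart z) \<partial>lborel)"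
  unfolding fs_measure_def using affine_chart_measurable
  by (subst nn_integral_distr) (auto simp: nn_integral_density)

text \<open>Write a, b for the square roots of 1 + |z|^2 and 1 + |w|^2, and d for |z - w|. Density
  over chordal distance is b / (a^3 d), at most 1 / (a^2 d) + 1 / a^3. The second term is below
  \<open>sing z\<close>; the first is below \<open>sing z + sing (z - w)\<close>, by cases on d < 1
  and a \<le> d.\<close>

lemma fs_inverse_distance:
  assumes x: "norm x = 1"
  shows "(\<integral>\<^sup>+y. ennreal (1 / norm (x - y)) \<partial>fs_measure) \<le> 2 * sing_int + sing_int"
proof -
  \<comment> \<open>If \<open>x\<close> is the point at infinity, \<open>w\<close> is an arbitrary
    point; then the chordal distance is 2 / a and \<open>sing z\<close> alone dominates.\<close>
  define w where "w = (SOME w. x = affine_chart w)"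
  have "ennreal (2 / (1 + (cmod z)\<^sup>2)\<^sup>2) * ennreal (1 / norm (x - affine_chart z)) \<le> 
     2 * ennreal (sing z) + ennreal (sing (z - w))" for z
  proof -
    define a where "a = sqrt (1 + (cmod z)\<^sup>2)"
    have a: "a \<ge> 1" "(1 + (cmod z)\<^sup>2) = a\<^sup>2" unfolding a_def by (auto intro!: real_le_rsqrt)
    have sa: "1 / a ^ 3 \<le> sing z" unfolding a_def by (rule chart_le_sing)
    have "2 / (1 + (cmod z)\<^sup>2)\<^sup>2 * (1 / norm (x - affine_chart z)) \<le> 2 * sing z + sing (z - w)"
      using x
    proof (cases rule: S2_cases)
      case (1 w')
      have xw: "x = affine_chart w" using 1 someI[of "\<lambda>w. x = affine_chart w" w'] by (simp add: w_def)
      define b where "b = sqrt (1 + (cmod w)\<^sup>2)"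
      define d where "d = cmod (z - w)"
      have b: "b > 0" using chart_r[of w] by (simp add: b_def)
      \<comment> \<open>Triangle inequality for the plane vectors (1, |w|) and (1, |z|), whose
        lengths are b and a.\<close>
      have ba: "b \<le> a + d"
      proof -
        have "b \<le> norm (Complex 1 (cmod w))" by (simp add: b_def complex_norm)
        also have "Complex 1 (cmod w) = Complex 1 (cmod z) + Complex 0 (cmod w - cmod z)" by (simp add: complex_eq_iff)
        also have "norm \<dots> \<le> norm (Complex 1 (cmod z)) + norm (Complex 0 (cmod w - cmod z))" by (rule norm_triangle_ineq)
        also have "\<dots> \<le> a + d" using norm_triangle_ineq3[of w z] by (simp add: a_def d_def complex_norm norm_minus_commute)
        finally show ?thesis .
      qed
      show ?thesis
      proof (cases "d = 0")
        case True
        then show ?thesis using xw sing_nonneg[of z] sing_nonneg[of "z - w"] by (simp add: d_def)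
      next
        case False
        then have d: "d > 0" by (simp add: d_def)
        have nrm: "norm (x - affine_chart z) = 2 * d / (b * a)"
          unfolding xw chart_dist by (simp add: a_def b_def d_def norm_minus_commute)
        have "2 / (1 + (cmod z)\<^sup>2)\<^sup>2 * (1 / norm (x - affine_chart z)) = b / (a ^ 3 * d)"
          unfolding a(2) nrm using a(1) b d by (simp add: field_simps power2_eq_square power3_eq_cube)
        also have "\<dots> \<le> (a + d) / (a ^ 3 * d)" using ba a d by (intro divide_right_mono) auto
        also have "\<dots> = 1 / (a\<^sup>2 * d) + 1 / a ^ 3" using a d by (simp add: field_simps power2_eq_square power3_eq_cube)
        also have "1 / (a\<^sup>2 * d) \<le> sing z + sing (z - w)"
        proof (cases "d < 1")
          case True
          have "1 / (a\<^sup>2 * d) \<le> 1 / d" using a d by (intro divide_left_mono) (auto simp: one_le_power)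
          also have "\<dots> \<le> sing (z - w)" using True by (simp add: sing_def d_def)
          finally show ?thesis using sing_nonneg[of z] by simp
        next
          case False
          then have sd: "sing (z - w) = 1 / d ^ 3" by (simp add: sing_def d_def)
          show ?thesis
          proof (cases "a \<le> d")
            case True
            have "a ^ 3 \<le> a\<^sup>2 * d" using True a by (simp add: power2_eq_square power3_eq_cube)
            then have "1 / (a\<^sup>2 * d) \<le> 1 / a ^ 3" using a d by (intro divide_left_mono) auto
            then show ?thesis using sa sing_nonneg[of "z - w"] by linarith
          next
            case False
            have "d ^ 3 \<le> a\<^sup>2 * d" using False a d by (simp add: power2_eq_square power3_eq_cube mult_mono)
            then have "1 / (a\<^sup>2 * d) \<le> 1 / d ^ 3" using a d by (intro divide_left_mono) auto
            then show ?thesis using sd sing_nonneg[of z] by linarith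
          qed
        qed
        finally show ?thesis using sa by linarith
      qed
    next
      case 2
      have "(norm (x - affine_chart z))\<^sup>2 = 2 * (1 + affine_chart z $ 3)"
        using chart_norm[of z] unfolding norm_eq_1 2
        by (simp add: power2_norm_eq_inner inner_diff_left inner_diff_right inner_vec_def sum_3 axis_def algebra_simps)
      also have "\<dots> = (2 / a)\<^sup>2" using a by (simp add: chart_nth field_simps power2_eq_square)
      finally have nrm: "norm (x - affine_chart z) = 2 / a" using a by (simp add: power2_eq_iff_nonneg)
      have "2 / (1 + (cmod z)\<^sup>2)\<^sup>2 * (1 / norm (x - affine_chart z)) = 1 / a ^ 3"
        unfolding a(2) nrm using a(1) by (simp add: field_simps power2_eq_square power3_eq_cube)
      then show ?thesis using sa sing_nonneg[of z] sing_nonneg[of "z - w"] by linarith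
    qed
    then have "ennreal (2 / (1 + (cmod z)\<^sup>2)\<^sup>2 * (1 / norm (x - affine_chart z))) \<le> ennreal (2 * sing z + sing (z - w))"
      by (rule ennreal_leI)
    moreover have "ennreal (2 * sing z + sing (z - w)) = 2 * ennreal (sing z) + ennreal (sing (z - w))"
      by (simp add: ennreal_plus ennreal_mult' sing_nonneg)
    moreover have "ennreal (2 / (1 + (cmod z)\<^sup>2)\<^sup>2) * ennreal (1 / norm (x - affine_chart z)) =
        ennreal (2 / (1 + (cmod z)\<^sup>2)\<^sup>2 * (1 / norm (x - affine_chart z)))"
      by (rule ennreal_mult[symmetric]) auto
    ultimately show ?thesis by (simp only:)
  qed
  then have "(\<integral>\<^sup>+y. ennreal (1 / norm (x - y)) \<partial>fs_measure) \<le>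
     (\<integral>\<^sup>+z. 2 * ennreal (sing z) + ennreal (sing (z - w)) \<partial>lborel)"
    by (subst fs_nn_integral) (auto intro!: nn_integral_mono)
  also have "\<dots> = 2 * sing_int + sing_int"
    by (subst nn_integral_add) (auto simp: nn_integral_cmult sing_shift sing_int_def[symmetric])
  finally show ?thesis .
qed

lemma fs_sets [measurable_cong, simp]: "sets fs_measure = sets borel"
  by (simp add: fs_measure_def)

lemma fs_space [simp]: "space fs_measure = UNIV"
  by (simp add: fs_measure_def)

lemma fs_finite: "emeasure fs_measure UNIV < \<infinity>"
proof -
  have "emeasure fs_measure UNIV = (\<integral>\<^sup>+x. 1 \<partial>fs_measure)" by simp
  also have "\<dots> = (\<integral>\<^sup>+z. ennreal (2 / (1 + (cmod z)\<^sup>2)\<^sup>2) \<partial>lborel)" by (subst fs_nn_integral) auto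
  also have "\<dots> \<le> (\<integral>\<^sup>+z. 2 * ennreal (sing z) \<partial>lborel)"
  proof (rule nn_integral_mono)
    fix z
    define a where "a = sqrt (1 + (cmod z)\<^sup>2)"
    have a: "a \<ge> 1" "(1 + (cmod z)\<^sup>2) = a\<^sup>2" unfolding a_def by (auto intro!: real_le_rsqrt)
    have "a ^ 3 \<le> (a\<^sup>2)\<^sup>2" using power_increasing[of 3 4 a] a(1) by (simp add: power_mult[symmetric])
    then have "2 / (1 + (cmod z)\<^sup>2)\<^sup>2 \<le> 2 * (1 / a ^ 3)" unfolding a(2) using a by (simp add: frac_le)
    also have "\<dots> \<le> 2 * sing z" using chart_le_sing[of z] by (simp add: a_def)
    finally show "ennreal (2 / (1 + (cmod z)\<^sup>2)\<^sup>2) \<le> 2 * ennreal (sing z)"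
      by (metis ennreal_leI ennreal_mult' ennreal_numeral zero_le_numeral)
  qed
  also have "\<dots> < \<infinity>" using sing_finite by (simp add: nn_integral_cmult ennreal_mult_less_top)
  finally show ?thesis .
qed

text \<open>\<open>fs_measure\<close> is a measure on all of R^3, while elements of
  \<open>area_diffeos\<close> are \<open>undefined\<close> off the sphere. This allows integrands to
  be altered there.\<close>

lemma fs_AE_S2: "AE x in fs_measure. norm x = 1"
proof -
  show ?thesis
    unfolding fs_measure_def using affine_chart_measurable by (subst AE_distr_iff) auto
qed

section \<open>Area-preserving diffeomorphisms preserve the measure\<close>

text \<open>The change of variables formula is phrased with determinants of maps of
  \<open>real^'m\<close>, so the complex coordinate is carried over to
  \<open>real^2\<close>.\<close>

definition of_plane :: "real^2 \<Rightarrow> complex" where "of_plane v = Complex (v $ 1) (v $ 2)"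
definition to_plane :: "complex \<Rightarrow> real^2" where "to_plane z = vector [Re z, Im z]"

lemma plane_inv [simp]: "to_plane (of_plane v) = v" "of_plane (to_plane z) = z"
  by (simp_all add: to_plane_def of_plane_def vec_eq_iff forall_2)

lemma of_plane_linear: "bounded_linear of_plane"
  by (intro linear_conv_bounded_linear[THEN iffD1] linearI) (simp_all add: of_plane_def complex_eq_iff)

lemma of_plane_measurable [measurable]: "of_plane \<in> borel_measurable borel"
  by (intro borel_measurable_continuous_onI linear_continuous_on of_plane_linear)

lemma Basis_plane: "(Basis :: (real^2) set) = {axis 1 1, axis 2 1}"
  by (auto simp: Basis_vec_def UNIV_2 exhaust_2)

lemma lborel_of_plane: "lborel = distr lborel borel of_plane"
proof (rule lborel_eqI)
  fix l u :: complex assume le: "\<And>b. b \<in> Basis \<Longrightarrow> l \<bullet> b \<le> u \<bullet> b"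
  have le': "Re l \<le> Re u" "Im l \<le> Im u" using le[of 1] le[of \<i>] by (auto simp: Basis_complex_def)
  have "of_plane -` box l u = box (to_plane l) (to_plane u)"
    by (auto simp: in_box_complex_iff of_plane_def to_plane_def mem_box_cart forall_2)
  then have "emeasure (distr lborel borel of_plane) (box l u) = emeasure lborel (box (to_plane l) (to_plane u))"
    by (subst emeasure_distr) auto
  also have "\<dots> = (\<Prod>b\<in>Basis. (to_plane u - to_plane l) \<bullet> b)"
    by (rule emeasure_lborel_box) (use le' in \<open>auto simp: Basis_plane inner_axis to_plane_def\<close>)
  also have "\<dots> = (\<Prod>b\<in>Basis. (u - l) \<bullet> b)"
    by (simp add: Basis_plane Basis_complex_def axis_eq_axis inner_axis to_plane_def)
  finally show "emeasure (distr lborel borel of_plane) (box l u) = (\<Prod>b\<in>Basis. (u - l) \<bullet> b)" .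
qed simp

lemma change_of_variables_scalar:
  fixes f :: "real^'m::{finite,wellorder} \<Rightarrow> real" and g :: "real^'m::_ \<Rightarrow> real^'m::_"
  assumes "S \<in> sets lebesgue"
    and "\<And>x. x \<in> S \<Longrightarrow> (g has_derivative g' x) (at x within S)"
    and "inj_on g S"
  shows "(\<lambda>x. \<bar>det (matrix (g' x))\<bar> * f (g x)) absolutely_integrable_on S \<and>
           integral S (\<lambda>x. \<bar>det (matrix (g' x))\<bar> * f (g x)) = b
     \<longleftrightarrow> f absolutely_integrable_on (g ` S) \<and> integral (g ` S) f = b"
  using has_absolute_integral_change_of_variables [OF assms, of "\<lambda>x. vec (f x) :: real^1" "vec b"]
  unfolding absolutely_integrable_on_1_iff integral_on_1_eq integrable_on_1_iff
  by (simp add: vec_eq_iff)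

definition chart2 :: "real^2 \<Rightarrow> real^3" where "chart2 v = affine_chart (of_plane v)"
definition dens2 :: "real^2 \<Rightarrow> real" where "dens2 v = 2 / (1 + (cmod (of_plane v))\<^sup>2)\<^sup>2"

lemma chart2_simps [simp]: "norm (chart2 v) = 1" "chart2 v = chart2 w \<longleftrightarrow> v = w" "chart2 v $ 3 \<noteq> -1"
  "to_plane (stereo (chart2 v)) = v"
  using chart_3_less[of "of_plane v"]
  by (auto simp: chart2_def chart_inj) (metis plane_inv(1))+

lemma dens2_pos: "dens2 v > 0"
  using chart_r[of "of_plane v"] by (simp add: dens2_def)

lemma chart2_derivative:
  obtains D where "(chart2 has_derivative D) (at v)" "fs_form (chart2 v) (D (axis 1 1)) (D (axis 2 1)) = dens2 v"
    "\<And>u. chart2 v \<bullet> D u = 0"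
proof -
  obtain E where E: "(affine_chart has_derivative E) (at (of_plane v))" using affine_chart_derivative by blast
  have D: "(chart2 has_derivative (\<lambda>u. E (of_plane u))) (at v)"
    unfolding chart2_def
    by (rule has_derivative_compose[OF bounded_linear_imp_has_derivative[OF of_plane_linear] E])
  have "of_plane (axis 1 1) = 1" "of_plane (axis 2 1) = \<i>"
    by (simp_all add: of_plane_def axis_def complex_eq_iff)
  then have f: "fs_form (chart2 v) (E (of_plane (axis 1 1))) (E (of_plane (axis 2 1))) = dens2 v"
    using fs_form_chart[OF E] by (simp add: chart2_def dens2_def)
  \<comment> \<open>Differentiating |chart2|^2 = 1 shows that the derivative takes tangent values,
    the only vectors on which \<open>area_diffeos\<close> controls the form.\<close>
  have "((\<lambda>v. chart2 v \<bullet> chart2 v) has_derivative (\<lambda>u. chart2 v \<bullet> E (of_plane u) + E (of_plane u) \<bullet> chart2 v)) (at v)"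
    by (rule has_derivative_inner[OF D D])
  moreover have "chart2 v \<bullet> chart2 v = 1" for v using chart2_simps(1) norm_eq_1 by blast
  ultimately have "((\<lambda>v. 1 :: real) has_derivative (\<lambda>u. chart2 v \<bullet> E (of_plane u) + E (of_plane u) \<bullet> chart2 v)) (at v)" by simp
  from has_derivative_unique[OF this has_derivative_const]
  have "chart2 v \<bullet> E (of_plane u) + E (of_plane u) \<bullet> chart2 v = 0" for u by metis
  then show ?thesis using that[OF D f] by (simp add: inner_commute)
qed

lemma chart2_continuous: "continuous_on S chart2"
  by (intro continuous_at_imp_continuous_on ballI) (metis chart2_derivative has_derivative_continuous)

lemma chart2_measurable [measurable]: "chart2 \<in> borel_measurable borel"
  by (intro borel_measurable_continuous_onI chart2_continuous)

lemma dens2_measurable [measurable]: "dens2 \<in> borel_measurable borel"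
  unfolding dens2_def by measurable

section \<open>Diffeomorphisms in the planar coordinate\<close>

lemma smooth_on_derivative:
  assumes "smooth_on S f" "x \<in> S"
  obtains U g where "open U" "x \<in> U" "\<And>y. y \<in> U \<Longrightarrow> g differentiable (at y)" "\<And>v. continuous_on U (\<lambda>y. frechet_derivative g (at y) v)"
    "\<And>y. y \<in> U \<inter> S \<Longrightarrow> g y = f y"
proof -
  obtain U g where U: "open U" "x \<in> U" "\<And>k. Ck_on k U g" "\<And>y. y \<in> U \<inter> S \<Longrightarrow> g y = f y"
    using assms unfolding smooth_on_def by metis
  show ?thesis using U(3)[of "Suc 0"] by (intro that[OF U(1,2) _ _ U(4)]) auto
qed

lemma smooth_on_continuous: "smooth_on S f \<Longrightarrow> continuous_on S f"
proof (unfold continuous_on_eq_continuous_within, intro ballI)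
  fix x assume "smooth_on S f" "x \<in> S"
  then obtain U g where U: "open U" "x \<in> U" "\<And>y. y \<in> U \<Longrightarrow> g differentiable (at y)" "\<And>y. y \<in> U \<inter> S \<Longrightarrow> g y = f y"
    by (rule smooth_on_derivative) blast
  have "continuous (at x within S) g" using U differentiable_imp_continuous_within continuous_at_imp_continuous_at_within by blast
  then show "continuous (at x within S) f"
    by (rule continuous_transform_within_openin[of _ _ _ "U \<inter> S"]) (use U \<open>x \<in> S\<close> in \<open>auto simp: openin_open\<close>)
qed

lemma stereo_differentiable:
  assumes "x $ 3 \<noteq> -1"
  shows "(\<lambda>x. to_plane (stereo x)) differentiable (at x)"
proof -
  have L: "bounded_linear (\<lambda>x::real^3. vector [x $ 1, x $ 2] :: real^2)"
    by (intro linear_conv_bounded_linear[THEN iffD1] linearI) (simp_all add: vec_eq_iff forall_2)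
  have "c * inverse (c\<^sup>2) = inverse c" for c :: real by (cases "c = 0") (auto simp: power2_eq_square)
  then have "(\<lambda>x. to_plane (stereo x)) = (\<lambda>x. inverse (1 + x $ 3) *\<^sub>R vector [x $ 1, x $ 2])"
    by (simp add: fun_eq_iff to_plane_def stereo_def vec_eq_iff forall_2 Re_divide_of_real Im_divide_of_real divide_inverse del: of_real_add)
  moreover have "(\<lambda>x::real^3. inverse (1 + x $ 3) *\<^sub>R (vector [x $ 1, x $ 2] :: real^2)) differentiable (at x)"
    using assms
    by (intro differentiable_scaleR differentiable_inverse differentiable_add differentiable_const
        bounded_linear_imp_differentiable[OF L] bounded_linear_imp_differentiable[OF bounded_linear_vec_nth]) auto
  ultimately show ?thesis by simp
qed

text \<open>The form is bilinear and alternating, so precomposition with \<open>L\<close> on a plane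
  multiplies it by the determinant.\<close>

lemma fs_form_linear:
  assumes "linear C" "linear L"
  shows "fs_form x (C (L (axis 1 1))) (C (L (axis 2 1))) = det (matrix L :: real^2^2) * fs_form x (C (axis 1 1)) (C (axis 2 1))"
proof -
  have e: "w = w $ 1 *\<^sub>R axis 1 1 + w $ 2 *\<^sub>R axis 2 1" for w :: "real^2"
    by (simp add: vec_eq_iff forall_2 axis_def)
  have C: "C w = w $ 1 *\<^sub>R C (axis 1 1) + w $ 2 *\<^sub>R C (axis 2 1)" for w
    by (subst e[of w]) (simp add: linear_add[OF assms(1)] linear_scale[OF assms(1)])
  show ?thesis
    unfolding C[of "L _"] det_2 matrix_def
    by (simp add: fs_form_def cross_add_left cross_add_right cross_mult_left cross_mult_right
        inner_add_right cross_skew[of "C (axis 2 1)" "C (axis 1 1)"] algebra_simps diff_divide_distrib add_divide_distrib)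
qed

text \<open>\<open>G\<close> is \<phi> in the coordinate, so \<open>chart2 \<circ> G\<close> equals
  \<open>\<phi> \<circ> chart2\<close> near \<open>v\<close>. Invariance of the form, evaluated on
  coordinate vectors on both sides, is then the transformation law of the density. The assumption
  keeps the image away from the point at infinity.\<close>

lemma diffeo_jacobian:
  assumes \<phi>: "\<phi> \<in> area_diffeos" and v: "\<phi> (chart2 v) $ 3 \<noteq> -1"
  defines "G \<equiv> \<lambda>v. to_plane (stereo (\<phi> (chart2 v)))"
  shows "\<exists>G'. (G has_derivative G') (at v) \<and> \<bar>det (matrix G')\<bar> * dens2 (G v) = dens2 v"
proof -
  have sm: "smooth_on S2 \<phi>" and bij: "bij_betw \<phi> S2 S2" using \<phi> by (auto simp: area_diffeos_def)
  have nrm: "norm (\<phi> x) = 1" if "norm x = 1" for x using bij that by (auto simp: bij_betw_def)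
  define x where "x = chart2 v"
  have x: "x \<in> S2" by (simp add: x_def)
  obtain U g where U: "open U" "x \<in> U" "g differentiable (at x)" "\<And>y. y \<in> U \<inter> S2 \<Longrightarrow> g y = \<phi> y"
    using smooth_on_derivative[OF sm x] by metis
  obtain g' where g': "(g has_derivative g') (at x)" using U(3) unfolding differentiable_def by blast
  obtain A where A: "(chart2 has_derivative A) (at v)" "fs_form (chart2 v) (A (axis 1 1)) (A (axis 2 1)) = dens2 v"
    "\<And>u. chart2 v \<bullet> A u = 0" using chart2_derivative by blast
  obtain C where C: "(chart2 has_derivative C) (at (G v))" "fs_form (chart2 (G v)) (C (axis 1 1)) (C (axis 2 1)) = dens2 (G v)"
    using chart2_derivative by blast
  obtain S where S: "((\<lambda>x. to_plane (stereo x)) has_derivative S) (at (\<phi> x))"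
    using stereo_differentiable[OF v] unfolding differentiable_def x_def by blast
  have gx: "g x = \<phi> x" using U x by auto
  have cont: "continuous_on UNIV (\<lambda>v. \<phi> (chart2 v))"
    by (rule continuous_on_compose2[OF smooth_on_continuous[OF sm] chart2_continuous]) auto
  define V where "V = chart2 -` U \<inter> {v. \<phi> (chart2 v) $ 3 \<noteq> -1}"
  have V: "open V" "v \<in> V"
    unfolding V_def using U(2) v
    by (auto simp: x_def intro!: open_Int open_vimage U(1) chart2_continuous open_Collect_neq continuous_intros cont)
  have gc: "((\<lambda>v. \<phi> (chart2 v)) has_derivative (\<lambda>u. g' (A u))) (at v)"
    by (rule has_derivative_transform_within_open[OF has_derivative_compose[OF A(1) g'[unfolded x_def]] V])
      (use U(4) in \<open>auto simp: V_def\<close>)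
  have G': "(G has_derivative (\<lambda>u. S (g' (A u)))) (at v)"
    unfolding G_def by (rule has_derivative_compose[OF gc S[unfolded x_def]])
  have chG: "chart2 (G w) = \<phi> (chart2 w)" if "w \<in> V" for w
    using chart_stereo[of "\<phi> (chart2 w)"] nrm that by (simp add: chart2_def G_def V_def)
  \<comment> \<open>The same map is differentiated a second time, now factored through
    \<open>G\<close>. Uniqueness of the derivative identifies the tangent map of \<phi> with that of
    \<open>G\<close> read through the chart.\<close>
  have "((\<lambda>v. \<phi> (chart2 v)) has_derivative (\<lambda>u. C (S (g' (A u))))) (at v)"
    by (rule has_derivative_transform_within_open[OF has_derivative_compose[OF G' C(1)] V]) (simp add: chG)
  from has_derivative_unique[OF this gc] have CG: "C (S (g' (A u))) = g' (A u)" for u by metis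
  have "(\<phi> has_derivative g') (at x within S2)"
    by (rule has_derivative_transform_eventually[OF has_derivative_at_withinI[OF g']])
       (use U x in \<open>auto simp: eventually_at_topological\<close>)
  then have "fs_form (\<phi> x) (g' (A (axis 1 1))) (g' (A (axis 2 1))) = fs_form x (A (axis 1 1)) (A (axis 2 1))"
    using \<phi> x A(3) unfolding area_diffeos_def x_def by blast
  then have "fs_form (chart2 (G v)) (C (S (g' (A (axis 1 1))))) (C (S (g' (A (axis 2 1))))) = dens2 v"
    using A(2) chG[OF V(2)] by (simp add: CG x_def)
  moreover have "linear C" "linear (\<lambda>u. S (g' (A u)))" using C(1) G' has_derivative_linear by blast+
  ultimately have "det (matrix (\<lambda>u. S (g' (A u)))) * dens2 (G v) = dens2 v"
    using fs_form_linear[of C "\<lambda>u. S (g' (A u))"] C(2) by simp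
  then have "\<bar>det (matrix (\<lambda>u. S (g' (A u)))) * dens2 (G v)\<bar> = dens2 v" using dens2_pos[of v] by simp
  then show ?thesis using G' dens2_pos[of "G v"] by (auto simp: abs_mult)
qed

lemma fs_emeasure_plane:
  assumes [measurable]: "A \<in> sets borel"
  shows "emeasure fs_measure A = (\<integral>\<^sup>+v. ennreal (dens2 v * indicator A (chart2 v)) \<partial>lborel)"
proof -
  have "emeasure fs_measure A = (\<integral>\<^sup>+x. indicator A x \<partial>fs_measure)" by simp
  also have "\<dots> = (\<integral>\<^sup>+z. ennreal (2 / (1 + (cmod z)\<^sup>2)\<^sup>2) * indicator A (affine_chart z) \<partial>lborel)"
    by (rule fs_nn_integral) simp
  also have "\<dots> = (\<integral>\<^sup>+v. ennreal (2 / (1 + (cmod (of_plane v))\<^sup>2)\<^sup>2) * indicator A (affine_chart (of_plane v)) \<partial>lborel)"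
    using affine_chart_measurable by (subst lborel_of_plane, subst nn_integral_distr) auto
  also have "\<dots> = (\<integral>\<^sup>+v. ennreal (dens2 v * indicator A (chart2 v)) \<partial>lborel)"
    by (intro nn_integral_cong) (auto simp: dens2_def chart2_def indicator_def)
  finally show ?thesis .
qed

lemma fs_measure_plane:
  assumes [measurable]: "A \<in> sets borel"
  shows "(\<lambda>v. dens2 v * indicator A (chart2 v)) absolutely_integrable_on UNIV"
    "emeasure fs_measure A = ennreal (integral UNIV (\<lambda>v. dens2 v * indicator A (chart2 v)))"
proof -
  let ?F = "\<lambda>v. dens2 v * indicator A (chart2 v) :: real"
  have nn: "?F v \<ge> 0" for v using dens2_pos[of v] by (simp add: indicator_def)
  have fin: "(\<integral>\<^sup>+v. ennreal (?F v) \<partial>lborel) < \<infinity>"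
    unfolding fs_emeasure_plane[OF assms, symmetric]
    using fs_finite emeasure_mono[of A UNIV fs_measure] by (metis fs_sets sets.top space_borel subset_UNIV order_le_less_trans fs_space)
  have int: "integrable lborel ?F"
    by (rule integrableI_nonneg) (use nn fin in auto)
  then show "?F absolutely_integrable_on UNIV"
    unfolding set_integrable_def by (simp add: integrable_completion)
  show "emeasure fs_measure A = ennreal (integral UNIV ?F)"
    unfolding fs_emeasure_plane[OF assms] integral_lborel[OF int]
    by (rule nn_integral_eq_integral[OF int]) (use nn in auto)
qed

lemma south_pole: "norm (x::real^3) = 1 \<Longrightarrow> x $ 3 = -1 \<Longrightarrow> x = - axis 3 1"
proof (erule S2_cases[of x])
  fix z assume "x $ 3 = -1" "x = affine_chart z"
  then show "x = - axis 3 1" using chart_3_less[of z] by simp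
qed

lemma negligible_subsingleton:
  fixes N :: "'a::euclidean_space set"
  assumes "\<And>v w. v \<in> N \<Longrightarrow> w \<in> N \<Longrightarrow> v = w"
  shows "negligible N"
proof -
  have "N = {} \<or> (\<exists>v. N = {v})" using assms by blast
  then show ?thesis by auto
qed

lemma diffeo_vimage_borel:
  assumes \<phi>: "\<phi> \<in> area_diffeos" and A: "A \<in> sets borel"
  shows "\<phi> -` A \<inter> S2 \<in> sets borel"
proof -
  have "continuous_on S2 \<phi>" using \<phi> smooth_on_continuous by (auto simp: area_diffeos_def)
  then have "\<phi> \<in> borel_measurable (restrict_space borel S2)" by (rule borel_measurable_continuous_on_restrict)
  then have "\<phi> -` A \<inter> space (restrict_space borel S2) \<in> sets (restrict_space borel S2)" using A by (rule measurable_sets)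
  then show ?thesis by (simp add: sets_restrict_space_iff)
qed

text \<open>By \<open>diffeo_jacobian\<close> the density times the Jacobian is the density again,
  so this is a change of variables. The coordinate map omits at most one point of the source, sent
  to infinity by \<phi>, and at most one of the target, the image of infinity.\<close>

lemma diffeo_measure_preserving:
  assumes \<phi>: "\<phi> \<in> area_diffeos" and A: "A \<in> sets borel"
  shows "emeasure fs_measure (\<phi> -` A \<inter> S2) = emeasure fs_measure A"
proof -
  have sm: "smooth_on S2 \<phi>" and bij: "bij_betw \<phi> S2 S2" using \<phi> by (auto simp: area_diffeos_def)
  have nrm: "norm (\<phi> x) = 1" if "norm x = 1" for x using bij that by (auto simp: bij_betw_def)
  have inj: "x = y" if "\<phi> x = \<phi> y" "norm x = 1" "norm y = 1" for x y
    using bij that by (auto simp: bij_betw_def inj_on_def)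
  let ?B = "\<phi> -` A \<inter> S2"
  have B: "?B \<in> sets borel" by (rule diffeo_vimage_borel[OF assms])
  let ?F = "\<lambda>A v. dens2 v * indicator A (chart2 v) :: real"
  define T where "T = {v. \<phi> (chart2 v) $ 3 \<noteq> -1}"
  define G where "G = (\<lambda>v. to_plane (stereo (\<phi> (chart2 v))))"
  have "continuous_on UNIV (\<lambda>v. \<phi> (chart2 v))"
    by (rule continuous_on_compose2[OF smooth_on_continuous[OF sm] chart2_continuous]) auto
  then have "open T" unfolding T_def by (intro open_Collect_neq continuous_intros)
  then have T: "T \<in> sets lebesgue" by auto
  obtain G' where G': "\<And>v. v \<in> T \<Longrightarrow> (G has_derivative G' v) (at v)" "\<And>v. v \<in> T \<Longrightarrow> \<bar>det (matrix (G' v))\<bar> * dens2 (G v) = dens2 v"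
    using diffeo_jacobian[OF \<phi>] unfolding T_def G_def mem_Collect_eq by metis
  have chG: "chart2 (G v) = \<phi> (chart2 v)" if "v \<in> T" for v
    using chart_stereo[of "\<phi> (chart2 v)"] nrm that by (simp add: chart2_def G_def T_def)
  have injG: "inj_on G T"
  proof (rule inj_onI)
    fix v w assume "v \<in> T" "w \<in> T" "G v = G w"
    then have "\<phi> (chart2 v) = \<phi> (chart2 w)" using chG by metis
    then show "v = w" using inj[of "chart2 v" "chart2 w"] by simp
  qed
  have FB: "\<bar>det (matrix (G' v))\<bar> * ?F A (G v) = ?F ?B v" if "v \<in> T" for v
    using G'(2)[OF that] chG[OF that] by (auto simp: indicator_def)
  have abs: "?F ?B absolutely_integrable_on T"
    by (rule set_integrable_subset[OF fs_measure_plane(1)[OF B] T]) simp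
  have "(\<lambda>v. \<bar>det (matrix (G' v))\<bar> * ?F A (G v)) absolutely_integrable_on T \<longleftrightarrow> ?F ?B absolutely_integrable_on T"
    by (rule set_integrable_cong[OF refl refl FB])
  moreover have "integral T (\<lambda>v. \<bar>det (matrix (G' v))\<bar> * ?F A (G v)) = integral T (?F ?B)"
    by (rule integral_cong[OF FB])
  ultimately have "integral (G ` T) (?F A) = integral T (?F ?B)"
    using change_of_variables_scalar[OF T has_derivative_at_withinI[OF G'(1)] injG, of "?F A" "integral T (?F ?B)"] abs by blast
  moreover have "integral T (?F ?B) = integral UNIV (?F ?B)"
  proof (rule integral_spike_set)
    have "negligible (- T)"
    proof (rule negligible_subsingleton)
      fix v w assume "v \<in> - T" "w \<in> - T"
      then have "\<phi> (chart2 v) = - axis 3 1" "\<phi> (chart2 w) = - axis 3 1"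
        unfolding T_def by (auto intro!: south_pole nrm)
      then show "v = w" using inj[of "chart2 v" "chart2 w"] by simp
    qed
    then show "negligible {x \<in> UNIV - T. ?F ?B x \<noteq> 0}" by (rule negligible_subset) auto
  qed auto
  moreover have "integral (G ` T) (?F A) = integral UNIV (?F A)"
  proof (rule integral_spike_set)
    have "negligible (- (G ` T))"
    proof (rule negligible_subsingleton)
      have s: "chart2 w = \<phi> (- axis 3 1)" if "w \<in> - (G ` T)" for w
      proof -
        have "chart2 w \<in> \<phi> ` S2" using bij by (simp add: bij_betw_def)
        then obtain x where x: "norm x = 1" "chart2 w = \<phi> x" by auto
        show ?thesis using x(1)
        proof (cases rule: S2_cases)
          case (1 z)
          have "to_plane z \<in> T" "G (to_plane z) = w"
            using x 1 chart2_simps(3,4)[of w] by (auto simp: T_def G_def chart2_def)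
          then show ?thesis using that by blast
        qed (use x in auto)
      qed
      fix v w assume "v \<in> - (G ` T)" "w \<in> - (G ` T)"
      then show "v = w" using s by (metis chart2_simps(2))
    qed
    then show "negligible {x \<in> UNIV - G ` T. ?F A x \<noteq> 0}" by (rule negligible_subset) auto
  qed auto
  ultimately show ?thesis using fs_measure_plane(2)[OF A] fs_measure_plane(2)[OF B] by simp
qed

text \<open>Extending \<phi> by the identity off the sphere gives a Borel map of R^3 whose image
  measure is \<open>fs_measure\<close>.\<close>

lemma diffeo_nn_integral:
  assumes \<phi>: "\<phi> \<in> area_diffeos" and f [measurable]: "f \<in> borel_measurable borel"
  shows "(\<integral>\<^sup>+x. f (if norm x = 1 then \<phi> x else x) \<partial>fs_measure) = (\<integral>\<^sup>+x. f x \<partial>fs_measure)"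
proof -
  let ?\<psi> = "\<lambda>x. if norm x = 1 then \<phi> x else x"
  have pre: "?\<psi> -` A = (\<phi> -` A \<inter> S2) \<union> (A - S2)" for A by (auto split: if_splits)
  have m: "?\<psi> \<in> borel_measurable borel"
    by (rule measurableI) (auto simp: pre intro!: sets.Un diffeo_vimage_borel[OF \<phi>])
  have "distr fs_measure borel ?\<psi> = fs_measure"
  proof (rule measure_eqI)
    fix A assume "A \<in> sets (distr fs_measure borel ?\<psi>)"
    then have A [measurable]: "A \<in> sets borel" by simp
    have "emeasure (distr fs_measure borel ?\<psi>) A = emeasure fs_measure (?\<psi> -` A)"
      using m by (subst emeasure_distr) (auto simp: measurable_def)
    also have "\<dots> = emeasure fs_measure (\<phi> -` A \<inter> S2)"
      by (rule emeasure_eq_AE)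
         (use fs_AE_S2 in \<open>auto simp: pre intro!: sets.Un diffeo_vimage_borel[OF \<phi>]\<close>)
    finally show "emeasure (distr fs_measure borel ?\<psi>) A = emeasure fs_measure A"
      by (simp add: diffeo_measure_preserving[OF \<phi> A])
  qed simp
  then have "(\<integral>\<^sup>+x. f x \<partial>fs_measure) = (\<integral>\<^sup>+x. f x \<partial>distr fs_measure borel ?\<psi>)" by (simp only:)
  also have "\<dots> = (\<integral>\<^sup>+x. f (?\<psi> x) \<partial>fs_measure)"
    using m f by (intro nn_integral_distr) (auto simp: measurable_def)
  finally show ?thesis ..
qed

section \<open>Rotation of four points along a path\<close>

text \<open>The velocity of the trajectory that starts at \<open>x\<close>, in contrast to
  \<open>generator\<close>, which is taken at the current position. Cross-ratios are followed along
  trajectories.\<close>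

definition velocity :: "(real \<Rightarrow> real^3 \<Rightarrow> real^3) \<Rightarrow> real \<Rightarrow> real^3 \<Rightarrow> real^3" where
  "velocity \<gamma> t x = vector_derivative (\<lambda>s. \<gamma> s x) (at t within {0..1})"

text \<open>\<open>F\<close> is the time derivative of a local smooth extension. The extension
  changes from point to point but the velocity does not, so continuity of the velocity follows
  locally.\<close>

lemma path_local:
  assumes "is_path \<gamma>" "t \<in> {0..1}" "x \<in> S2"
  obtains U F where "open U" "(t, x) \<in> U" "continuous_on U F"
    "\<And>s y. (s, y) \<in> U \<Longrightarrow> s \<in> {0..1} \<Longrightarrow> y \<in> S2 \<Longrightarrow> ((\<lambda>r. \<gamma> r y) has_vector_derivative F (s, y)) (at s within {0..1})"
proof -
  have "smooth_on ({0..1} \<times> S2) (\<lambda>(t, x). \<gamma> t x)" "(t, x) \<in> {0..1} \<times> S2" using assms by (auto simp: is_path_def)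
  then obtain U g where U: "open U" "(t, x) \<in> U" "\<And>y. y \<in> U \<Longrightarrow> g differentiable (at y)"
    "\<And>v. continuous_on U (\<lambda>y. frechet_derivative g (at y) v)"
    "\<And>y. y \<in> U \<inter> ({0..1} \<times> S2) \<Longrightarrow> g y = (case y of (t, x) \<Rightarrow> \<gamma> t x)" by (rule smooth_on_derivative) blast
  show ?thesis
  proof (rule that[OF U(1,2) U(4)[of "(1, 0)"]])
    fix s y assume sy: "(s, y) \<in> U" "s \<in> {0..1}" "y \<in> S2"
    have "((\<lambda>r. (r, y)) has_derivative (\<lambda>h. (h, 0))) (at s)"
      by (intro derivative_intros)
    from has_derivative_compose[OF this frechet_derivative_works[THEN iffD1, OF U(3)[OF sy(1)]]]
    have d1: "((\<lambda>r. g (r, y)) has_derivative (\<lambda>h. frechet_derivative g (at (s, y)) (h, 0))) (at s)" .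
    have d2: "frechet_derivative g (at (s, y)) (h, 0) = h *\<^sub>R frechet_derivative g (at (s, y)) (1, 0)" for h
      using linear_scale[OF linear_frechet_derivative[OF U(3)[OF sy(1)]], of h "(1, 0)"] by simp
    have "((\<lambda>r. g (r, y)) has_derivative (\<lambda>h. h *\<^sub>R frechet_derivative g (at (s, y)) (1, 0))) (at s within {0..1})"
      by (rule has_derivative_eq_rhs[OF has_derivative_at_withinI[OF d1]]) (rule ext, rule d2)
    then show "((\<lambda>r. \<gamma> r y) has_vector_derivative frechet_derivative g (at (s, y)) (1, 0)) (at s within {0..1})"
      unfolding has_vector_derivative_def
    proof (rule has_derivative_transform_eventually)
      have "open ((\<lambda>r. (r, y)) -` U)" by (intro open_vimage U(1) continuous_intros)
      then show "\<forall>\<^sub>F r in at s within {0..1}. g (r, y) = \<gamma> r y"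
        unfolding eventually_at_topological using sy U(5) by (intro exI[of _ "(\<lambda>r. (r, y)) -` U"]) auto
    qed (use sy U(5)[of "(s, y)"] in auto)
  qed
qed

lemma velocity_eq:
  assumes "((\<lambda>r. \<gamma> r y) has_vector_derivative v) (at s within {0..1})" "s \<in> {0..1}"
  shows "velocity \<gamma> s y = v"
  unfolding velocity_def using assms vector_derivative_within_closed_interval[of 0 1 s] by auto

lemma path_velocity:
  assumes "is_path \<gamma>" "t \<in> {0..1}" "x \<in> S2"
  shows "((\<lambda>r. \<gamma> r x) has_vector_derivative velocity \<gamma> t x) (at t within {0..1})"
proof -
  obtain U F where U: "(t, x) \<in> U" "\<And>s y. (s, y) \<in> U \<Longrightarrow> s \<in> {0..1} \<Longrightarrow> y \<in> S2 \<Longrightarrow> ((\<lambda>r. \<gamma> r y) has_vector_derivative F (s, y)) (at s within {0..1})"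
    using path_local[OF assms] by metis
  show ?thesis using U(2)[OF U(1) assms(2,3)] velocity_eq assms(2) by metis
qed

lemma velocity_continuous:
  assumes "is_path \<gamma>"
  shows "continuous_on ({0..1} \<times> S2) (\<lambda>(t, x). velocity \<gamma> t x)"
  unfolding continuous_on_eq_continuous_within
proof (intro ballI)
  fix p :: "real \<times> (real^3)" assume p: "p \<in> {0..1} \<times> S2"
  obtain t x where px: "p = (t, x)" by (cases p)
  with p have tx: "t \<in> {0..1}" "x \<in> S2" by auto
  obtain U F where U: "open U" "p \<in> U" "continuous_on U F"
    "\<And>s y. (s, y) \<in> U \<Longrightarrow> s \<in> {0..1} \<Longrightarrow> y \<in> S2 \<Longrightarrow> ((\<lambda>r. \<gamma> r y) has_vector_derivative F (s, y)) (at s within {0..1})"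
    using path_local[OF assms tx] unfolding px by metis
  have "continuous (at p within {0..1} \<times> S2) F"
    using U(1-3) continuous_on_eq_continuous_at continuous_at_imp_continuous_at_within by blast
  then show "continuous (at p within {0..1} \<times> S2) (\<lambda>(t, x). velocity \<gamma> t x)"
    by (rule continuous_transform_within_openin[of _ _ _ "U \<inter> ({0..1} \<times> S2)"])
       (use U(1,2) p velocity_eq[OF U(4)] in \<open>auto simp: openin_open\<close>)
qed

lemma path_continuous: "is_path \<gamma> \<Longrightarrow> continuous_on ({0..1} \<times> S2) (\<lambda>(t, x). \<gamma> t x)"
  unfolding is_path_def using smooth_on_continuous by blast

lemma path_continuous_compose:
  assumes "is_path \<gamma>" "continuous_on S T" "continuous_on S f" "\<And>p. p \<in> S \<Longrightarrow> T p \<in> {0..1}" "\<And>p. p \<in> S \<Longrightarrow> norm (f p) = 1"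
  shows "continuous_on S (\<lambda>p. \<gamma> (T p) (f p))" "continuous_on S (\<lambda>p. velocity \<gamma> (T p) (f p))"
proof -
  have sub: "(\<lambda>p. (T p, f p)) ` S \<subseteq> {0..1} \<times> S2" using assms(4,5) by auto
  show "continuous_on S (\<lambda>p. \<gamma> (T p) (f p))"
    using continuous_on_compose2[OF path_continuous[OF assms(1)] continuous_on_Pair[OF assms(2,3)] sub] by simp
  show "continuous_on S (\<lambda>p. velocity \<gamma> (T p) (f p))"
    using continuous_on_compose2[OF velocity_continuous[OF assms(1)] continuous_on_Pair[OF assms(2,3)] sub] by simp
qed

lemma path_in_S2: "is_path \<gamma> \<Longrightarrow> t \<in> {0..1} \<Longrightarrow> norm x = 1 \<Longrightarrow> norm (\<gamma> t x) = 1"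
  unfolding is_path_def area_diffeos_def using bij_betwE by fastforce

lemma path_inj: "is_path \<gamma> \<Longrightarrow> t \<in> {0..1} \<Longrightarrow> norm x = 1 \<Longrightarrow> norm y = 1 \<Longrightarrow> x \<noteq> y \<Longrightarrow> \<gamma> t x \<noteq> \<gamma> t y"
  by (auto simp: is_path_def area_diffeos_def bij_betw_def inj_on_def)

lemma continuous_on_Complex':
  "continuous_on S f \<Longrightarrow> continuous_on S g \<Longrightarrow> continuous_on S (\<lambda>x. Complex (f x) (g x))"
  by (simp add: Complex_eq continuous_intros)

lemma continuous_on_cr:
  fixes a :: "'a::t2_space \<Rightarrow> real^3"
  assumes "continuous_on S a" "continuous_on S b" "continuous_on S c" "continuous_on S d"
  shows "continuous_on S (\<lambda>x. cr (a x) (b x) (c x) (d x))"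
  unfolding cr_def by (intro continuous_on_Complex' continuous_intros continuous_on_cross assms)

lemma continuous_on_cr1:
  fixes a :: "'a::t2_space \<Rightarrow> real^3"
  assumes "continuous_on S a" "continuous_on S b" "continuous_on S c" "continuous_on S d"
  shows "continuous_on S (\<lambda>x. cr1 (a x) (b x) (c x) (d x))"
  unfolding cr1_def by (intro continuous_on_Complex' continuous_intros continuous_on_cross assms)

text \<open>The curve \<open>c\<close> carries the second point from \<open>y1\<close> to
  \<open>y2\<close> while avoiding \<open>y3\<close> and \<open>y4\<close>. At its start
  \<open>cr_same\<close> makes both cross-ratios positive, and at times 0 and 1 the two paths agree.
  No homotopy from \<gamma> to \<delta> enters.\<close>

lemma path_phase_transfer:
  fixes c :: "real \<Rightarrow> real^3"
  assumes \<gamma>: "is_path \<gamma>" "is_path \<delta>" "\<gamma> 0 = \<delta> 0" "\<gamma> 1 = \<delta> 1"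
    and c: "continuous_on {0..1} c" "\<And>s. s \<in> {0..1} \<Longrightarrow> norm (c s) = 1 \<and> c s \<noteq> y3 \<and> c s \<noteq> y4" "c 0 = y1" "c 1 = y2"
    and y: "norm y3 = 1" "norm y4 = 1"
    and ph: "phase (\<lambda>t. cr (\<delta> t y1) (\<delta> t y2) (\<delta> t y3) (\<delta> t y4)) \<psi>"
  shows "\<exists>\<psi>'. phase (\<lambda>t. cr (\<gamma> t y1) (\<gamma> t y2) (\<gamma> t y3) (\<gamma> t y4)) \<psi>' \<and> \<psi>' 1 - \<psi>' 0 = \<psi> 1 - \<psi> 0"
proof -
  have y1: "norm y1 = 1" "y1 \<noteq> y3" "y1 \<noteq> y4" using c(2)[of 0] c(3) by auto
  define M where "M = (\<lambda>(\<gamma> :: real \<Rightarrow> real^3 \<Rightarrow> real^3) s t. cr (\<gamma> t y1) (\<gamma> t (c s)) (\<gamma> t y3) (\<gamma> t y4))"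
  have c1: "continuous_on ({0..1} \<times> {0..1}) (\<lambda>(s,t). M \<gamma> s t)" if g: "is_path \<gamma>" for \<gamma>
  proof -
    have *: "continuous_on ({0..1::real} \<times> {0..1}) (\<lambda>p. \<gamma> (snd p) (f p))" if "continuous_on ({0..1} \<times> {0..1}) f" "\<And>p. p \<in> {0..1} \<times> {0..1} \<Longrightarrow> norm (f p) = 1" for f
      by (rule path_continuous_compose(1)[OF g]) (use that in \<open>auto intro!: continuous_intros\<close>)
    have cc: "continuous_on ({0..1::real} \<times> {0..1::real}) (\<lambda>p. c (fst p))"
      by (rule continuous_on_compose2[OF c(1)]) (auto intro!: continuous_intros)
    show ?thesis
      unfolding M_def case_prod_unfold
      by (intro continuous_on_cr * cc continuous_on_const) (use c(2) y y1 in auto)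
  qed
  have c2: "M \<gamma> s t \<noteq> 0" if "is_path \<gamma>" "s \<in> {0..1}" "t \<in> {0..1}" for \<gamma> s t
  proof -
    have "cmod (M \<gamma> s t) \<noteq> 0"
      unfolding M_def using that y y1 c(2)[OF that(2)]
      by (subst cr_norm) (auto simp: path_in_S2 path_inj)
    then show ?thesis by auto
  qed
  have c3: "\<exists>r>0. M \<gamma> 0 t = of_real r" if "is_path \<gamma>" "t \<in> {0..1}" for \<gamma> t
    unfolding M_def c(3) using that y y1
    by (subst cr_same) (auto simp: path_in_S2 path_inj intro!: exI[of _ "(norm (\<gamma> t y1 - \<gamma> t y3) * norm (\<gamma> t y1 - \<gamma> t y4))\<^sup>2 / 2"])
  have "\<exists>\<psi>'. phase (M \<gamma> 1) \<psi>' \<and> \<psi>' 1 - \<psi>' 0 = \<psi> 1 - \<psi> 0"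
    by (rule phase_transfer[where N = "M \<delta>"]) (use c1 c2 c3 \<gamma> ph c(4) in \<open>auto simp: M_def\<close>)
  then show ?thesis by (simp add: M_def c(4))
qed

text \<open>In the coordinate the twist multiplies by a rotation of rate \<open>k\<close> times the
  height. As \<open>cr\<close> is the conjugate of the cross-ratio, the sign of
  \<open>twist_phase\<close> is reversed.\<close>

lemma twist_path_phase:
  assumes l: "cmod z4 < cmod z1" "cmod z4 < cmod z2" "cmod z1 < cmod z3" "cmod z2 < cmod z3"
  defines "y \<equiv> affine_chart"
  shows "\<exists>\<psi>. phase (\<lambda>t. cr (twist_path k t (y z1)) (twist_path k t (y z2)) (twist_path k t (y z3)) (twist_path k t (y z4))) \<psi>
     \<and> \<bar>\<psi> 1 - \<psi> 0 - k * (y z1 $ 3 - y z2 $ 3)\<bar> \<le> 4 * pi"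
proof -
  let ?a = "\<lambda>z. k * y z $ 3"
  have tw: "twist_path k t (y z) = y (z * cis (?a z * t))" for z t
    by (simp add: twist_path_def y_def twist_chart mult_ac)
  obtain \<psi> where \<psi>: "phase (\<lambda>t. (z1 * cis (?a z1 * t) - z3 * cis (?a z3 * t)) * (z2 * cis (?a z2 * t) - z4 * cis (?a z4 * t))
     * cnj ((z2 * cis (?a z2 * t) - z3 * cis (?a z3 * t)) * (z1 * cis (?a z1 * t) - z4 * cis (?a z4 * t)))) \<psi>"
    "\<bar>\<psi> 1 - \<psi> 0 - (?a z2 - ?a z1)\<bar> \<le> 4 * pi"
    using twist_phase[OF l] by blast
  have "phase (\<lambda>t. cr (twist_path k t (y z1)) (twist_path k t (y z2)) (twist_path k t (y z3)) (twist_path k t (y z4))) (\<lambda>t. - \<psi> t)"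
    unfolding tw unfolding y_def cr_chart
    by (rule phase_scale[OF phase_cnj[OF \<psi>(1)[unfolded y_def]]]) (use chart_r in simp)
  then show ?thesis using \<psi>(2)
    by (intro exI[of _ "\<lambda>t. - \<psi> t"]) (auto simp: algebra_simps abs_le_iff)
qed

lemma path_rotation_bound:
  assumes \<gamma>: "is_path \<gamma>" "\<gamma> 0 = restrict id S2" "\<gamma> 1 = restrict (twist k) S2" and k: "k \<ge> 0"
    and z: "cmod z4 < 1" "1 < cmod z1" "cmod z1 < 2" "3 < cmod z2" "cmod z2 < 4" "5 < cmod z3"
    and y: "y1 = affine_chart z1" "y2 = affine_chart z2" "y3 = affine_chart z3" "y4 = affine_chart z4"
  defines "f \<equiv> \<lambda>t. cr (\<gamma> t y1) (\<gamma> t y2) (\<gamma> t y3) (\<gamma> t y4)"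
    and "f' \<equiv> \<lambda>t. crd (\<gamma> t y1) (\<gamma> t y2) (\<gamma> t y3) (\<gamma> t y4) (velocity \<gamma> t y1) (velocity \<gamma> t y2) (velocity \<gamma> t y3) (velocity \<gamma> t y4)"
  shows "k / 5 - 4 * pi \<le> integral {0..1} (\<lambda>t. cmod (f' t) / cmod (f t))"
    "continuous_on {0..1} (\<lambda>t. cmod (f' t) / cmod (f t))"
proof -
  have z0: "z1 \<noteq> 0" "z2 \<noteq> 0" using z by auto
  \<comment> \<open>Interpolation of logarithms from z1 to z2: the moduli stay between |z1| and
    |z2|, away from |z4| < 1 and |z3| > 5. A straight segment could cross the unit disc.\<close>
  define w where "w = (\<lambda>s::real. exp ((1 - of_real s) * Ln z1 + of_real s * Ln z2))"
  have w: "1 < cmod (w s)" "cmod (w s) < 5" if "s \<in> {0..1}" for s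
  proof -
    have e: "cmod (w s) = exp ((1 - s) * ln (cmod z1) + s * ln (cmod z2))" using z0 by (simp add: w_def)
    have conv: "(1 - s) * a + s * b < u" if "a < u" "b < u" for a b u :: real
      using convex_bound_lt[OF that, of "1 - s" s] \<open>s \<in> {0..1}\<close> by simp
    have "(1 - s) * (- ln (cmod z1)) + s * (- ln (cmod z2)) < 0"
      using ln_gt_zero[of "cmod z1"] ln_gt_zero[of "cmod z2"] z by (intro conv) linarith+
    then have "0 < (1 - s) * ln (cmod z1) + s * ln (cmod z2)" by simp
    then show "1 < cmod (w s)" unfolding e by simp
    have "(1 - s) * ln (cmod z1) + s * ln (cmod z2) < ln 5" using z z0 by (intro conv) auto
    then have "cmod (w s) < exp (ln 5)" unfolding e by (rule exp_less_mono)
    then show "cmod (w s) < 5" by simp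
  qed
  have cs: "continuous_on {0..1} (\<lambda>s. affine_chart (w s))"
    unfolding w_def by (rule continuous_on_compose2[OF chart_continuous[of UNIV]]) (auto intro!: continuous_intros)
  have cn: "norm (affine_chart (w s)) = 1 \<and> affine_chart (w s) \<noteq> y3 \<and> affine_chart (w s) \<noteq> y4" if "s \<in> {0..1}" for s
    using w[OF that] z by (auto simp: y chart_inj)
  obtain \<psi>0 where p0: "phase (\<lambda>t. cr (twist_path k t y1) (twist_path k t y2) (twist_path k t y3) (twist_path k t y4)) \<psi>0"
      "\<bar>\<psi>0 1 - \<psi>0 0 - k * (y1 $ 3 - y2 $ 3)\<bar> \<le> 4 * pi"
    using twist_path_phase[of z4 z1 z2 z3 k] z unfolding y by auto
  have e0: "\<gamma> 0 = twist_path k 0" "\<gamma> 1 = twist_path k 1"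
    using \<gamma> by (auto simp: twist_path_0) (simp add: twist_path_def)
  obtain \<psi> where p: "phase f \<psi>" "\<psi> 1 - \<psi> 0 = \<psi>0 1 - \<psi>0 0"
    using path_phase_transfer[OF \<gamma>(1) twist_path_is_path e0 cs cn _ _ _ _ p0(1)] z0
    unfolding f_def by (auto simp: w_def y)
  have n: "norm y1 = 1" "norm y2 = 1" "norm y3 = 1" "norm y4 = 1" by (simp_all add: y)
  have ne: "y1 \<noteq> y3" "y1 \<noteq> y4" "y2 \<noteq> y3" "y2 \<noteq> y4" using z by (auto simp: y chart_inj)
  have nz: "f t \<noteq> 0" if "t \<in> {0..1}" for t
  proof -
    have "cmod (f t) \<noteq> 0"
      unfolding f_def using that n ne \<gamma>(1) by (subst cr_norm) (auto simp: path_in_S2 path_inj)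
    then show ?thesis by auto
  qed
  have D: "(f has_vector_derivative f' t) (at t within {0..1})" if "t \<in> {0..1}" for t
    unfolding f_def f'_def by (intro cr_derivative path_velocity \<gamma>(1) that) (use n in auto)
  have cv: "continuous_on {0..1} (\<lambda>t. velocity \<gamma> t x)" if "norm x = 1" for x
    by (rule path_continuous_compose(2)[OF \<gamma>(1)]) (use that in \<open>auto intro!: continuous_intros\<close>)
  have cg: "continuous_on {0..1} (\<lambda>t. \<gamma> t x)" if "norm x = 1" for x
    by (rule path_continuous_compose(1)[OF \<gamma>(1)]) (use that in \<open>auto intro!: continuous_intros\<close>)
  have cf': "continuous_on {0..1} f'"
    unfolding f'_def crd_def by (intro continuous_intros continuous_on_cr1 cv cg n)
  have cf: "continuous_on {0..1} f"
    unfolding f_def by (intro continuous_on_cr cg n)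
  show "continuous_on {0..1} (\<lambda>t. cmod (f' t) / cmod (f t))"
    by (intro continuous_intros cf cf') (use nz in auto)
  \<comment> \<open>The height (1 - r^2) / (1 + r^2) equals -3/5 at r = 2 and -4/5 at r = 3. This
    gap is the origin of \<open>k / 5\<close>.\<close>
  have h1: "y1 $ 3 \<ge> - 3 / 5"
    using z(2,3) power_mono[of "cmod z1" 2 2] chart_r[of z1] by (simp add: y chart_nth field_simps)
  have h2: "y2 $ 3 \<le> - 4 / 5"
    using z(4,5) power_mono[of 3 "cmod z2" 2] chart_r[of z2] by (simp add: y chart_nth field_simps)
  have "k * (1 / 5) \<le> k * (y1 $ 3 - y2 $ 3)" using h1 h2 k by (intro mult_left_mono) auto
  then have "k / 5 - 4 * pi \<le> \<bar>\<psi> 1 - \<psi> 0\<bar>" using p0(2) p(2) by simp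
  also have "\<dots> \<le> integral {0..1} (\<lambda>t. cmod (f' t) / cmod (f t))"
    by (rule phase_lower_bound[OF D cf' nz p(1)])
  finally show "k / 5 - 4 * pi \<le> integral {0..1} (\<lambda>t. cmod (f' t) / cmod (f t))" .
qed

section \<open>Length and mean speed\<close>

interpretation fs: finite_measure fs_measure
  using fs_finite by (intro finite_measureI) simp

text \<open>Extended by zero off the cylinder, so that Fubini applies to Borel functions on the
  whole product of R and R^3; likewise \<open>vel\<close>.\<close>

definition pos :: "(real \<Rightarrow> real^3 \<Rightarrow> real^3) \<Rightarrow> real \<times> (real^3) \<Rightarrow> real^3" where
  "pos \<gamma> p = (if p \<in> {0..1} \<times> S2 then \<gamma> (fst p) (snd p) else 0)"

definition vel :: "(real \<Rightarrow> real^3 \<Rightarrow> real^3) \<Rightarrow> real \<times> (real^3) \<Rightarrow> real^3" where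
  "vel \<gamma> p = (if p \<in> {0..1} \<times> S2 then velocity \<gamma> (fst p) (snd p) else 0)"

lemma cylinder_closed: "closed ({0..1::real} \<times> S2)"
  by (intro closed_Times) auto

lemma pos_measurable: "is_path \<gamma> \<Longrightarrow> pos \<gamma> \<in> borel_measurable (borel \<Otimes>\<^sub>M borel)"
  using path_continuous[of \<gamma>] cylinder_closed unfolding borel_prod
  by (simp add: pos_def[abs_def] borel_measurable_continuous_on_if borel_closed case_prod_unfold)

lemma vel_measurable: "is_path \<gamma> \<Longrightarrow> vel \<gamma> \<in> borel_measurable (borel \<Otimes>\<^sub>M borel)"
  using velocity_continuous[of \<gamma>] cylinder_closed unfolding borel_prod
  by (simp add: vel_def[abs_def] borel_measurable_continuous_on_if borel_closed case_prod_unfold)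

lemma vel_bounded: "is_path \<gamma> \<Longrightarrow> \<exists>B\<ge>0. \<forall>p. norm (vel \<gamma> p) \<le> B"
proof -
  assume "is_path \<gamma>"
  then have "bounded ((\<lambda>(t, x). velocity \<gamma> t x) ` ({0..1} \<times> S2))"
    by (intro compact_imp_bounded compact_continuous_image velocity_continuous compact_Times) auto
  then obtain B where "\<forall>y\<in>(\<lambda>(t, x). velocity \<gamma> t x) ` ({0..1} \<times> S2). norm y \<le> B"
    unfolding bounded_iff by blast
  then have B: "norm (velocity \<gamma> (fst p) (snd p)) \<le> B" if "p \<in> {0..1} \<times> S2" for p using that by force
  show ?thesis
    using B by (intro exI[of _ "max B 0"]) (auto simp: vel_def le_max_iff_disj)
qed

lemma generator_velocity: "generator \<gamma> t x = velocity \<gamma> t (inv_into S2 (\<gamma> t) x)"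
  by (simp add: generator_def velocity_def)

lemma generator_measurable:
  assumes \<gamma>: "is_path \<gamma>" "t \<in> {0..1}"
  shows "generator \<gamma> t \<in> borel_measurable borel"
proof -
  have d: "\<gamma> t \<in> area_diffeos" using \<gamma> by (auto simp: is_path_def)
  then have b: "bij_betw (\<gamma> t) S2 S2" by (simp add: area_diffeos_def)
  \<comment> \<open>Off the sphere the inverse is one fixed unspecified point, so the generator is
    constant there and Borel measurable overall.\<close>
  have "inv_into S2 (\<gamma> t) x = (SOME y. False)" if "x \<notin> S2" for x
  proof -
    have "(\<lambda>y. y \<in> S2 \<and> \<gamma> t y = x) = (\<lambda>y. False)" using that bij_betwE[OF b] by blast
    then show ?thesis unfolding inv_into_def by (simp only:)
  qed
  then have "generator \<gamma> t = (\<lambda>x. if x \<in> S2 then velocity \<gamma> t (inv_into S2 (\<gamma> t) x) else velocity \<gamma> t (SOME y. False))"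
    by (auto simp: generator_velocity fun_eq_iff)
  moreover have "continuous_on S2 (\<lambda>x. velocity \<gamma> t (inv_into S2 (\<gamma> t) x))"
  proof (rule path_continuous_compose(2)[OF \<gamma>(1)])
    show "continuous_on S2 (inv_into S2 (\<gamma> t))" using d smooth_on_continuous by (auto simp: area_diffeos_def)
    show "norm (inv_into S2 (\<gamma> t) x) = 1" if "x \<in> S2" for x
      using bij_betwE[OF bij_betw_inv_into[OF b]] that by auto
  qed (use \<gamma>(2) in auto)
  then have "(\<lambda>x. if x \<in> S2 then velocity \<gamma> t (inv_into S2 (\<gamma> t) x) else velocity \<gamma> t (SOME y. False)) \<in> borel_measurable borel"
    by (intro borel_measurable_continuous_on_if) auto
  ultimately show ?thesis by (simp only:)
qed

text \<open>Takes the place of Hoelder's inequality: with \<open>s\<close> the L^p norm of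
  \<open>a\<close>, integration bounds the L^1 norm by (total area + 1) \<open>s\<close>.\<close>

lemma young_powr:
  fixes a s p :: real
  assumes "s > 0" "a \<ge> 0" "p \<ge> 1"
  shows "a \<le> s + s powr (1 - p) * a powr p"
proof (cases "a \<le> s")
  case True
  then show ?thesis by (simp add: add_increasing2)
next
  case False
  then have a: "a > s" by simp
  have "a = a powr (1 - p) * a powr p" using assms a by (simp add: powr_add[symmetric])
  also have "\<dots> \<le> s powr (1 - p) * a powr p" using assms a by (intro mult_right_mono powr_mono2') auto
  finally show ?thesis using assms by linarith
qed

text \<open>Area preservation replaces the generator at the point reached from \<open>x\<close> by
  the velocity of that trajectory. The factor 2 undoes \<open>fs_norm\<close>; the total area plus 1
  comes from \<open>young_powr\<close> at each time.\<close>

lemma lp_length_lower_bound: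
  assumes \<gamma>: "is_path \<gamma>" and p: "p \<ge> 1"
  shows "(\<integral>\<^sup>+t. \<integral>\<^sup>+x. ennreal (norm (vel \<gamma> (t, x))) \<partial>fs_measure \<partial>lborel) \<le> ennreal (2 * (measure fs_measure UNIV + 1)) * ennreal (lp_length p \<gamma>)"
    "lp_length p \<gamma> \<ge> 0"
proof -
  note [measurable] = vel_measurable[OF \<gamma>]
  define q where "q = (\<lambda>t x. (norm (vel \<gamma> (t, x)) / 2) powr p)"
  have q_meas [measurable]: "(\<lambda>z. q (fst z) (snd z)) \<in> borel_measurable (borel \<Otimes>\<^sub>M fs_measure)"
    unfolding q_def by measurable
  define J where "J = (\<lambda>t. \<integral>\<^sup>+x. ennreal (q t x) \<partial>fs_measure)"
  obtain B where B: "B \<ge> 0" "\<And>z. norm (vel \<gamma> z) \<le> B" using vel_bounded[OF \<gamma>] by blast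
  define C where "C = (B / 2) powr p * measure fs_measure UNIV"
  have JC: "J t \<le> ennreal C" for t
  proof -
    have "J t \<le> (\<integral>\<^sup>+x. ennreal ((B / 2) powr p) \<partial>fs_measure)"
      unfolding J_def q_def by (intro nn_integral_mono ennreal_leI powr_mono2) (use B p in auto)
    then show ?thesis by (simp add: C_def fs.emeasure_eq_measure ennreal_mult)
  qed
  define I where "I = (\<lambda>t. enn2real (J t))"
  have JI: "J t = ennreal (I t)" and I0: "I t \<ge> 0" and IC: "I t \<le> C" for t
    using JC[of t] by (auto simp: I_def ennreal_enn2real_if top_unique enn2real_leI C_def)
  have J_meas [measurable]: "J \<in> borel_measurable borel"
    unfolding J_def by measurable
  have I_meas [measurable]: "I \<in> borel_measurable borel"
    unfolding I_def by measurable
  define L where "L = (\<lambda>t. I t powr (1 / p))"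
  have L_meas [measurable]: "L \<in> borel_measurable borel"
    unfolding L_def by measurable
  have gen: "(LINT x|fs_measure. fs_norm (generator \<gamma> t x) powr p) = I t" if t: "t \<in> {0..1}" for t
  proof -
    note [measurable] = generator_measurable[OF \<gamma> t]
    have d: "\<gamma> t \<in> area_diffeos" using \<gamma> t by (auto simp: is_path_def)
    then have b: "bij_betw (\<gamma> t) S2 S2" by (simp add: area_diffeos_def)
    let ?f = "\<lambda>x. (norm (generator \<gamma> t x) / 2) powr p"
    have "(LINT x|fs_measure. ?f x) = enn2real (\<integral>\<^sup>+x. ennreal (?f x) \<partial>fs_measure)"
      by (rule integral_eq_nn_integral) auto
    also have "(\<integral>\<^sup>+x. ennreal (?f x) \<partial>fs_measure) = (\<integral>\<^sup>+x. ennreal (?f (if norm x = 1 then \<gamma> t x else x)) \<partial>fs_measure)"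
      by (rule diffeo_nn_integral[OF d, of "\<lambda>x. ennreal (?f x)", symmetric]) measurable
    also have "\<dots> = J t"
      unfolding J_def
    proof (rule nn_integral_cong_AE, rule AE_mp[OF fs_AE_S2], rule AE_I2, rule impI)
      fix x :: "real^3" assume x: "norm x = 1"
      have "inv_into S2 (\<gamma> t) (\<gamma> t x) = x" using b x by (simp add: bij_betw_def)
      then show "ennreal (?f (if norm x = 1 then \<gamma> t x else x)) = ennreal (q t x)"
        using x t by (simp add: q_def generator_velocity vel_def)
    qed
    finally show ?thesis by (simp add: fs_norm_def I_def)
  qed
  have lpL: "lp_length p \<gamma> = integral {0..1} L"
    unfolding lp_length_def L_def by (rule integral_cong) (simp add: gen)
  have "set_integrable lborel {0..1} L"
    unfolding set_integrable_def
  proof (rule integrableI_bounded_set_indicator[where B = "C powr (1 / p)"])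
    show "AE x in lborel. x \<in> {0..1} \<longrightarrow> norm (L x) \<le> C powr (1 / p)"
      using IC I0 p by (auto simp: L_def intro!: powr_mono2)
  qed auto
  then have "L integrable_on {0..1}" by (rule set_borel_integral_eq_integral(1))
  then have hi: "(L has_integral lp_length p \<gamma>) {0..1}" unfolding lpL by (rule integrable_integral)
  have "(\<lambda>t. indicator {0..1} t * L t) = (\<lambda>t. if t \<in> {0..1} then L t else 0)" by (auto simp: indicator_def)
  then have "((\<lambda>t. indicator {0..1} t * L t) has_integral lp_length p \<gamma>) UNIV"
    using hi has_integral_restrict_UNIV[of "{0..1}" L] by simp
  then have lp: "(\<integral>\<^sup>+t. ennreal (indicator {0..1} t * L t) \<partial>lborel) = ennreal (lp_length p \<gamma>)"
    by (intro nn_integral_has_integral_lborel) (auto simp: L_def[abs_def])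
  show "lp_length p \<gamma> \<ge> 0" unfolding lpL by (rule Henstock_Kurzweil_Integration.integral_nonneg) (use \<open>L integrable_on {0..1}\<close> in \<open>auto simp: L_def\<close>)
  let ?m = "measure fs_measure UNIV"
  have main: "(\<integral>\<^sup>+x. ennreal (norm (vel \<gamma> (t, x))) \<partial>fs_measure) \<le> ennreal (2 * (?m + 1)) * ennreal (indicator {0..1} t * L t)" for t
  proof (cases "t \<in> {0..1}")
    case False
    then have "vel \<gamma> (t, x) = 0" for x by (auto simp: vel_def)
    then show ?thesis by simp
  next
    case t: True
    show ?thesis
    proof (cases "I t = 0")
      \<comment> \<open>\<open>young_powr\<close> needs s > 0. When the L^p norm at time
        \<open>t\<close> vanishes, the velocity is zero almost everywhere.\<close>
      case True
      then have "(\<integral>\<^sup>+x. ennreal (q t x) \<partial>fs_measure) = 0" using JI[of t] by (simp add: J_def)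
      then have "AE x in fs_measure. ennreal (q t x) = 0"
        by (subst (asm) nn_integral_0_iff_AE) (auto simp: q_def)
      then have "AE x in fs_measure. ennreal (norm (vel \<gamma> (t, x))) = 0" by (auto simp: q_def)
      then have "(\<integral>\<^sup>+x. ennreal (norm (vel \<gamma> (t, x))) \<partial>fs_measure) = (\<integral>\<^sup>+x. 0 \<partial>fs_measure)" by (rule nn_integral_cong_AE)
      then show ?thesis by simp
    next
      case False
      then have I: "I t > 0" using I0[of t] by simp
      define s where "s = L t"
      have s: "s > 0" using I by (simp add: s_def L_def)
      have sp: "s powr p = I t" using I p by (simp add: s_def L_def powr_powr)
      have "(\<integral>\<^sup>+x. ennreal (norm (vel \<gamma> (t, x))) \<partial>fs_measure) \<le>
          (\<integral>\<^sup>+x. ennreal (2 * s) + ennreal (2 * s powr (1 - p)) * ennreal (q t x) \<partial>fs_measure)"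
      proof (rule nn_integral_mono)
        fix x
        have "norm (vel \<gamma> (t, x)) \<le> 2 * s + 2 * s powr (1 - p) * q t x"
          using young_powr[OF s _ p, of "norm (vel \<gamma> (t, x)) / 2"] by (simp add: q_def algebra_simps)
        then have "ennreal (norm (vel \<gamma> (t, x))) \<le> ennreal (2 * s + 2 * s powr (1 - p) * q t x)" by (rule ennreal_leI)
        also have "\<dots> = ennreal (2 * s) + ennreal (2 * s powr (1 - p)) * ennreal (q t x)"
          using s by (simp add: q_def ennreal_plus ennreal_mult)
        finally show "ennreal (norm (vel \<gamma> (t, x))) \<le> ennreal (2 * s) + ennreal (2 * s powr (1 - p)) * ennreal (q t x)" .
      qed
      also have "\<dots> = ennreal (2 * s) * emeasure fs_measure UNIV + ennreal (2 * s powr (1 - p)) * J t"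
        unfolding J_def by (subst nn_integral_add) (auto simp: nn_integral_cmult q_def)
      also have "\<dots> = ennreal (2 * s * ?m + 2 * s powr (1 - p) * I t)"
        using s I unfolding JI fs.emeasure_eq_measure by (simp add: ennreal_mult ennreal_plus)
      also have "2 * s * ?m + 2 * s powr (1 - p) * I t = 2 * (?m + 1) * s"
        unfolding sp[symmetric] using s by (simp add: powr_add[symmetric] mult.assoc algebra_simps)
      also have "ennreal (2 * (?m + 1) * s) = ennreal (2 * (?m + 1)) * ennreal (indicator {0..1} t * L t)"
        using t s by (simp add: s_def[symmetric] ennreal_mult)
      finally show ?thesis .
    qed
  qed
  have "(\<integral>\<^sup>+t. \<integral>\<^sup>+x. ennreal (norm (vel \<gamma> (t, x))) \<partial>fs_measure \<partial>lborel) \<le> (\<integral>\<^sup>+t. ennreal (2 * (?m + 1)) * ennreal (indicator {0..1} t * L t) \<partial>lborel)"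
    by (rule nn_integral_mono) (rule main)
  also have "\<dots> = ennreal (2 * (?m + 1)) * ennreal (lp_length p \<gamma>)"
    by (subst nn_integral_cmult) (auto simp: lp)
  finally show "(\<integral>\<^sup>+t. \<integral>\<^sup>+x. ennreal (norm (vel \<gamma> (t, x))) \<partial>fs_measure \<partial>lborel) \<le> ennreal (2 * (?m + 1)) * ennreal (lp_length p \<gamma>)" .
qed

section \<open>Averaging over four points\<close>

text \<open>One point is absent from each term and contributes the area \<open>m\<close>; each
  inverse distance has its own partner variable and contributes \<open>J\<close>. The weight
  \<open>w\<close> appears in the hypothesis so that the bound is required only where it does not
  vanish.\<close>

lemma four_point_integrals:
  fixes w :: "real^3 \<Rightarrow> ennreal" and e :: "(real^3) \<times> (real^3) \<Rightarrow> ennreal"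
  assumes [measurable]: "w \<in> borel_measurable borel" "e \<in> borel_measurable (borel \<Otimes>\<^sub>M borel)"
    and bound: "\<And>a. w a * (\<integral>\<^sup>+b. e (a, b) \<partial>fs_measure) \<le> w a * J"
  defines "m \<equiv> emeasure fs_measure UNIV"
  shows "(\<integral>\<^sup>+a. \<integral>\<^sup>+b. \<integral>\<^sup>+c. \<integral>\<^sup>+d. w a * e (a, c) * e (a, d) \<partial>fs_measure \<partial>fs_measure \<partial>fs_measure \<partial>fs_measure) \<le> m * J * J * (\<integral>\<^sup>+a. w a \<partial>fs_measure)"
    "(\<integral>\<^sup>+a. \<integral>\<^sup>+b. \<integral>\<^sup>+c. \<integral>\<^sup>+d. w b * e (b, c) * e (b, d) \<partial>fs_measure \<partial>fs_measure \<partial>fs_measure \<partial>fs_measure) \<le> m * J * J * (\<integral>\<^sup>+a. w a \<partial>fs_measure)"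
    "(\<integral>\<^sup>+a. \<integral>\<^sup>+b. \<integral>\<^sup>+c. \<integral>\<^sup>+d. w c * e (c, a) * e (c, b) \<partial>fs_measure \<partial>fs_measure \<partial>fs_measure \<partial>fs_measure) \<le> m * J * J * (\<integral>\<^sup>+a. w a \<partial>fs_measure)"
    "(\<integral>\<^sup>+a. \<integral>\<^sup>+b. \<integral>\<^sup>+c. \<integral>\<^sup>+d. w d * e (d, a) * e (d, b) \<partial>fs_measure \<partial>fs_measure \<partial>fs_measure \<partial>fs_measure) \<le> m * J * J * (\<integral>\<^sup>+a. w a \<partial>fs_measure)"
proof -
  define E where "E = (\<lambda>a. \<integral>\<^sup>+b. e (a, b) \<partial>fs_measure)"
  have Ea: "(\<integral>\<^sup>+b. e (a, b) \<partial>fs_measure) = E a" for a by (simp add: E_def)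
  have E_meas [measurable]: "E \<in> borel_measurable borel" unfolding E_def by measurable
  have swap: "(\<integral>\<^sup>+x. \<integral>\<^sup>+y. f (x, y) \<partial>fs_measure \<partial>fs_measure) = (\<integral>\<^sup>+y. \<integral>\<^sup>+x. f (x, y) \<partial>fs_measure \<partial>fs_measure)"
    if "f \<in> borel_measurable (fs_measure \<Otimes>\<^sub>M fs_measure)" for f
  proof -
    interpret pair_sigma_finite fs_measure fs_measure by standard
    show ?thesis by (rule Fubini'[symmetric]) (use that in simp)
  qed
  have K: "(\<integral>\<^sup>+a. m * (w a * E a * E a) \<partial>fs_measure) \<le> m * J * J * (\<integral>\<^sup>+a. w a \<partial>fs_measure)"
  proof -
    have "m * (w a * E a * E a) \<le> m * J * J * w a" for a
    proof -
      have "w a * E a * E a \<le> w a * J * E a" using bound[of a] unfolding E_def by (intro mult_right_mono) auto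
      also have "\<dots> = (w a * E a) * J" by (simp add: mult_ac)
      also have "\<dots> \<le> (w a * J) * J" using bound[of a] unfolding E_def by (intro mult_right_mono) auto
      finally have "m * (w a * E a * E a) \<le> m * (w a * J * J)" by (rule mult_left_mono) simp
      then show ?thesis by (simp add: mult_ac)
    qed
    then have "(\<integral>\<^sup>+a. m * (w a * E a * E a) \<partial>fs_measure) \<le> (\<integral>\<^sup>+a. m * J * J * w a \<partial>fs_measure)" by (intro nn_integral_mono)
    then show ?thesis by (simp add: nn_integral_cmult)
  qed
  have cd: "(\<integral>\<^sup>+c. \<integral>\<^sup>+d. w a * e (a, c) * e (a, d) \<partial>fs_measure \<partial>fs_measure) = w a * E a * E a" for a
    by (simp add: nn_integral_cmult nn_integral_multc Ea)
  \<comment> \<open>Here the base point is an inner variable, and Fubini must move it outside before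
    its two partners can be integrated.\<close>
  have abc: "(\<integral>\<^sup>+a. \<integral>\<^sup>+b. \<integral>\<^sup>+c. m * (w c * e (c, a) * e (c, b)) \<partial>fs_measure \<partial>fs_measure \<partial>fs_measure) = (\<integral>\<^sup>+a. m * (w a * E a * E a) \<partial>fs_measure)"
  proof -
    have "(\<integral>\<^sup>+b. \<integral>\<^sup>+c. m * (w c * e (c, a) * e (c, b)) \<partial>fs_measure \<partial>fs_measure) = (\<integral>\<^sup>+c. m * (w c * e (c, a) * E c) \<partial>fs_measure)" for a
      by (subst swap[of "\<lambda>(b, c). m * (w c * e (c, a) * e (c, b))", simplified])
         (simp_all add: nn_integral_cmult Ea)
    then have "(\<integral>\<^sup>+a. \<integral>\<^sup>+b. \<integral>\<^sup>+c. m * (w c * e (c, a) * e (c, b)) \<partial>fs_measure \<partial>fs_measure \<partial>fs_measure) = (\<integral>\<^sup>+a. \<integral>\<^sup>+c. m * (w c * e (c, a) * E c) \<partial>fs_measure \<partial>fs_measure)"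
      by simp
    also have "\<dots> = (\<integral>\<^sup>+c. \<integral>\<^sup>+a. m * (w c * e (c, a) * E c) \<partial>fs_measure \<partial>fs_measure)"
      by (subst swap[of "\<lambda>(a, c). m * (w c * e (c, a) * E c)", simplified]) simp_all
    also have "\<dots> = (\<integral>\<^sup>+a. m * (w a * E a * E a) \<partial>fs_measure)"
      by (simp add: nn_integral_cmult nn_integral_multc Ea)
    finally show ?thesis .
  qed
  show "(\<integral>\<^sup>+a. \<integral>\<^sup>+b. \<integral>\<^sup>+c. \<integral>\<^sup>+d. w a * e (a, c) * e (a, d) \<partial>fs_measure \<partial>fs_measure \<partial>fs_measure \<partial>fs_measure) \<le> m * J * J * (\<integral>\<^sup>+a. w a \<partial>fs_measure)"
    using K unfolding cd by (simp add: m_def mult.commute)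
  show "(\<integral>\<^sup>+a. \<integral>\<^sup>+b. \<integral>\<^sup>+c. \<integral>\<^sup>+d. w b * e (b, c) * e (b, d) \<partial>fs_measure \<partial>fs_measure \<partial>fs_measure \<partial>fs_measure) \<le> m * J * J * (\<integral>\<^sup>+a. w a \<partial>fs_measure)"
    using K unfolding cd by (simp add: m_def nn_integral_cmult mult.commute)
  show "(\<integral>\<^sup>+a. \<integral>\<^sup>+b. \<integral>\<^sup>+c. \<integral>\<^sup>+d. w c * e (c, a) * e (c, b) \<partial>fs_measure \<partial>fs_measure \<partial>fs_measure \<partial>fs_measure) \<le> m * J * J * (\<integral>\<^sup>+a. w a \<partial>fs_measure)"
    using K unfolding abc[symmetric] by (simp add: m_def mult.commute)
  have "(\<integral>\<^sup>+c. \<integral>\<^sup>+d. w d * e (d, a) * e (d, b) \<partial>fs_measure \<partial>fs_measure) = (\<integral>\<^sup>+c. m * (w c * e (c, a) * e (c, b)) \<partial>fs_measure)" for a b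
    by (simp add: nn_integral_cmult m_def mult.commute)
  then show "(\<integral>\<^sup>+a. \<integral>\<^sup>+b. \<integral>\<^sup>+c. \<integral>\<^sup>+d. w d * e (d, a) * e (d, b) \<partial>fs_measure \<partial>fs_measure \<partial>fs_measure \<partial>fs_measure) \<le> m * J * J * (\<integral>\<^sup>+a. w a \<partial>fs_measure)"
    using K unfolding abc[symmetric] by simp
qed

definition region :: "complex set \<Rightarrow> (real^3) set" where
  "region Z = {x. norm x = 1 \<and> x $ 3 \<noteq> -1 \<and> stereo x \<in> Z}"

lemma region_borel [measurable]:
  assumes "open Z"
  shows "region Z \<in> sets borel"
proof -
  have [measurable]: "stereo \<in> borel_measurable borel"
    unfolding stereo_def Complex_eq by measurable
  have [measurable]: "Z \<in> sets borel" using assms by simp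
  show ?thesis unfolding region_def by measurable
qed

lemma region_chart: "x \<in> region Z \<Longrightarrow> \<exists>z\<in>Z. x = affine_chart z"
  unfolding region_def by (auto intro!: bexI[of _ "stereo x"] simp: chart_stereo)

text \<open>The density is positive and a nonempty open planar set is not negligible.\<close>

lemma region_positive:
  assumes "open Z" "Z \<noteq> {}"
  shows "emeasure fs_measure (region Z) > 0"
proof -
  have [measurable]: "Z \<in> sets borel" using assms by simp
  have "affine_chart z \<in> region Z \<longleftrightarrow> z \<in> Z" for z
    using chart_3_less[of z] by (auto simp: region_def)
  then have ind: "indicator (region Z) (affine_chart z) = (indicator Z z :: ennreal)" for z by (simp add: indicator_def)
  have "emeasure fs_measure (region Z) = (\<integral>\<^sup>+x. indicator (region Z) x \<partial>fs_measure)"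
    using region_borel[OF assms(1)] by simp
  also have "\<dots> = (\<integral>\<^sup>+z. ennreal (2 / (1 + (cmod z)\<^sup>2)\<^sup>2) * indicator Z z \<partial>lborel)"
    using region_borel[OF assms(1)] by (subst fs_nn_integral) (auto simp: ind)
  also have "\<dots> \<noteq> 0"
  proof
    assume "(\<integral>\<^sup>+z. ennreal (2 / (1 + (cmod z)\<^sup>2)\<^sup>2) * indicator Z z \<partial>lborel) = 0"
    then have "AE z in lborel. ennreal (2 / (1 + (cmod z)\<^sup>2)\<^sup>2) * indicator Z z = 0"
      by (subst (asm) nn_integral_0_iff_AE) auto
    moreover have "ennreal (2 / (1 + (cmod z)\<^sup>2)\<^sup>2) \<noteq> 0" for z
      using chart_r[of z] by (simp add: ennreal_eq_0_iff not_le)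
    ultimately have "AE z in lborel. z \<notin> Z" by (auto simp: indicator_def)
    then have "Z \<in> null_sets lborel" by (simp add: AE_iff_null_sets)
    then have "negligible Z" unfolding negligible_iff_null_sets by (rule null_sets_completionI)
    then show False using open_not_negligible assms by blast
  qed
  finally show ?thesis by (simp add: zero_less_iff_neq_zero)
qed

definition inv_dist :: "(real \<Rightarrow> real^3 \<Rightarrow> real^3) \<Rightarrow> real \<Rightarrow> (real^3) \<times> (real^3) \<Rightarrow> ennreal" where
  "inv_dist \<gamma> t = (\<lambda>(a, b). ennreal (1 / norm (pos \<gamma> (t, a) - pos \<gamma> (t, b))))"

definition speed :: "(real \<Rightarrow> real^3 \<Rightarrow> real^3) \<Rightarrow> real \<Rightarrow> real^3 \<Rightarrow> ennreal" where
  "speed \<gamma> t x = ennreal (norm (vel \<gamma> (t, x)))"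

text \<open>The partner \<open>b\<close> enters only through its position at time \<open>t\<close>,
  and the flow preserves area, so the integral is that of \<open>fs_inverse_distance\<close> with
  base point the position of \<open>a\<close>. Elsewhere the speed is zero.\<close>

lemma inv_dist_bound:
  assumes \<gamma>: "is_path \<gamma>"
  shows "speed \<gamma> t a * (\<integral>\<^sup>+b. inv_dist \<gamma> t (a, b) \<partial>fs_measure) \<le> speed \<gamma> t a * (2 * sing_int + sing_int)"
proof (cases "t \<in> {0..1} \<and> norm a = 1")
  case False
  then show ?thesis by (auto simp: speed_def vel_def)
next
  case True
  then have t: "t \<in> {0..1}" and a: "norm a = 1" by auto
  have d: "\<gamma> t \<in> area_diffeos" using \<gamma> t by (auto simp: is_path_def)
  let ?f = "\<lambda>x. ennreal (1 / norm (\<gamma> t a - x))"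
  have "(\<integral>\<^sup>+b. inv_dist \<gamma> t (a, b) \<partial>fs_measure) = (\<integral>\<^sup>+b. ?f (if norm b = 1 then \<gamma> t b else b) \<partial>fs_measure)"
    by (rule nn_integral_cong_AE, rule AE_mp[OF fs_AE_S2], rule AE_I2) (use t a in \<open>simp add: inv_dist_def pos_def\<close>)
  also have "\<dots> = (\<integral>\<^sup>+b. ?f b \<partial>fs_measure)"
    by (rule diffeo_nn_integral[OF d]) measurable
  also have "\<dots> \<le> 2 * sing_int + sing_int"
    by (rule fs_inverse_distance) (rule path_in_S2[OF \<gamma> t a])
  finally show ?thesis by (rule mult_left_mono) simp
qed

text \<open>Eight times this bounds the logarithmic derivative of \<open>cr\<close> along the trajectories of the four points.\<close>

definition swirl :: "(real \<Rightarrow> real^3 \<Rightarrow> real^3) \<Rightarrow> real \<Rightarrow> real^3 \<Rightarrow> real^3 \<Rightarrow> real^3 \<Rightarrow> real^3 \<Rightarrow> ennreal" where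
  "swirl \<gamma> t a b c d =
     speed \<gamma> t a * inv_dist \<gamma> t (a, c) * inv_dist \<gamma> t (a, d) + speed \<gamma> t b * inv_dist \<gamma> t (b, c) * inv_dist \<gamma> t (b, d)
   + speed \<gamma> t c * inv_dist \<gamma> t (c, a) * inv_dist \<gamma> t (c, b) + speed \<gamma> t d * inv_dist \<gamma> t (d, a) * inv_dist \<gamma> t (d, b)"

lemma speed_measurable:
  assumes \<gamma>: "is_path \<gamma>" and [measurable]: "T \<in> borel_measurable M" "a \<in> borel_measurable M"
  shows "(\<lambda>x. speed \<gamma> (T x) (a x)) \<in> borel_measurable M"
proof -
  note [measurable] = vel_measurable[OF \<gamma>]
  show ?thesis unfolding speed_def by measurable
qed

lemma inv_dist_measurable:
  assumes \<gamma>: "is_path \<gamma>" and [measurable]: "T \<in> borel_measurable M" "a \<in> borel_measurable M" "b \<in> borel_measurable M"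
  shows "(\<lambda>x. inv_dist \<gamma> (T x) (a x, b x)) \<in> borel_measurable M"
proof -
  note [measurable] = pos_measurable[OF \<gamma>]
  show ?thesis unfolding inv_dist_def prod.case by measurable
qed

lemma swirl_measurable:
  assumes "is_path \<gamma>" "T \<in> borel_measurable M" "a \<in> borel_measurable M" "b \<in> borel_measurable M"
    "c \<in> borel_measurable M" "d \<in> borel_measurable M"
  shows "(\<lambda>x. swirl \<gamma> (T x) (a x) (b x) (c x) (d x)) \<in> borel_measurable M"
  unfolding swirl_def
  by (intro borel_measurable_add borel_measurable_times_ennreal speed_measurable inv_dist_measurable assms)

lemma ennreal_four:
  assumes "v1 \<ge> 0" "p1 \<ge> 0" "q1 \<ge> 0" "v2 \<ge> 0" "p2 \<ge> 0" "q2 \<ge> 0" "v3 \<ge> 0" "p3 \<ge> 0" "q3 \<ge> 0" "v4 \<ge> 0" "p4 \<ge> 0" "q4 \<ge> 0"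
  shows "ennreal (8 * (v1 * (p1 * q1) + v2 * (p2 * q2) + v3 * (p3 * q3) + v4 * (p4 * q4))) =
    8 * (ennreal v1 * ennreal p1 * ennreal q1 + ennreal v2 * ennreal p2 * ennreal q2 + ennreal v3 * ennreal p3 * ennreal q3 + ennreal v4 * ennreal p4 * ennreal q4)"
  using assms by (simp add: ennreal_mult ennreal_plus mult.assoc)

text \<open>Time integration of \<open>crd_bound\<close> against \<open>path_rotation_bound\<close>.
  For small \<open>k\<close> the left side is truncated to 0 by \<open>ennreal\<close>.\<close>

lemma swirl_lower_bound:
  assumes \<gamma>: "is_path \<gamma>" "\<gamma> 0 = restrict id S2" "\<gamma> 1 = restrict (twist k) S2" and k: "k \<ge> 0"
    and z: "cmod z4 < 1" "1 < cmod z1" "cmod z1 < 2" "3 < cmod z2" "cmod z2 < 4" "5 < cmod z3"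
    and y: "y1 = affine_chart z1" "y2 = affine_chart z2" "y3 = affine_chart z3" "y4 = affine_chart z4"
  shows "ennreal (k / 5 - 4 * pi) \<le> 8 * (\<integral>\<^sup>+t. swirl \<gamma> t y1 y2 y3 y4 \<partial>lborel)"
proof -
  define h where "h = (\<lambda>t. cmod (crd (\<gamma> t y1) (\<gamma> t y2) (\<gamma> t y3) (\<gamma> t y4) (velocity \<gamma> t y1) (velocity \<gamma> t y2) (velocity \<gamma> t y3) (velocity \<gamma> t y4))
      / cmod (cr (\<gamma> t y1) (\<gamma> t y2) (\<gamma> t y3) (\<gamma> t y4)))"
  have h: "k / 5 - 4 * pi \<le> integral {0..1} h" "continuous_on {0..1} h"
    using path_rotation_bound[OF \<gamma> k z y] unfolding h_def by auto
  have n: "norm y1 = 1" "norm y2 = 1" "norm y3 = 1" "norm y4 = 1" by (simp_all add: y)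
  have ne: "y1 \<noteq> y3" "y1 \<noteq> y4" "y2 \<noteq> y3" "y2 \<noteq> y4" using z by (auto simp: y chart_inj)
  have meas: "(\<lambda>t. indicator {0..1} t * h t) \<in> borel_measurable borel"
    using borel_measurable_continuous_on_indicator[OF _ h(2)] by simp
  have "(\<lambda>t. indicator {0..1} t * h t) = (\<lambda>t. if t \<in> {0..1} then h t else 0)" by (auto simp: indicator_def)
  then have "((\<lambda>t. indicator {0..1} t * h t) has_integral integral {0..1} h) UNIV"
    using integrable_integral[OF integrable_continuous_real[OF h(2)]] has_integral_restrict_UNIV[of "{0..1}" h] by simp
  then have "(\<integral>\<^sup>+t. ennreal (indicator {0..1} t * h t) \<partial>lborel) = ennreal (integral {0..1} h)"
    by (intro nn_integral_has_integral_lborel meas) (auto simp: h_def)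
  then have "ennreal (k / 5 - 4 * pi) \<le> (\<integral>\<^sup>+t. ennreal (indicator {0..1} t * h t) \<partial>lborel)"
    using h(1) by (simp add: ennreal_leI)
  also have "\<dots> \<le> (\<integral>\<^sup>+t. 8 * swirl \<gamma> t y1 y2 y3 y4 \<partial>lborel)"
  proof (rule nn_integral_mono)
    fix t
    show "ennreal (indicator {0..1} t * h t) \<le> 8 * swirl \<gamma> t y1 y2 y3 y4"
    proof (cases "t \<in> {0..1}")
      case t: True
      let ?d = "\<lambda>a b. 1 / norm (\<gamma> t a - \<gamma> t b)" let ?v = "\<lambda>a. norm (velocity \<gamma> t a)"
      have "h t \<le> 8 * (?v y1 * (?d y1 y3 * ?d y1 y4) + ?v y2 * (?d y2 y3 * ?d y2 y4) + ?v y3 * (?d y3 y1 * ?d y3 y2) + ?v y4 * (?d y4 y1 * ?d y4 y2))"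
        unfolding h_def by (rule crd_bound) (use n ne \<gamma>(1) t in \<open>auto simp: path_in_S2 path_inj\<close>)
      then have "ennreal (h t) \<le> ennreal (8 * (?v y1 * (?d y1 y3 * ?d y1 y4) + ?v y2 * (?d y2 y3 * ?d y2 y4) + ?v y3 * (?d y3 y1 * ?d y3 y2) + ?v y4 * (?d y4 y1 * ?d y4 y2)))"
        by (rule ennreal_leI)
      also have "\<dots> = 8 * swirl \<gamma> t y1 y2 y3 y4"
        by (subst ennreal_four) (use t n in \<open>auto simp: swirl_def speed_def inv_dist_def vel_def pos_def\<close>)
      finally show ?thesis using t by simp
    qed simp
  qed
  also have "\<dots> = 8 * (\<integral>\<^sup>+t. swirl \<gamma> t y1 y2 y3 y4 \<partial>lborel)"
    by (rule nn_integral_cmult) (rule swirl_measurable[OF \<gamma>(1)], auto)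
  finally show ?thesis .
qed

lemma nn_integral_fs4:
  assumes "f \<in> borel_measurable (fs_measure \<Otimes>\<^sub>M (fs_measure \<Otimes>\<^sub>M (fs_measure \<Otimes>\<^sub>M fs_measure)))"
  shows "(\<integral>\<^sup>+y. f y \<partial>(fs_measure \<Otimes>\<^sub>M (fs_measure \<Otimes>\<^sub>M (fs_measure \<Otimes>\<^sub>M fs_measure)))) =
    (\<integral>\<^sup>+a. \<integral>\<^sup>+b. \<integral>\<^sup>+c. \<integral>\<^sup>+d. f (a, b, c, d) \<partial>fs_measure \<partial>fs_measure \<partial>fs_measure \<partial>fs_measure)"
    "sigma_finite_measure (fs_measure \<Otimes>\<^sub>M (fs_measure \<Otimes>\<^sub>M (fs_measure \<Otimes>\<^sub>M fs_measure)))"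
    "emeasure (fs_measure \<Otimes>\<^sub>M (fs_measure \<Otimes>\<^sub>M (fs_measure \<Otimes>\<^sub>M fs_measure))) UNIV < \<infinity>"
proof -
  have fin: "finite_measure (fs_measure \<Otimes>\<^sub>M N)" if "finite_measure N" for N :: "'b measure"
    by (rule finite_measure_pair_measure[OF that fs.finite_measure_axioms])
  interpret M2: finite_measure "fs_measure \<Otimes>\<^sub>M fs_measure" by (rule fin) (rule fs.finite_measure_axioms)
  interpret M3: finite_measure "fs_measure \<Otimes>\<^sub>M (fs_measure \<Otimes>\<^sub>M fs_measure)" by (rule fin) (rule M2.finite_measure_axioms)
  interpret M4: finite_measure "fs_measure \<Otimes>\<^sub>M (fs_measure \<Otimes>\<^sub>M (fs_measure \<Otimes>\<^sub>M fs_measure))" by (rule fin) (rule M3.finite_measure_axioms)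
  note [measurable] = assms
  show "(\<integral>\<^sup>+y. f y \<partial>(fs_measure \<Otimes>\<^sub>M (fs_measure \<Otimes>\<^sub>M (fs_measure \<Otimes>\<^sub>M fs_measure)))) =
    (\<integral>\<^sup>+a. \<integral>\<^sup>+b. \<integral>\<^sup>+c. \<integral>\<^sup>+d. f (a, b, c, d) \<partial>fs_measure \<partial>fs_measure \<partial>fs_measure \<partial>fs_measure)"
    by (subst M3.nn_integral_fst[symmetric], measurable, subst M2.nn_integral_fst[symmetric], measurable, subst fs.nn_integral_fst[symmetric], measurable)
  show "sigma_finite_measure (fs_measure \<Otimes>\<^sub>M (fs_measure \<Otimes>\<^sub>M (fs_measure \<Otimes>\<^sub>M fs_measure)))"
    by (rule M4.sigma_finite_measure_axioms)
  show "emeasure (fs_measure \<Otimes>\<^sub>M (fs_measure \<Otimes>\<^sub>M (fs_measure \<Otimes>\<^sub>M fs_measure))) UNIV < \<infinity>"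
    unfolding infinity_ennreal_def top.not_eq_extremum[symmetric] by (rule M4.emeasure_finite)
qed

lemma swirl_integral_bound:
  assumes \<gamma>: "is_path \<gamma>"
  defines "J \<equiv> 2 * sing_int + sing_int" and "m \<equiv> emeasure fs_measure UNIV"
  shows "(\<integral>\<^sup>+y. swirl \<gamma> t (fst y) (fst (snd y)) (fst (snd (snd y))) (snd (snd (snd y)))
      \<partial>(fs_measure \<Otimes>\<^sub>M (fs_measure \<Otimes>\<^sub>M (fs_measure \<Otimes>\<^sub>M fs_measure))))
    \<le> 4 * (m * J * J) * (\<integral>\<^sup>+x. speed \<gamma> t x \<partial>fs_measure)"
proof -
  let ?M = "fs_measure \<Otimes>\<^sub>M (fs_measure \<Otimes>\<^sub>M (fs_measure \<Otimes>\<^sub>M fs_measure))"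
  let ?K = "m * J * J * (\<integral>\<^sup>+x. speed \<gamma> t x \<partial>fs_measure)"
  have w: "speed \<gamma> t \<in> borel_measurable borel"
    by (rule speed_measurable[OF \<gamma>, of "\<lambda>_. t" borel "\<lambda>x. x"]) auto
  have e: "inv_dist \<gamma> t \<in> borel_measurable (borel \<Otimes>\<^sub>M borel)"
    using inv_dist_measurable[OF \<gamma>, of "\<lambda>_. t" "borel \<Otimes>\<^sub>M borel" fst snd] by simp
  define f where "f = (\<lambda>(a :: (real^3) \<times> (real^3) \<times> (real^3) \<times> (real^3) \<Rightarrow> real^3) c d y. speed \<gamma> t (a y) * inv_dist \<gamma> t (a y, c y) * inv_dist \<gamma> t (a y, d y))"
  have f_meas: "f a c d \<in> borel_measurable ?M" if "a \<in> borel_measurable ?M" "c \<in> borel_measurable ?M" "d \<in> borel_measurable ?M" for a c d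
    unfolding f_def by (intro borel_measurable_times_ennreal speed_measurable inv_dist_measurable \<gamma> that) auto
  define y1 y2 y3 y4 where "y1 = (\<lambda>y::(real^3) \<times> (real^3) \<times> (real^3) \<times> (real^3). fst y)"
    and "y2 = (\<lambda>y::(real^3) \<times> (real^3) \<times> (real^3) \<times> (real^3). fst (snd y))"
    and "y3 = (\<lambda>y::(real^3) \<times> (real^3) \<times> (real^3) \<times> (real^3). fst (snd (snd y)))"
    and "y4 = (\<lambda>y::(real^3) \<times> (real^3) \<times> (real^3) \<times> (real^3). snd (snd (snd y)))"
  have ym: "y1 \<in> borel_measurable ?M" "y2 \<in> borel_measurable ?M" "y3 \<in> borel_measurable ?M" "y4 \<in> borel_measurable ?M"
    unfolding y1_def y2_def y3_def y4_def by measurable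
  note m = f_meas[OF ym(1,3,4)] f_meas[OF ym(2,3,4)] f_meas[OF ym(3,1,2)] f_meas[OF ym(4,1,2)]
  note four = four_point_integrals[OF w e, of J, folded m_def, OF inv_dist_bound[OF \<gamma>, of t, folded J_def]]
  have "(\<integral>\<^sup>+y. f y1 y3 y4 y \<partial>?M) \<le> ?K" "(\<integral>\<^sup>+y. f y2 y3 y4 y \<partial>?M) \<le> ?K" "(\<integral>\<^sup>+y. f y3 y1 y2 y \<partial>?M) \<le> ?K" "(\<integral>\<^sup>+y. f y4 y1 y2 y \<partial>?M) \<le> ?K"
    unfolding nn_integral_fs4(1)[OF m(1)] nn_integral_fs4(1)[OF m(2)] nn_integral_fs4(1)[OF m(3)] nn_integral_fs4(1)[OF m(4)]
    unfolding f_def y1_def y2_def y3_def y4_def fst_conv snd_conv by (rule four)+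
  then have le: "(\<integral>\<^sup>+y. f y1 y3 y4 y \<partial>?M) + (\<integral>\<^sup>+y. f y2 y3 y4 y \<partial>?M) + (\<integral>\<^sup>+y. f y3 y1 y2 y \<partial>?M) + (\<integral>\<^sup>+y. f y4 y1 y2 y \<partial>?M) \<le> ?K + ?K + ?K + ?K"
    by (intro add_mono)
  have "(\<integral>\<^sup>+y. swirl \<gamma> t (fst y) (fst (snd y)) (fst (snd (snd y))) (snd (snd (snd y))) \<partial>?M)
     = (\<integral>\<^sup>+y. f y1 y3 y4 y + f y2 y3 y4 y + f y3 y1 y2 y + f y4 y1 y2 y \<partial>?M)"
    by (simp add: swirl_def f_def y1_def y2_def y3_def y4_def)
  also have "\<dots> = (\<integral>\<^sup>+y. f y1 y3 y4 y \<partial>?M) + (\<integral>\<^sup>+y. f y2 y3 y4 y \<partial>?M) + (\<integral>\<^sup>+y. f y3 y1 y2 y \<partial>?M) + (\<integral>\<^sup>+y. f y4 y1 y2 y \<partial>?M)"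
    using m by (simp add: nn_integral_add)
  also note le
  also have "?K + ?K + ?K + ?K = 4 * (m * J * J) * (\<integral>\<^sup>+x. speed \<gamma> t x \<partial>fs_measure)"
  proof -
    have four: "(4::ennreal) = 1 + 1 + 1 + 1" by simp
    have "x + x + x + x = 4 * x" for x :: ennreal
      unfolding four by (simp only: distrib_right mult_1_left)
    then show ?thesis by (simp only: mult.assoc)
  qed
  finally show ?thesis .
qed

text \<open>The lower bound for rotation holds on a product of regions of positive measure, while
  the average over all quadruples is at most a multiple of the length. Fubini compares the
  two.\<close>

lemma length_growth:
  assumes p: "p \<ge> 1"
  shows "\<exists>D>0. \<forall>k\<ge>0. \<forall>\<gamma>. is_path \<gamma> \<longrightarrow> \<gamma> 0 = restrict id S2 \<longrightarrow> \<gamma> 1 = restrict (twist k) S2 \<longrightarrow> D * (k / 5 - 4 * pi) \<le> lp_length p \<gamma>"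
proof -
  let ?M = "fs_measure \<Otimes>\<^sub>M (fs_measure \<Otimes>\<^sub>M (fs_measure \<Otimes>\<^sub>M fs_measure))"
  define J where "J = 2 * sing_int + sing_int"
  define m where "m = emeasure fs_measure UNIV"
  \<comment> \<open>The moduli are ordered as \<open>twist_phase\<close> requires, the gap from 2 to
    3 separates the heights of the first two points, and 1 and 5 leave room for moving one into the
    other.\<close>
  define Z1 Z2 Z3 Z4 where "Z1 = {z. 1 < cmod z \<and> cmod z < 2}" and "Z2 = {z. 3 < cmod z \<and> cmod z < 4}"
    and "Z3 = {z. 5 < cmod z}" and "Z4 = {z. cmod z < 1}"
  have op: "open Z1" "open Z2" "open Z3" "open Z4"
    unfolding Z1_def Z2_def Z3_def Z4_def by (intro open_Collect_conj open_Collect_less continuous_intros)+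
  have ne: "Z1 \<noteq> {}" "Z2 \<noteq> {}" "Z3 \<noteq> {}" "Z4 \<noteq> {}"
  proof -
    have "of_real (3/2) \<in> Z1" "of_real (7/2) \<in> Z2" "of_real 6 \<in> Z3" "0 \<in> Z4"
      unfolding Z1_def Z2_def Z3_def Z4_def mem_Collect_eq norm_of_real by auto
    then show "Z1 \<noteq> {}" "Z2 \<noteq> {}" "Z3 \<noteq> {}" "Z4 \<noteq> {}" by blast+
  qed
  note [measurable] = region_borel[OF op(1)] region_borel[OF op(2)] region_borel[OF op(3)] region_borel[OF op(4)]
  define R where "R = region Z1 \<times> (region Z2 \<times> (region Z3 \<times> region Z4))"
  have R_meas [measurable]: "R \<in> sets ?M" unfolding R_def by simp
  have sf: "sigma_finite_measure ?M" and fM: "emeasure ?M UNIV < \<infinity>" using nn_integral_fs4[of "\<lambda>_. 0"] by auto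
  interpret M: sigma_finite_measure ?M by (rule sf)
  have "emeasure ?M R = emeasure fs_measure (region Z1) * (emeasure fs_measure (region Z2) * (emeasure fs_measure (region Z3) * emeasure fs_measure (region Z4)))"
  proof -
    interpret M2: pair_sigma_finite fs_measure fs_measure by standard
    interpret M3: pair_sigma_finite fs_measure "fs_measure \<Otimes>\<^sub>M fs_measure" by standard
    show ?thesis unfolding R_def by (simp add: M3.P.emeasure_pair_measure_Times M2.P.emeasure_pair_measure_Times fs.emeasure_pair_measure_Times)
  qed
  then have "emeasure ?M R \<noteq> 0"
    using region_positive[OF op(1) ne(1)] region_positive[OF op(2) ne(2)] region_positive[OF op(3) ne(3)] region_positive[OF op(4) ne(4)]
    by auto
  moreover have "emeasure ?M R < \<infinity>"
  proof (rule order_le_less_trans[OF emeasure_mono fM])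
    show "UNIV \<in> sets ?M" using sets.top[of ?M] by (simp add: space_pair_measure)
  qed simp
  ultimately obtain r where r: "emeasure ?M R = ennreal r" "r > 0"
    by (cases "emeasure ?M R") (auto simp: top_unique less_top)
  have "8 * (4 * (m * J * J)) < \<infinity>"
    using sing_finite fs_finite by (simp add: J_def m_def sing_int_def ennreal_mult_less_top)
  then obtain C where C: "8 * (4 * (m * J * J)) = ennreal C" "C \<ge> 0" by (cases "8 * (4 * (m * J * J))") auto
  define K where "K = C * (2 * (measure fs_measure UNIV + 1))"
  have K: "K \<ge> 0" using C by (simp add: K_def)
  show ?thesis
  proof (intro exI conjI allI impI)
    \<comment> \<open>\<open>r\<close> is the measure of the set of good quadruples; the 1 guards
      against K = 0.\<close>
    show "r / (K + 1) > 0" using r K by simp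
    fix k \<gamma> assume k: "(k::real) \<ge> 0" and \<gamma>: "is_path \<gamma>" "\<gamma> 0 = restrict id S2" "\<gamma> 1 = restrict (twist k) S2"
    let ?s = "\<lambda>t y. swirl \<gamma> t (fst y) (fst (snd y)) (fst (snd (snd y))) (snd (snd (snd y)))"
    have s_meas: "(\<lambda>z. ?s (fst z) (snd z)) \<in> borel_measurable (lborel \<Otimes>\<^sub>M ?M)"
      by (rule swirl_measurable[OF \<gamma>(1)]) measurable
    have "ennreal (k / 5 - 4 * pi) * emeasure ?M R = (\<integral>\<^sup>+y. ennreal (k / 5 - 4 * pi) * indicator R y \<partial>?M)"
      by (rule nn_integral_cmult_indicator[OF R_meas, symmetric])
    also have "\<dots> \<le> (\<integral>\<^sup>+y. 8 * (\<integral>\<^sup>+t. ?s t y \<partial>lborel) \<partial>?M)"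
    proof (rule nn_integral_mono)
      fix y :: "(real^3) \<times> (real^3) \<times> (real^3) \<times> (real^3)"
      obtain a b c d where y: "y = (a, b, c, d)" by (cases y) auto
      show "ennreal (k / 5 - 4 * pi) * indicator R y \<le> 8 * (\<integral>\<^sup>+t. ?s t y \<partial>lborel)"
      proof (cases "y \<in> R")
        case True
        then have "a \<in> region Z1" "b \<in> region Z2" "c \<in> region Z3" "d \<in> region Z4" by (auto simp: R_def y)
        then obtain z1 z2 z3 z4 where "z1 \<in> Z1" "z2 \<in> Z2" "z3 \<in> Z3" "z4 \<in> Z4" "a = affine_chart z1" "b = affine_chart z2" "c = affine_chart z3" "d = affine_chart z4"
          using region_chart by metis
        then have "ennreal (k / 5 - 4 * pi) \<le> 8 * (\<integral>\<^sup>+t. swirl \<gamma> t a b c d \<partial>lborel)"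
          by (intro swirl_lower_bound[OF \<gamma> k, of z4 z1 z2 z3]) (auto simp: Z1_def Z2_def Z3_def Z4_def)
        then show ?thesis using True by (simp add: y)
      qed simp
    qed
    also have "\<dots> = 8 * (\<integral>\<^sup>+y. \<integral>\<^sup>+t. ?s t y \<partial>lborel \<partial>?M)"
    proof (rule nn_integral_cmult)
      have "(\<lambda>z. ?s (snd z) (fst z)) \<in> borel_measurable (?M \<Otimes>\<^sub>M lborel)"
        by (rule swirl_measurable[OF \<gamma>(1)]) measurable
      then show "(\<lambda>y. \<integral>\<^sup>+t. ?s t y \<partial>lborel) \<in> borel_measurable ?M"
        by (intro lborel.borel_measurable_nn_integral) (simp add: case_prod_unfold)
    qed
    also have "(\<integral>\<^sup>+y. \<integral>\<^sup>+t. ?s t y \<partial>lborel \<partial>?M) = (\<integral>\<^sup>+t. \<integral>\<^sup>+y. ?s t y \<partial>?M \<partial>lborel)"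
    proof -
      interpret pair_sigma_finite lborel ?M by standard
      show ?thesis using Fubini'[of ?s] s_meas by (simp add: case_prod_unfold)
    qed
    also have "\<dots> \<le> (\<integral>\<^sup>+t. 4 * (m * J * J) * (\<integral>\<^sup>+x. speed \<gamma> t x \<partial>fs_measure) \<partial>lborel)"
    proof (rule nn_integral_mono)
      fix t
      show "(\<integral>\<^sup>+y. ?s t y \<partial>?M) \<le> 4 * (m * J * J) * (\<integral>\<^sup>+x. speed \<gamma> t x \<partial>fs_measure)"
        unfolding m_def J_def by (rule swirl_integral_bound[OF \<gamma>(1)])
    qed
    also have "\<dots> = 4 * (m * J * J) * (\<integral>\<^sup>+t. \<integral>\<^sup>+x. speed \<gamma> t x \<partial>fs_measure \<partial>lborel)"
    proof (rule nn_integral_cmult)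
      have "(\<lambda>z. speed \<gamma> (fst z) (snd z)) \<in> borel_measurable (lborel \<Otimes>\<^sub>M fs_measure)"
        by (rule speed_measurable[OF \<gamma>(1)]) measurable
      then show "(\<lambda>t. \<integral>\<^sup>+x. speed \<gamma> t x \<partial>fs_measure) \<in> borel_measurable lborel"
        by (intro fs.borel_measurable_nn_integral) (simp add: case_prod_unfold)
    qed
    also have "\<dots> \<le> 4 * (m * J * J) * (ennreal (2 * (measure fs_measure UNIV + 1)) * ennreal (lp_length p \<gamma>))"
      unfolding speed_def by (rule mult_left_mono[OF lp_length_lower_bound(1)[OF \<gamma>(1) p]]) simp
    finally have "ennreal (k / 5 - 4 * pi) * ennreal r \<le> 8 * (4 * (m * J * J) * (ennreal (2 * (measure fs_measure UNIV + 1)) * ennreal (lp_length p \<gamma>)))"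
      unfolding r by (simp add: mult_left_mono)
    also have "\<dots> = 8 * (4 * (m * J * J)) * (ennreal (2 * (measure fs_measure UNIV + 1)) * ennreal (lp_length p \<gamma>))"
      by (simp only: mult.assoc)
    also have "\<dots> = ennreal (K * lp_length p \<gamma>)"
    proof -
      have g: "ennreal x * (ennreal y * ennreal z) = ennreal (x * y * z)" if "x \<ge> 0" "y \<ge> 0" "z \<ge> 0" for x y z
        using that by (simp add: ennreal_mult mult.assoc)
      show ?thesis unfolding C(1) K_def by (rule g) (use C(2) lp_length_lower_bound(2)[OF \<gamma>(1) p] in auto)
    qed
    finally have le: "ennreal (k / 5 - 4 * pi) * ennreal r \<le> ennreal (K * lp_length p \<gamma>)" .
    have nn: "K * lp_length p \<gamma> \<ge> 0" using K lp_length_lower_bound(2)[OF \<gamma>(1) p] by simp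
    \<comment> \<open>Return from \<open>ennreal\<close>, where a negative left factor would have
      been lost; in that case the claim follows from nonnegative length.\<close>
    have "(k / 5 - 4 * pi) * r \<le> K * lp_length p \<gamma>"
    proof (cases "k / 5 - 4 * pi \<ge> 0")
      case True
      then have "ennreal ((k / 5 - 4 * pi) * r) \<le> ennreal (K * lp_length p \<gamma>)"
        using le r(2) by (simp only: ennreal_mult less_imp_le)
      then show ?thesis using nn by (simp only: ennreal_le_iff)
    next
      case False
      then have "(k / 5 - 4 * pi) * r \<le> 0" using r(2) by (intro mult_nonpos_nonneg) auto
      then show ?thesis using nn by linarith
    qed
    also have "\<dots> \<le> (K + 1) * lp_length p \<gamma>"
      using lp_length_lower_bound(2)[OF \<gamma>(1) p] by (intro mult_right_mono) auto
    finally show "r / (K + 1) * (k / 5 - 4 * pi) \<le> lp_length p \<gamma>"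
      using K by (simp add: field_simps)
  qed
qed

section \<open>From path lengths to the two metrics\<close>

lemma homotopic_endpoints: "(\<alpha>, \<beta>) \<in> homotopy_rel \<Longrightarrow> is_path \<beta> \<and> \<beta> 0 = restrict id S2 \<and> \<beta> 1 = \<alpha> 1"
  unfolding homotopy_rel_def based_paths_def by auto (metis atLeastAtMost_iff order_refl zero_le_one)

lemma twist_path_1: "twist_path k 1 = restrict (twist k) S2"
  by (simp add: twist_path_def)

lemma twist_path_zero: "twist_path 0 t = restrict id S2"
  by (auto simp: twist_path_def)

theorem corollary3:
  fixes p :: real
  assumes "p > 2"
  shows "\<not> bdd_above {dist_cover p A B | A B. A \<in> universal_cover \<and> B \<in> universal_cover} \<and>
         \<not> bdd_above {dist_G p \<phi> \<psi> | \<phi> \<psi>. \<phi> \<in> area_diffeos \<and> \<psi> \<in> area_diffeos}"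
proof -
  have "p \<ge> 1" using assms by simp
  then obtain D where D: "D > 0" and len: "\<And>k \<gamma>. k \<ge> 0 \<Longrightarrow> is_path \<gamma> \<Longrightarrow> \<gamma> 0 = restrict id S2 \<Longrightarrow> \<gamma> 1 = restrict (twist k) S2 \<Longrightarrow> D * (k / 5 - 4 * pi) \<le> lp_length p \<gamma>"
    using length_growth by blast
  have unbounded: "\<not> bdd_above S" if *: "\<And>k. k \<ge> 0 \<Longrightarrow> \<exists>x\<in>S. D * (k / 5 - 4 * pi) \<le> x" for S :: "real set"
  proof
    assume "bdd_above S"
    then obtain b where b: "\<And>x. x \<in> S \<Longrightarrow> x \<le> b" unfolding bdd_above_def by blast
    \<comment> \<open>Chosen so that the lower bound equals |b| + 1.\<close>
    define k where "k = 5 * ((\<bar>b\<bar> + 1) / D + 4 * pi)"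
    have "k \<ge> 0" using D by (simp add: k_def)
    then obtain x where "x \<in> S" "D * (k / 5 - 4 * pi) \<le> x" using * by blast
    moreover have "k / 5 - 4 * pi = (\<bar>b\<bar> + 1) / D" unfolding k_def by (subst nonzero_mult_div_cancel_left) simp_all
    then have "D * (k / 5 - 4 * pi) = \<bar>b\<bar> + 1" using D by simp
    ultimately show False using b[of x] by linarith
  qed
  have "\<exists>x\<in>{dist_G p \<phi> \<psi> | \<phi> \<psi>. \<phi> \<in> area_diffeos \<and> \<psi> \<in> area_diffeos}. D * (k / 5 - 4 * pi) \<le> x" if k: "k \<ge> 0" for k
  proof
    show "dist_G p (restrict id S2) (restrict (twist k) S2) \<in> {dist_G p \<phi> \<psi> | \<phi> \<psi>. \<phi> \<in> area_diffeos \<and> \<psi> \<in> area_diffeos}"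
      using twist_area_diffeo[of 0] twist_area_diffeo[of k] twist_path_zero[of 1] twist_path_1[of 0] by auto
    show "D * (k / 5 - 4 * pi) \<le> dist_G p (restrict id S2) (restrict (twist k) S2)"
      unfolding dist_G_def
    proof (rule cInf_greatest)
      show "{lp_length p \<gamma> |\<gamma>. is_path \<gamma> \<and> \<gamma> 0 = restrict id S2 \<and> \<gamma> 1 = restrict (twist k) S2} \<noteq> {}"
        using twist_path_is_path[of k] twist_path_0[of k] twist_path_1[of k] by blast
    qed (use len k in blast)
  qed
  moreover have "\<exists>x\<in>{dist_cover p A B | A B. A \<in> universal_cover \<and> B \<in> universal_cover}. D * (k / 5 - 4 * pi) \<le> x" if k: "k \<ge> 0" for k
  proof
    define A B where "A = homotopy_rel `` {twist_path 0}" and "B = homotopy_rel `` {twist_path k}"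
    show "dist_cover p A B \<in> {dist_cover p A B | A B. A \<in> universal_cover \<and> B \<in> universal_cover}"
      unfolding universal_cover_def A_def B_def using twist_path_based by (blast intro: quotientI)
    \<comment> \<open>A union over all representatives of both factors. It suffices that it contains
      \<open>twist_path k\<close> and that all its elements end at the same twist.\<close>
    let ?X = "cover_mult B (cover_inv A)"
    have inv: "restrict (inv_into S2 (restrict id S2)) S2 = restrict id S2"
      by (rule restrict_ext, rule inv_into_f_eq) (auto simp: inj_on_def)
    have comp: "compose S2 (restrict f S2) (restrict id S2) = restrict f S2" for f :: "real^3 \<Rightarrow> real^3"
      by (auto simp: compose_def)
    have "twist_path 0 \<in> A" "twist_path k \<in> B" unfolding A_def B_def by (simp_all add: twist_path_homotopic)
    moreover have "twist_path 0 \<in> cover_inv A"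
      unfolding cover_inv_def
    proof (rule UN_I[OF \<open>twist_path 0 \<in> A\<close>])
      have "(\<lambda>t. restrict (inv_into S2 (twist_path 0 t)) S2) = twist_path 0" by (rule ext) (simp only: twist_path_zero inv)
      then show "twist_path 0 \<in> homotopy_rel `` {\<lambda>t. restrict (inv_into S2 (twist_path 0 t)) S2}"
        by (simp add: twist_path_homotopic)
    qed
    moreover have "(\<lambda>t. compose S2 (twist_path k t) (twist_path 0 t)) = twist_path k"
      unfolding twist_path_zero unfolding twist_path_def comp ..
    ultimately have "twist_path k \<in> ?X"
      unfolding cover_mult_def using twist_path_homotopic[of k] by (intro UN_I[of "twist_path k"] UN_I[of "twist_path 0"]) simp_all
    \<comment> \<open>Homotopies fix the time-one map, so the endpoint of \<delta> is that of
      \<open>twist_path k\<close> composed with an inverse of the identity, for every choice of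
      representatives.\<close>
    moreover have "D * (k / 5 - 4 * pi) \<le> lp_length p \<delta>" if \<delta>: "\<delta> \<in> ?X" for \<delta>
    proof -
      obtain \<alpha> \<beta> where ab: "\<alpha> \<in> B" "\<beta> \<in> cover_inv A" "((\<lambda>t. compose S2 (\<alpha> t) (\<beta> t)), \<delta>) \<in> homotopy_rel"
        using \<delta> unfolding cover_mult_def by blast
      obtain \<alpha>' where a': "\<alpha>' \<in> A" "((\<lambda>t. restrict (inv_into S2 (\<alpha>' t)) S2), \<beta>) \<in> homotopy_rel"
        using ab(2) unfolding cover_inv_def by blast
      have "\<alpha>' 1 = restrict id S2" using a'(1) homotopic_endpoints[of "twist_path 0" \<alpha>'] unfolding A_def twist_path_zero by auto
      then have "\<beta> 1 = restrict id S2" using homotopic_endpoints[OF a'(2)] inv by simp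
      moreover have "\<alpha> 1 = restrict (twist k) S2" using ab(1) homotopic_endpoints[of "twist_path k" \<alpha>] unfolding B_def twist_path_1 by auto
      ultimately have "\<delta> 1 = restrict (twist k) S2" using homotopic_endpoints[OF ab(3)] comp by simp
      then show ?thesis using homotopic_endpoints[OF ab(3)] len[OF k] by blast
    qed
    ultimately show "D * (k / 5 - 4 * pi) \<le> dist_cover p A B"
      unfolding dist_cover_def cover_norm_def by (intro cInf_greatest) auto
  qed
  ultimately show ?thesis using unbounded by simp
qed

end
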